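(* Let $k\ge 2$, let $p,q\ge 0$ be fixed with $p+q\le 1$, and let $G_{n;\beta_1,\ldots,\beta_k}(p,q)$ be a random $k$-partite signed graph on $n$ vertices whose parts have sizes $n\beta_i$, where $\beta_i=\beta_i(n)$ and $\lim_{n\to\infty}\beta_i(n)>0$ for $i=1,2,\ldots,k$. Then almost surely $$n^{3/2}\left(1-\sum_{i=1}^k\beta_i^{3/2}\right)\le \mathcal{E}(G_{n;\beta_1,\ldots,\beta_k}(p,q))\left(\frac{8}{3\pi}\sqrt{p+q-(p-q)^2}+o(1)\right)^{-1}\le n^{3/2}\left(1+\sum_{i=1}^k\beta_i^{3/2}\right),$$ where $o(1)$ denotes a quantity tending to $0$ as $n\to\infty$.
   Context: A signed graph is a simple graph in which each edge is labeled positive or negative. Its adjacency matrix is the symmetric matrix with $(i,j)$ entry $+1$ if $v_iv_j$ is a positive edge, $-1$ if $v_iv_j$ is a negative edge, and $0$ otherwise. The energy $\mathcal{E}(\Gamma)$ of a signed graph $\Gamma$ is the sum of the absolute values of the eigenvalues of its adjacency matrix, counted with multiplicity. $K_{n;\beta_1,\ldots,\beta_k}$ denotes the complete $k$-partite graph on vertex set $V=\{v_1,\ldots,v_n\}$ with parts $V_1,\ldots,V_k$, where $|V_i|=n\beta_i=n\beta_i(n)$ (so $\sum_{i=1}^k\beta_i=1$). The random $k$-partite signed graph $G_{n;\beta_1,\ldots,\beta_k}(p,q)$ is obtained as follows: independently for each edge of $K_{n;\beta_1,\ldots,\beta_k}$ (i.e. each pair of vertices in different parts), the pair is joined by a positive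 edge with probability $p$, by a negative edge with probability $q$, and is not joined with probability $1-p-q$; there are no edges inside a part. "Almost surely" means "with probability tending to $1$ as $n\to\infty$".
   Formalization: For p=q=0 the graph is edgeless with energy 0 and the stated lower bound fails for every o(1); whenever 8/(3π)·sqrt(p+q-(p-q)^2)+o(1)=0 the display is read with the inverse cleared, i.e. as energy = 0, which changes the claim only for p=q=0. *)

theory Defs
  imports "HOL-Probability.Probability" "Jordan_Normal_Form.Char_Poly"
begin

datatype edge_sign = Pos | Neg

text \<open>
  A signed graph on the vertices \<open>{0..<n}\<close> is a partial map whose domain is the edge set (a set of
  two-element sets of vertices) and whose values are the signs of the edges.
\<close>

type_synonym signed_graph = "nat set \<rightharpoonup> edge_sign"

definition adjacency_matrix :: "nat \<Rightarrow> signed_graph \<Rightarrow> real mat" where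
  "adjacency_matrix n G = mat n n (\<lambda>(i, j).
     case G {i, j} of Some Pos \<Rightarrow> 1 | Some Neg \<Rightarrow> - 1 | None \<Rightarrow> 0)"

text \<open>
  The multiplicity of an eigenvalue is its order as a root of the characteristic polynomial. The
  adjacency matrix is real symmetric, so it has no non-real eigenvalues.
\<close>

definition energy :: "nat \<Rightarrow> signed_graph \<Rightarrow> real" where
  "energy n G = (let A = adjacency_matrix n G in
     \<Sum>x | eigenvalue A x. real (Polynomial.order x (char_poly A)) * \<bar>x\<bar>)"

definition multipartite_edges :: "nat \<Rightarrow> (nat \<Rightarrow> nat set) \<Rightarrow> nat set set" where
  "multipartite_edges k V =
     {{u, v} | u v i j. i \<in> {1..k} \<and> j \<in> {1..k} \<and> i \<noteq> j \<and> u \<in> V i \<and> v \<in> V j}"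

definition edge_pmf :: "real \<Rightarrow> real \<Rightarrow> edge_sign option pmf" where
  "edge_pmf p q = pmf_of_list [(Some Pos, p), (Some Neg, q), (None, 1 - p - q)]"

definition random_multipartite ::
    "nat \<Rightarrow> (nat \<Rightarrow> nat set) \<Rightarrow> real \<Rightarrow> real \<Rightarrow> signed_graph pmf" where
  "random_multipartite k V p q = Pi_pmf (multipartite_edges k V) None (\<lambda>_. edge_pmf p q)"

end

theory Submission
  imports Defs "Jordan_Normal_Form.Spectral_Radius" "HOL-Real_Asymp.Real_Asymp"
begin

text \<open>
  The energy is the nuclear norm, which satisfies the triangle inequality. Centring the entries changes
  the matrix by a multiple of the adjacency matrix of the complete multipartite graph, whose nuclear
  norm is at most \<open>2 n\<close>. The centred matrix is \<open>W - \<Sum>\<^sub>i W\<^sub>i\<close>, where \<open>W\<close> is a Wigner matrix of size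
  \<open>n\<close> and \<open>W\<^sub>i\<close> its diagonal block on the \<open>i\<close>-th part, again a Wigner matrix. A Wigner matrix of size
  \<open>m\<close> with entry variance \<open>\<sigma>\<^sup>2\<close> has mean nuclear norm asymptotic to \<open>8 / (3 \<pi>) \<sigma> m\<^sup>3\<^sup>/\<^sup>2\<close>, so the mean energy
  lies between the two bounds up to \<open>o(n\<^sup>3\<^sup>/\<^sup>2)\<close>. Changing one edge changes the energy by at most 4, so
  the variance of the energy is \<open>O(n\<^sup>2)\<close> and the energy concentrates around its mean.

  The asymptotics for Wigner matrices come from Coulson's formula
  \<open>\<bar>d\<bar> = 2 / \<pi> \<integral>\<^sub>0\<^sup>\<infinity> d\<^sup>2 / (d\<^sup>2 + y\<^sup>2) dy\<close>, which involves the resolvent on the imaginary axis only. Its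
  normalised mean trace \<open>s\<close> satisfies \<open>s\<^sup>2 - i y s + 1 = o(1)\<close>, by expanding the resolvent in each single
  entry; dominated convergence then gives the constant
  \<open>2 / \<pi> \<integral>\<^sub>0\<^sup>\<infinity> (1 + y (y - \<surd>(y\<^sup>2 + 4)) / 2) dy = 8 / (3 \<pi>)\<close>. If \<open>\<sigma> = 0\<close>, the graph is deterministic.
\<close>

section \<open>Spectral theorem for real symmetric matrices\<close>

text \<open>The constant 8 / (3 pi) is the mean of |x| under the semicircle law of variance 1,
  although that law never appears. Weak convergence of the spectrum would need an extra argument to
  reach the unbounded function |x|; integrating over y leaves only the bounded functions d^2 / (d^2
  + y^2), with a second-moment bound as majorant. On the imaginary axis the sign of Im s is known
  beforehand, which singles out the right root at each y > 0 without a continuity argument in the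
  spectral parameter.

  The factors 1 - S and 1 + S, with S the sum of the powers \<beta>_i^(3/2), are the two sides of
  the triangle inequality: a block of size n \<beta>_i has a norm smaller than that of W by the
  factor \<beta>_i^(3/2). Since the blocks live on the parts, matrices are functions on arbitrary
  finite index sets; a block is then the same function on a smaller set, and nothing is
  renumbered.\<close>

definition mmul :: "'i set \<Rightarrow> ('i \<Rightarrow> 'i \<Rightarrow> 'c) \<Rightarrow> ('i \<Rightarrow> 'i \<Rightarrow> 'c) \<Rightarrow> 'i \<Rightarrow> 'i \<Rightarrow> 'c::comm_semiring_1" where
  "mmul U a b i j = (\<Sum>k\<in>U. a i k * b k j)"

lemma mmul_assoc: "mmul U (mmul U a b) c i j = mmul U a (mmul U b c) i j"
proof -
  have "mmul U (mmul U a b) c i j = (\<Sum>k\<in>U. \<Sum>l\<in>U. a i l * b l k * c k j)"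
    by (simp add: mmul_def sum_distrib_right)
  also have "\<dots> = (\<Sum>l\<in>U. \<Sum>k\<in>U. a i l * b l k * c k j)"
    by (rule sum.swap)
  also have "\<dots> = mmul U a (mmul U b c) i j"
    by (simp add: mmul_def sum_distrib_left mult.assoc)
  finally show ?thesis .
qed

lemma mmul_cong:
  "(\<And>k. k \<in> U \<Longrightarrow> a i k = a' i k) \<Longrightarrow> (\<And>k. k \<in> U \<Longrightarrow> b k j = b' k j)
    \<Longrightarrow> mmul U a b i j = mmul U a' b' i j"
  by (simp add: mmul_def)

definition unit_matrix :: "'i \<Rightarrow> 'i \<Rightarrow> 'c::comm_semiring_1" where
  "unit_matrix i j = (if i = j then 1 else 0)"

lemma mmul_unit_left [simp]: "finite U \<Longrightarrow> i \<in> U \<Longrightarrow> mmul U unit_matrix a i j = a i j"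
  by (simp add: mmul_def unit_matrix_def if_distrib[of "\<lambda>x. x * _"] sum.delta cong: if_cong)

lemma mmul_unit_right [simp]: "finite U \<Longrightarrow> j \<in> U \<Longrightarrow> mmul U a unit_matrix i j = a i j"
  by (simp add: mmul_def unit_matrix_def if_distrib[of "\<lambda>x. _ * x"] sum.delta' cong: if_cong)

lemma mmul_unit_left':
  assumes "finite U" "i \<in> U" "\<And>k. k \<in> U \<Longrightarrow> m i k = unit_matrix i k"
  shows "mmul U m a i j = a i j"
  using mmul_cong[of U m i unit_matrix a j a] assms by simp

lemma mmul_unit_right':
  assumes "finite U" "j \<in> U" "\<And>k. k \<in> U \<Longrightarrow> m k j = unit_matrix k j"
  shows "mmul U a m i j = a i j"
  using mmul_cong[of U a i a m j unit_matrix] assms by simp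

text \<open>
  Eigenvalues and eigenvectors are indexed by \<open>U\<close> itself: \<open>u k\<close> is the eigenvector of \<open>d k\<close>.
\<close>

definition eigensystem :: "'i set \<Rightarrow> ('i \<Rightarrow> 'i \<Rightarrow> real) \<Rightarrow> ('i \<Rightarrow> real) \<Rightarrow> ('i \<Rightarrow> 'i \<Rightarrow> real) \<Rightarrow> bool" where
  "eigensystem U a d u \<longleftrightarrow>
    (\<forall>i\<in>U. \<forall>j\<in>U. (\<Sum>k\<in>U. u k i * u k j) = unit_matrix i j) \<and>
    (\<forall>k\<in>U. \<forall>l\<in>U. (\<Sum>i\<in>U. u k i * u l i) = unit_matrix k l) \<and>
    (\<forall>i\<in>U. \<forall>j\<in>U. a i j = (\<Sum>k\<in>U. d k * u k i * u k j))"

section \<open>Diagonalisation by deflation\<close>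

text \<open>The complexified matrix has some eigenvector. Symmetry makes its quadratic form real,
  hence the eigenvalue too, and then the real or the imaginary part of the vector is a nonzero real
  eigenvector.\<close>

lemma symmetric_unit_eigenvector:
  fixes a :: "nat \<Rightarrow> nat \<Rightarrow> real"
  assumes n: "n > 0" and sym: "\<And>i j. i < n \<Longrightarrow> j < n \<Longrightarrow> a i j = a j i"
  shows "\<exists>l v. (\<Sum>i<n. (v i)\<^sup>2) = 1 \<and> (\<forall>i<n. (\<Sum>j<n. a i j * v j) = l * v i)"
proof -
  define A where "A = mat n n (\<lambda>(i, j). complex_of_real (a i j))"
  have A: "A \<in> carrier_mat n n" by (simp add: A_def)
  obtain l where "eigenvalue A l"
    using spectrum_non_empty[OF A n] by (auto simp: spectrum_def)
  then obtain w where w: "w \<in> carrier_vec n" "w \<noteq> 0\<^sub>v n" "A *\<^sub>v w = l \<cdot>\<^sub>v w"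
    using A by (auto simp: eigenvalue_def eigenvector_def)
  have ev: "(\<Sum>j<n. complex_of_real (a i j) * w $ j) = l * w $ i" if "i < n" for i
  proof -
    have "(A *\<^sub>v w) $ i = (\<Sum>j<n. complex_of_real (a i j) * w $ j)"
      using that w(1) by (auto simp: A_def scalar_prod_def lessThan_atLeast0 intro!: sum.cong)
    then show ?thesis using that w by simp
  qed
  define N where "N = (\<Sum>i<n. (cmod (w $ i))\<^sup>2)"
  have "\<exists>i<n. w $ i \<noteq> 0"
    using w(1,2) by (auto simp: vec_eq_iff)
  then have N: "N > 0"
    unfolding N_def by (auto intro: sum_pos2)
  have "l * N = (\<Sum>i<n. cnj (w $ i) * (l * w $ i))"
    by (simp add: N_def sum_distrib_left complex_norm_square mult_ac flip: of_real_power)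
  also have "\<dots> = (\<Sum>i<n. \<Sum>j<n. a i j * cnj (w $ i) * w $ j)"
    by (intro sum.cong refl) (simp flip: ev add: sum_distrib_left mult_ac)
  finally have Q: "l * N = (\<Sum>i<n. \<Sum>j<n. a i j * cnj (w $ i) * w $ j)" .
  then have "cnj (l * N) = (\<Sum>i<n. \<Sum>j<n. a i j * w $ i * cnj (w $ j))"
    by simp
  also have "\<dots> = (\<Sum>j<n. \<Sum>i<n. a i j * w $ i * cnj (w $ j))"
    by (rule sum.swap)
  also have "\<dots> = (\<Sum>i<n. \<Sum>j<n. a i j * cnj (w $ i) * w $ j)"
    by (intro sum.cong refl) (simp add: sym)
  finally have "cnj (l * N) = l * N" using Q by (simp only:)
  then have l: "l = of_real (Re l)"
    using N by (auto simp: complex_eq_iff)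
  have evr: "(\<Sum>j<n. a i j * Re (w $ j)) = Re l * Re (w $ i)"
    and evi: "(\<Sum>j<n. a i j * Im (w $ j)) = Re l * Im (w $ i)" if "i < n" for i
    using arg_cong[OF ev[OF that], of Re] arg_cong[OF ev[OF that], of Im] l
    by (auto simp: complex_eq_iff)
  have "\<exists>x. (\<exists>i<n. x i \<noteq> 0) \<and> (\<forall>i<n. (\<Sum>j<n. a i j * x j) = Re l * x i)"
  proof (cases "\<exists>i<n. Re (w $ i) \<noteq> 0")
    case True
    then show ?thesis using evr by (intro exI[of _ "\<lambda>i. Re (w $ i)"]) auto
  next
    case False
    then show ?thesis using evi \<open>\<exists>i<n. w $ i \<noteq> 0\<close>
      by (intro exI[of _ "\<lambda>i. Im (w $ i)"]) (auto simp: complex_eq_iff)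
  qed
  then obtain x where x: "\<exists>i<n. x i \<noteq> 0" "\<And>i. i < n \<Longrightarrow> (\<Sum>j<n. a i j * x j) = Re l * x i"
    by blast
  define M where "M = (\<Sum>i<n. (x i)\<^sup>2)"
  have M: "M > 0"
    using x(1) unfolding M_def by (auto intro: sum_pos2)
  show ?thesis
  proof (intro exI conjI allI impI)
    show "(\<Sum>i<n. (x i / sqrt M)\<^sup>2) = 1"
      using M by (simp add: power_divide flip: sum_divide_distrib M_def)
    show "(\<Sum>j<n. a i j * (x j / sqrt M)) = Re l * (x i / sqrt M)" if "i < n" for i
      using x(2)[OF that] by (simp flip: sum_divide_distrib)
  qed
qed

text \<open>The reflection in the hyperplane orthogonal to v - e_z exchanges the unit vectors e_z
  and v. It is symmetric and its own inverse, which keeps conjugation simple.\<close>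

lemma householder:
  fixes v :: "'i \<Rightarrow> real"
  assumes U: "finite U" "z \<in> U" and v: "(\<Sum>i\<in>U. (v i)\<^sup>2) = 1"
  shows "\<exists>q. (\<forall>i j. q i j = q j i) \<and> (\<forall>i\<in>U. \<forall>j\<in>U. mmul U q q i j = unit_matrix i j) \<and>
    (\<forall>i\<in>U. q i z = v i)"
proof (cases "v z = 1")
  case True
  have "(\<Sum>i\<in>U - {z}. (v i)\<^sup>2) = 0"
    using v True U by (simp add: sum.remove)
  then have "v i = 0" if "i \<in> U" "i \<noteq> z" for i
    using that U by (subst (asm) sum_nonneg_eq_0_iff) auto
  then show ?thesis using U True
    by (intro exI[of _ unit_matrix]) (auto simp: unit_matrix_def mmul_unit_left)
next
  case False
  define w where "w = (\<lambda>i. v i - unit_matrix i z)"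
  \<comment> \<open>The reflection is 1 - 2 w w^T / |w|^2, and |w|^2 = 2 - 2 v_z; the excluded case
    v_z = 1 is w = 0.\<close>
  define c where "c = 1 / (1 - v z)"
  have "(\<Sum>i\<in>U. w i * w i) = (\<Sum>i\<in>U. (v i)\<^sup>2 - 2 * (v i * unit_matrix i z) + unit_matrix i z)"
    by (intro sum.cong refl) (auto simp: w_def unit_matrix_def power2_eq_square algebra_simps)
  also have "\<dots> = 2 - 2 * v z"
    using U v by (simp add: sum.distrib sum_subtractf unit_matrix_def flip: sum_distrib_left)
       (simp add: if_distrib[of "\<lambda>x. _ * x"] cong: if_cong)
  finally have ww: "(\<Sum>i\<in>U. w i * w i) = 2 - 2 * v z" .
  have cw: "c * (\<Sum>i\<in>U. w i * w i) = 2"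
    using False by (simp add: ww c_def field_simps)
  define q where "q = (\<lambda>i j. unit_matrix i j - c * w i * w j)"
  have "mmul U q q i j = unit_matrix i j" if "i \<in> U" "j \<in> U" for i j
  proof -
    have "mmul U q q i j = (\<Sum>k\<in>U. unit_matrix i k * unit_matrix k j) - c * w i * (\<Sum>k\<in>U. w k * unit_matrix k j)
        - c * w j * (\<Sum>k\<in>U. unit_matrix i k * w k) + c * w i * w j * (c * (\<Sum>k\<in>U. w k * w k))"
      by (simp add: mmul_def q_def algebra_simps sum.distrib sum_subtractf sum_distrib_left)
    also have "(\<Sum>k\<in>U. unit_matrix i k * unit_matrix k j) = (unit_matrix i j :: real)"
      using mmul_unit_left[of U i unit_matrix j] that U by (simp add: mmul_def)
    also have "(\<Sum>k\<in>U. w k * unit_matrix k j) = w j"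
      using mmul_unit_right[of U j "\<lambda>_. w" i] that U by (simp add: mmul_def)
    also have "(\<Sum>k\<in>U. unit_matrix i k * w k) = w i"
      using mmul_unit_left[of U i "\<lambda>k _. w k" j] that U by (simp add: mmul_def)
    finally show ?thesis unfolding cw by simp
  qed
  moreover have "q i z = v i" for i
    using False by (simp add: q_def w_def c_def unit_matrix_def field_simps)
  ultimately show ?thesis
    by (intro exI[of _ q]) (auto simp: q_def unit_matrix_def)
qed

text \<open>Carries an eigensystem back from the deflated matrix: the rows of
  \<open>mmul U u q\<close> are the old eigenvectors reflected by \<open>q\<close>.\<close>

lemma eigensystem_conjugate:
  assumes U: "finite U" and b: "eigensystem U b d u"
    and q: "\<And>i j. q i j = q j i" "\<And>i j. i \<in> U \<Longrightarrow> j \<in> U \<Longrightarrow> mmul U q q i j = unit_matrix i j"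
  shows "eigensystem U (mmul U (mmul U q b) q) d (mmul U u q)"
proof -
  let ?t = "\<lambda>a i j. a j i"
  have tr: "mmul U u q k i = mmul U q (?t u) i k" for k i
    by (simp add: mmul_def q(1)[of i] mult.commute)
  have b1: "mmul U (?t u) u i j = unit_matrix i j" and b2: "mmul U u (?t u) i j = unit_matrix i j"
    and b3: "b i j = mmul U (?t u) (\<lambda>k i. d k * u k i) i j" if "i \<in> U" "j \<in> U" for i j
    using b that by (auto simp: eigensystem_def mmul_def mult_ac)
  have "(\<Sum>k\<in>U. mmul U u q k i * mmul U u q k j) = unit_matrix i j" if ij: "i \<in> U" "j \<in> U" for i j
  proof -
    have "(\<Sum>k\<in>U. mmul U u q k i * mmul U u q k j) = mmul U (mmul U q (?t u)) (mmul U u q) i j"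
      by (simp add: mmul_def[of U "mmul U q (?t u)"] tr)
    also have "\<dots> = mmul U q (mmul U (mmul U (?t u) u) q) i j"
      by (simp add: mmul_assoc cong: mmul_cong)
    also have "\<dots> = mmul U q q i j"
      using U by (intro mmul_cong refl mmul_unit_left') (auto simp: b1)
    finally show ?thesis using q(2) ij by simp
  qed
  moreover have "(\<Sum>i\<in>U. mmul U u q k i * mmul U u q l i) = unit_matrix k l" if kl: "k \<in> U" "l \<in> U" for k l
  proof -
    have "(\<Sum>i\<in>U. mmul U u q k i * mmul U u q l i) = mmul U (mmul U u q) (mmul U q (?t u)) k l"
      by (simp add: mmul_def[of U "mmul U u q"] flip: tr)
    also have "\<dots> = mmul U u (mmul U (mmul U q q) (?t u)) k l"
      by (simp add: mmul_assoc cong: mmul_cong)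
    also have "\<dots> = mmul U u (?t u) k l"
      using U by (intro mmul_cong refl mmul_unit_left') (auto simp: q(2))
    finally show ?thesis using b2 kl by simp
  qed
  moreover have "mmul U (mmul U q b) q i j = (\<Sum>k\<in>U. d k * mmul U u q k i * mmul U u q k j)"
    if ij: "i \<in> U" "j \<in> U" for i j
  proof -
    have "mmul U (mmul U q b) q i j = mmul U (mmul U q (mmul U (?t u) (\<lambda>k i. d k * u k i))) q i j"
      using b3 by (intro mmul_cong refl)
    also have "\<dots> = mmul U (mmul U q (?t u)) (mmul U (\<lambda>k i. d k * u k i) q) i j"
      by (simp add: mmul_assoc cong: mmul_cong)
    also have "\<dots> = (\<Sum>k\<in>U. mmul U u q k i * (d k * mmul U u q k j))"
      by (simp add: mmul_def[of U "mmul U q (?t u)"] flip: tr)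
         (simp add: mmul_def[of U "\<lambda>k i. d k * u k i"] mmul_def[of U u _ _ j] sum_distrib_left mult.assoc)
    also have "\<dots> = (\<Sum>k\<in>U. d k * mmul U u q k i * mmul U u q k j)"
      by (simp add: mult_ac)
    finally show ?thesis .
  qed
  ultimately show ?thesis
    by (auto simp: eigensystem_def)
qed

lemma eigensystem_cong:
  assumes "\<And>i j. i \<in> U \<Longrightarrow> j \<in> U \<Longrightarrow> a i j = b i j"
  shows "eigensystem U a d u \<longleftrightarrow> eigensystem U b d u"
  using assms by (auto simp: eigensystem_def)

text \<open>After a unit eigenvector is reflected onto the last basis vector, the last row and
  column vanish off the diagonal, and the remaining symmetric block has size
  \<open>n\<close>.\<close>

lemma symmetric_eigensystem_nat:
  fixes a :: "nat \<Rightarrow> nat \<Rightarrow> real"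
  assumes "\<And>i j. i < n \<Longrightarrow> j < n \<Longrightarrow> a i j = a j i"
  shows "\<exists>d u. eigensystem {..<n} a d u"
  using assms
proof (induction n arbitrary: a)
  case 0
  show ?case by (simp add: eigensystem_def)
next
  case (Suc n)
  let ?U = "{..<Suc n}"
  obtain l v where v: "(\<Sum>i\<in>?U. (v i)\<^sup>2) = 1" "\<And>i. i \<in> ?U \<Longrightarrow> (\<Sum>j\<in>?U. a i j * v j) = l * v i"
    using symmetric_unit_eigenvector[of "Suc n" a] Suc.prems by blast
  obtain q where q: "\<And>i j. q i j = q j i" "\<And>i j. i \<in> ?U \<Longrightarrow> j \<in> ?U \<Longrightarrow> mmul ?U q q i j = unit_matrix i j"
     "\<And>i. i \<in> ?U \<Longrightarrow> q i n = v i"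
    using householder[of ?U n v] v(1) by blast
  define b where "b = mmul ?U (mmul ?U q a) q"
  have bsym: "b i j = b j i" if "i \<in> ?U" "j \<in> ?U" for i j
  proof -
    have "b j i = (\<Sum>k\<in>?U. \<Sum>m\<in>?U. q j m * a m k * q k i)"
      by (simp only: b_def mmul_def sum_distrib_right)
    also have "\<dots> = (\<Sum>k\<in>?U. \<Sum>m\<in>?U. q i k * a k m * q m j)"
      using Suc.prems by (intro sum.cong refl) (simp add: q(1)[of j] q(1)[of _ i])
    also have "\<dots> = (\<Sum>m\<in>?U. \<Sum>k\<in>?U. q i k * a k m * q m j)"
      by (rule sum.swap)
    also have "\<dots> = b i j"
      by (simp only: b_def mmul_def sum_distrib_right)
    finally show ?thesis by simp
  qed
  have bn: "b i n = l * unit_matrix i n" if "i \<in> ?U" for i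
  proof -
    have "b i n = mmul ?U q (mmul ?U a q) i n"
      by (simp add: b_def mmul_assoc)
    also have "\<dots> = mmul ?U q (\<lambda>i j. l * q i j) i n"
    proof (intro mmul_cong refl)
      fix k assume k: "k \<in> ?U"
      have "mmul ?U a q k n = (\<Sum>j\<in>?U. a k j * v j)"
        unfolding mmul_def by (intro sum.cong refl) (simp add: q(3))
      then show "mmul ?U a q k n = l * q k n"
        using v(2)[OF k] q(3)[OF k] by simp
    qed
    also have "\<dots> = l * mmul ?U q q i n"
      by (simp add: mmul_def sum_distrib_left mult_ac del: sum.lessThan_Suc)
    also have "\<dots> = l * unit_matrix i n"
      using q(2)[OF that, of n] by simp
    finally show ?thesis .
  qed
  obtain d u where du: "eigensystem {..<n} b d u"
    using Suc.IH[of b] bsym by auto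
  \<comment> \<open>The eigensystem of the block is extended by the last basis vector with
    eigenvalue \<open>l\<close>, overwriting whatever \<open>d\<close> and \<open>u\<close> are
    outside the block.\<close>
  define d1 where "d1 = d(n := l)"
  define u1 where "u1 = (\<lambda>k i. if k = n \<or> i = n then unit_matrix k i else u k i)"
  have s: "(\<Sum>k<n. u1 k i * u1 k j) = (if i = n \<or> j = n then 0 else \<Sum>k<n. u k i * u k j)"
    "(\<Sum>k<n. u1 i k * u1 j k) = (if i = n \<or> j = n then 0 else \<Sum>k<n. u i k * u j k)"
    "(\<Sum>k<n. d1 k * u1 k i * u1 k j) = (if i = n \<or> j = n then 0 else \<Sum>k<n. d k * u k i * u k j)" for i j
    by (auto simp: u1_def d1_def unit_matrix_def intro!: sum.cong sum.neutral)
  have "eigensystem ?U b d1 u1"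
    unfolding eigensystem_def
  proof (intro conjI ballI)
    fix i j assume ij: "i \<in> ?U" "j \<in> ?U"
    show "(\<Sum>k\<in>?U. u1 k i * u1 k j) = unit_matrix i j" "(\<Sum>k\<in>?U. u1 i k * u1 j k) = unit_matrix i j"
      using ij du by (auto simp: s eigensystem_def less_Suc_eq) (auto simp: u1_def unit_matrix_def)
    show "b i j = (\<Sum>k\<in>?U. d1 k * u1 k i * u1 k j)"
    proof (cases "i = n \<or> j = n")
      case True
      then show ?thesis using bn[of i] bn[of j] bsym[OF ij] ij
        by (auto simp: s) (auto simp: u1_def d1_def unit_matrix_def)
    next
      case False
      then show ?thesis using ij du
        by (auto simp: s eigensystem_def) (auto simp: u1_def d1_def unit_matrix_def)
    qed
  qed
  then have "eigensystem ?U (mmul ?U (mmul ?U q b) q) d1 (mmul ?U u1 q)"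
    using q by (intro eigensystem_conjugate) auto
  \<comment> \<open>Conjugating twice by the involution \<open>q\<close> returns the original
    matrix.\<close>
  moreover have "mmul ?U (mmul ?U q b) q i j = a i j" if ij: "i \<in> ?U" "j \<in> ?U" for i j
  proof -
    have "mmul ?U (mmul ?U q b) q i j = mmul ?U (mmul ?U (mmul ?U q q) a) (mmul ?U q q) i j"
      by (simp add: b_def mmul_assoc cong: mmul_cong del: sum.lessThan_Suc)
    also have "\<dots> = mmul ?U (mmul ?U q q) a i j"
      using q(2) ij by (intro mmul_unit_right') auto
    also have "\<dots> = a i j"
      using q(2) ij by (intro mmul_unit_left') auto
    finally show ?thesis .
  qed
  ultimately have "eigensystem ?U a d1 (mmul ?U u1 q)"
    by (subst eigensystem_cong[where b = "mmul ?U (mmul ?U q b) q"]) auto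
  then show ?case by blast
qed

lemma symmetric_eigensystem:
  assumes U: "finite U" and sym: "\<And>i j. i \<in> U \<Longrightarrow> j \<in> U \<Longrightarrow> a i j = a j i"
  shows "\<exists>d u. eigensystem U a d u"
proof -
  obtain f where f: "bij_betw f U {..<card U}"
    using ex_bij_betw_finite_nat[OF U] by (auto simp: atLeast0LessThan)
  define g where "g = the_inv_into U f"
  have g: "bij_betw g {..<card U} U"
    using f by (simp add: g_def bij_betw_the_inv_into)
  have gf: "g (f i) = i" if "i \<in> U" for i
    using f that by (simp add: g_def the_inv_into_f_f bij_betw_def)
  have fU: "f i \<in> {..<card U}" if "i \<in> U" for i
    using f that by (auto simp: bij_betw_def)
  have finj: "f i = f j \<longleftrightarrow> i = j" if "i \<in> U" "j \<in> U" for i j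
    using f that by (auto simp: bij_betw_def inj_on_def)
  obtain d u where du: "eigensystem {..<card U} (\<lambda>i j. a (g i) (g j)) d u"
    using symmetric_eigensystem_nat[of "card U" "\<lambda>i j. a (g i) (g j)"] sym bij_betwE[OF g]
    by auto
  have r: "(\<Sum>k\<in>U. F (f k)) = (\<Sum>k<card U. F k)" for F :: "nat \<Rightarrow> real"
    using f by (rule sum.reindex_bij_betw)
  have aij: "a i j = (\<Sum>k<card U. d k * u k (f i) * u k (f j))" if "i \<in> U" "j \<in> U" for i j
  proof -
    have "\<forall>i\<in>{..<card U}. \<forall>j\<in>{..<card U}. a (g i) (g j) = (\<Sum>k<card U. d k * u k i * u k j)"
      using du by (simp add: eigensystem_def)
    from this[rule_format, OF fU[OF that(1)] fU[OF that(2)]] show ?thesis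
      by (simp add: gf that)
  qed
  have "eigensystem U a (\<lambda>k. d (f k)) (\<lambda>k i. u (f k) (f i))"
    unfolding eigensystem_def r[of "\<lambda>k. u k _ * u k _"] r[of "\<lambda>k. u _ k * u _ k"]
      r[of "\<lambda>k. d k * u k _ * u k _"]
    using du fU by (auto simp: eigensystem_def finj unit_matrix_def aij)
  then show ?thesis by blast
qed

section \<open>Nuclear norm and energy\<close>

text \<open>The unit ball of the operator norm, written as a bilinear form on vectors of length at
  most 1; restricting to a subset of indices then amounts to padding vectors by zero.\<close>

definition contraction :: "'i set \<Rightarrow> ('i \<Rightarrow> 'i \<Rightarrow> real) \<Rightarrow> bool" where
  "contraction U c \<longleftrightarrow> (\<forall>x y. (\<Sum>i\<in>U. (x i)\<^sup>2) \<le> 1 \<longrightarrow> (\<Sum>i\<in>U. (y i)\<^sup>2) \<le> 1 \<longrightarrow>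
     (\<Sum>i\<in>U. \<Sum>j\<in>U. c i j * (x i * y j)) \<le> 1)"

text \<open>
  The nuclear norm, defined by duality with the operator norm to make the triangle inequality immediate.
\<close>

definition nuc :: "'i set \<Rightarrow> ('i \<Rightarrow> 'i \<Rightarrow> real) \<Rightarrow> real" where
  "nuc U a = (SUP c\<in>{c. contraction U c}. \<Sum>i\<in>U. \<Sum>j\<in>U. a i j * c i j)"

lemma contraction_zero: "contraction U (\<lambda>_ _. 0)"
  by (simp add: contraction_def)

lemma contraction_uminus:
  assumes "contraction U c"
  shows "contraction U (\<lambda>i j. - c i j)"
  unfolding contraction_def
proof (intro allI impI)
  fix x y :: "'a \<Rightarrow> real"
  assume "(\<Sum>i\<in>U. (x i)\<^sup>2) \<le> 1" "(\<Sum>i\<in>U. (y i)\<^sup>2) \<le> 1"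
  then have "(\<Sum>i\<in>U. \<Sum>j\<in>U. c i j * (- x i * y j)) \<le> 1"
    by (intro assms[unfolded contraction_def, rule_format]) auto
  then show "(\<Sum>i\<in>U. \<Sum>j\<in>U. - c i j * (x i * y j)) \<le> 1" by simp
qed

lemma contraction_bilinear:
  assumes U: "finite U" and c: "contraction U c" and X: "(\<Sum>i\<in>U. (x i)\<^sup>2) \<le> X" "X \<ge> 0"
    and Y: "(\<Sum>i\<in>U. (y i)\<^sup>2) \<le> Y" "Y \<ge> 0"
  shows "(\<Sum>i\<in>U. \<Sum>j\<in>U. c i j * (x i * y j)) \<le> sqrt X * sqrt Y"
proof (cases "X = 0 \<or> Y = 0")
  case True
  have "\<forall>i\<in>U. f i = 0" if "(\<Sum>i\<in>U. (f i)\<^sup>2) \<le> 0" for f :: "'a \<Rightarrow> real"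
  proof -
    have "(\<Sum>i\<in>U. (f i)\<^sup>2) = 0"
      using that by (intro antisym sum_nonneg) auto
    then show ?thesis using U by (simp add: sum_nonneg_eq_0_iff)
  qed
  then have "(\<forall>i\<in>U. x i = 0) \<or> (\<forall>i\<in>U. y i = 0)"
    using True X(1) Y(1) by blast
  then show ?thesis using X Y by auto
next
  case False
  then have XY: "X > 0" "Y > 0" using X Y by auto
  have "(\<Sum>i\<in>U. \<Sum>j\<in>U. c i j * (x i / sqrt X * (y j / sqrt Y))) \<le> 1"
    using c X(1) Y(1) XY unfolding contraction_def
    by (elim allE[of _ "\<lambda>i. x i / sqrt X"] allE[of _ "\<lambda>i. y i / sqrt Y"])
       (simp add: power_divide flip: sum_divide_distrib)
  also have "(\<Sum>i\<in>U. \<Sum>j\<in>U. c i j * (x i / sqrt X * (y j / sqrt Y)))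
      = (\<Sum>i\<in>U. \<Sum>j\<in>U. c i j * (x i * y j)) / (sqrt X * sqrt Y)"
    by (simp add: sum_divide_distrib)
  finally show ?thesis using XY by (simp add: field_simps)
qed

lemma contraction_subset:
  assumes "finite U" "V \<subseteq> U" "contraction U c"
  shows "contraction V c"
  unfolding contraction_def
proof (intro allI impI)
  fix x y :: "'a \<Rightarrow> real"
  assume xy: "(\<Sum>i\<in>V. (x i)\<^sup>2) \<le> 1" "(\<Sum>i\<in>V. (y i)\<^sup>2) \<le> 1"
  have s: "(\<Sum>i\<in>U. if i \<in> V then f i else 0) = sum f V" for f :: "'a \<Rightarrow> real"
    using assms by (simp add: sum.inter_restrict[symmetric] Int_absorb1)
  let ?x = "\<lambda>i. if i \<in> V then x i else 0" and ?y = "\<lambda>i. if i \<in> V then y i else 0"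
  have "(\<Sum>i\<in>U. \<Sum>j\<in>U. c i j * (?x i * ?y j)) = (\<Sum>i\<in>U. if i \<in> V then (\<Sum>j\<in>U. if j \<in> V then c i j * (x i * y j) else 0) else 0)"
    by (intro sum.cong refl) (auto intro!: sum.cong)
  also have "\<dots> = (\<Sum>i\<in>V. \<Sum>j\<in>V. c i j * (x i * y j))"
    by (simp add: s)
  finally have *: "(\<Sum>i\<in>U. \<Sum>j\<in>U. c i j * (?x i * ?y j)) = (\<Sum>i\<in>V. \<Sum>j\<in>V. c i j * (x i * y j))" .
  have "(\<Sum>i\<in>U. (?x i)\<^sup>2) = (\<Sum>i\<in>V. (x i)\<^sup>2)" "(\<Sum>i\<in>U. (?y i)\<^sup>2) = (\<Sum>i\<in>V. (y i)\<^sup>2)"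
    by (simp_all add: if_distrib[of "\<lambda>x. x\<^sup>2"] s cong: if_cong)
  with xy assms(3) * show "(\<Sum>i\<in>V. \<Sum>j\<in>V. c i j * (x i * y j)) \<le> 1"
    using assms(3)[unfolded contraction_def, rule_format, of ?x ?y] by simp
qed

lemma contraction_entry:
  assumes U: "finite U" "i \<in> U" "j \<in> U" and c: "contraction U c"
  shows "\<bar>c i j\<bar> \<le> 1"
proof -
  \<comment> \<open>Pairing \<open>s\<close> times one basis vector with another, for both signs of
    \<open>s\<close>, bounds the absolute value of the entry.\<close>
  have *: "c i j * s \<le> 1" if "s = 1 \<or> s = -1" for s
  proof -
    have "(\<Sum>k\<in>U. \<Sum>l\<in>U. c k l * ((if k = i then s else 0) * (if l = j then 1 else 0))) \<le> 1"
      using c unfolding contraction_def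
      by (elim allE[of _ "\<lambda>k. if k = i then s else 0"] allE[of _ "\<lambda>l. if l = j then 1 else 0"])
         (use U that in \<open>auto simp: if_distrib[of "\<lambda>x. x\<^sup>2"] cong: if_cong\<close>)
    also have "(\<Sum>k\<in>U. \<Sum>l\<in>U. c k l * ((if k = i then s else 0) * (if l = j then 1 else 0))) =
        (\<Sum>k\<in>U. if k = i then (\<Sum>l\<in>U. if l = j then c i j * s else 0) else 0)"
      by (intro sum.cong refl) (auto intro!: sum.cong)
    also have "\<dots> = c i j * s"
      using U by simp
    finally show ?thesis .
  qed
  show ?thesis using *[of 1] *[of "-1"] by auto
qed

text \<open>A supremum of reals is informative only over a set bounded above; entries of a
  contraction are at most 1 in absolute value, which bounds every pairing.\<close>

lemma nuc_bdd:
  assumes "finite U"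
  shows "bdd_above ((\<lambda>c. \<Sum>i\<in>U. \<Sum>j\<in>U. a i j * c i j) ` {c. contraction U c})"
proof (rule bdd_aboveI2)
  fix c assume c: "c \<in> {c. contraction U c}"
  show "(\<Sum>i\<in>U. \<Sum>j\<in>U. a i j * c i j) \<le> (\<Sum>i\<in>U. \<Sum>j\<in>U. \<bar>a i j\<bar>)"
  proof (intro sum_mono)
    fix i j assume "i \<in> U" "j \<in> U"
    then have "\<bar>a i j\<bar> * \<bar>c i j\<bar> \<le> \<bar>a i j\<bar> * 1"
      using c assms by (intro mult_left_mono contraction_entry[of U]) auto
    then show "a i j * c i j \<le> \<bar>a i j\<bar>" by (simp flip: abs_mult)
  qed
qed

lemma nuc_upper:
  assumes "finite U" "contraction U c"
  shows "(\<Sum>i\<in>U. \<Sum>j\<in>U. a i j * c i j) \<le> nuc U a"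
  unfolding nuc_def using assms by (intro cSUP_upper nuc_bdd) auto

lemma nuc_least:
  assumes "\<And>c. contraction U c \<Longrightarrow> (\<Sum>i\<in>U. \<Sum>j\<in>U. a i j * c i j) \<le> B"
  shows "nuc U a \<le> B"
  unfolding nuc_def using assms contraction_zero by (intro cSUP_least) auto

lemma nuc_cong:
  assumes "\<And>i j. i \<in> U \<Longrightarrow> j \<in> U \<Longrightarrow> a i j = b i j"
  shows "nuc U a = nuc U b"
  unfolding nuc_def using assms by (intro SUP_cong refl sum.cong) auto

lemma nuc_nonneg: "finite U \<Longrightarrow> nuc U a \<ge> 0"
  using nuc_upper[OF _ contraction_zero, of U a] by simp

lemma nuc_zero: "nuc U (\<lambda>_ _. 0) = 0"
  unfolding nuc_def using contraction_zero[of U] by (simp, subst cSUP_const) auto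

lemma nuc_add:
  assumes "finite U"
  shows "nuc U (\<lambda>i j. a i j + b i j) \<le> nuc U a + nuc U b"
proof (rule nuc_least)
  fix c assume "contraction U c"
  then show "(\<Sum>i\<in>U. \<Sum>j\<in>U. (a i j + b i j) * c i j) \<le> nuc U a + nuc U b"
    using nuc_upper[of U c a] nuc_upper[of U c b] assms by (simp add: algebra_simps sum.distrib)
qed

lemma nuc_sum:
  assumes "finite U"
  shows "nuc U (\<lambda>i j. \<Sum>l\<in>L. a l i j) \<le> (\<Sum>l\<in>L. nuc U (a l))"
proof (induction L rule: infinite_finite_induct)
  case (insert l L)
  then show ?case
    using nuc_add[OF assms, of "a l" "\<lambda>i j. \<Sum>l\<in>L. a l i j"] by simp
qed (simp_all add: nuc_zero)

text \<open>The sign of \<open>t\<close> is absorbed into the test matrix, which stays a contraction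
  or becomes zero.\<close>

lemma nuc_scale_le:
  assumes "finite U"
  shows "nuc U (\<lambda>i j. t * a i j) \<le> \<bar>t\<bar> * nuc U a"
proof (rule nuc_least)
  fix c assume c: "contraction U c"
  have "(\<Sum>i\<in>U. \<Sum>j\<in>U. a i j * (sgn t * c i j)) \<le> nuc U a"
    using c contraction_uminus[OF c] contraction_zero by (intro nuc_upper assms) (auto simp: sgn_if)
  from mult_left_mono[OF this, of "\<bar>t\<bar>"]
  have "(\<Sum>i\<in>U. \<Sum>j\<in>U. (\<bar>t\<bar> * sgn t) * a i j * c i j) \<le> \<bar>t\<bar> * nuc U a"
    by (simp add: sum_distrib_left mult_ac)
  then show "(\<Sum>i\<in>U. \<Sum>j\<in>U. t * a i j * c i j) \<le> \<bar>t\<bar> * nuc U a"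
    by (simp add: abs_mult_sgn)
qed

lemma nuc_scale:
  assumes "finite U"
  shows "nuc U (\<lambda>i j. t * a i j) = \<bar>t\<bar> * nuc U a"
proof (cases "t = 0")
  case True
  then show ?thesis by (simp add: nuc_zero)
next
  case False
  have "\<bar>t\<bar> * nuc U (\<lambda>i j. inverse t * (t * a i j)) \<le> \<bar>t\<bar> * (\<bar>inverse t\<bar> * nuc U (\<lambda>i j. t * a i j))"
    by (intro mult_left_mono nuc_scale_le assms) auto
  also have "\<dots> = nuc U (\<lambda>i j. t * a i j)"
    using False by (simp add: field_simps)
  finally have "\<bar>t\<bar> * nuc U a \<le> nuc U (\<lambda>i j. t * a i j)"
    using False by (simp add: mult.assoc[symmetric])
  then show ?thesis using nuc_scale_le[OF assms, of t a] by simp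
qed

lemma nuc_diff:
  assumes "finite U"
  shows "\<bar>nuc U a - nuc U b\<bar> \<le> nuc U (\<lambda>i j. a i j - b i j)"
proof -
  have "nuc U (\<lambda>i j. (a i j - b i j) + b i j) \<le> nuc U (\<lambda>i j. a i j - b i j) + nuc U b"
    by (rule nuc_add[OF assms])
  moreover have "nuc U (\<lambda>i j. - 1 * (a i j - b i j) + a i j) \<le> nuc U (\<lambda>i j. - 1 * (a i j - b i j)) + nuc U a"
    by (rule nuc_add[OF assms])
  ultimately show ?thesis
    unfolding nuc_scale[OF assms] by simp
qed

text \<open>A test matrix on \<open>U\<close> is still a contraction on the index set
  \<open>V\<close>, so padding a block by zeros does not increase its norm.\<close>

lemma nuc_restrict:
  assumes "finite U" "V \<subseteq> U"
  shows "nuc U (\<lambda>i j. if i \<in> V \<and> j \<in> V then a i j else 0) \<le> nuc V a"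
proof (rule nuc_least)
  fix c assume c: "contraction U c"
  have s: "(\<Sum>i\<in>U. if i \<in> V then f i else 0) = sum f V" for f :: "'a \<Rightarrow> real"
    using assms by (simp add: sum.inter_restrict[symmetric] Int_absorb1)
  have "(\<Sum>i\<in>U. \<Sum>j\<in>U. (if i \<in> V \<and> j \<in> V then a i j else 0) * c i j)
      = (\<Sum>i\<in>U. if i \<in> V then \<Sum>j\<in>U. if j \<in> V then a i j * c i j else 0 else 0)"
    by (intro sum.cong refl) (auto intro!: sum.cong)
  also have "\<dots> = (\<Sum>i\<in>V. \<Sum>j\<in>V. a i j * c i j)"
    by (simp add: s)
  also have "\<dots> \<le> nuc V a"
    using assms c by (intro nuc_upper contraction_subset[of U V]) (auto intro: finite_subset)
  finally show "(\<Sum>i\<in>U. \<Sum>j\<in>U. (if i \<in> V \<and> j \<in> V then a i j else 0) * c i j) \<le> nuc V a" .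
qed

text \<open>The all-ones matrix has rank one: its pairing with \<open>c\<close> is the form of
  \<open>c\<close> at the constant vector, whose squared length is \<open>card U\<close>.\<close>

lemma nuc_const_le:
  assumes "finite U"
  shows "nuc U (\<lambda>_ _. 1) \<le> card U"
proof (rule nuc_least)
  fix c assume c: "contraction U c"
  show "(\<Sum>i\<in>U. \<Sum>j\<in>U. 1 * c i j) \<le> real (card U)"
    using contraction_bilinear[OF assms c, of "\<lambda>_. 1" "card U" "\<lambda>_. 1" "card U"]
    by (simp add: mult_ac)
qed

text \<open>An edge occupies two symmetric positions, each worth at most |t|; this limits how far
  one edge can move the energy.\<close>

lemma nuc_two_entries:
  assumes "finite U"
  shows "nuc U (\<lambda>i j. if {i, j} = {k, l} then t else 0) \<le> 2 * \<bar>t\<bar>"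
proof (rule nuc_least)
  fix c assume c: "contraction U c"
  have "(\<Sum>i\<in>U. \<Sum>j\<in>U. (if {i, j} = {k, l} then t else 0) * c i j)
      \<le> (\<Sum>i\<in>U. \<Sum>j\<in>U. if {i, j} = {k, l} then \<bar>t\<bar> else 0)"
  proof (intro sum_mono)
    fix i j assume "i \<in> U" "j \<in> U"
    then have "\<bar>t\<bar> * \<bar>c i j\<bar> \<le> \<bar>t\<bar> * 1"
      using c assms by (intro mult_left_mono contraction_entry[of U]) auto
    then have "t * c i j \<le> \<bar>t\<bar>"
      by (simp flip: abs_mult)
    then show "(if {i, j} = {k, l} then t else 0) * c i j \<le> (if {i, j} = {k, l} then \<bar>t\<bar> else 0)"
      by simp
  qed
  also have "\<dots> \<le> (\<Sum>i\<in>U. \<Sum>j\<in>U. (if i = k then if j = l then \<bar>t\<bar> else 0 else 0) + (if i = l then if j = k then \<bar>t\<bar> else 0 else 0))"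
    by (intro sum_mono) (auto simp: doubleton_eq_iff)
  also have "\<dots> = (\<Sum>i\<in>U. (if i = k then \<Sum>j\<in>U. if j = l then \<bar>t\<bar> else 0 else 0) + (if i = l then \<Sum>j\<in>U. if j = k then \<bar>t\<bar> else 0 else 0))"
    by (intro sum.cong refl) (auto simp: sum.distrib)
  also have "\<dots> \<le> 2 * \<bar>t\<bar>"
    using assms by (simp add: sum.distrib)
  finally show "(\<Sum>i\<in>U. \<Sum>j\<in>U. (if {i, j} = {k, l} then t else 0) * c i j) \<le> 2 * \<bar>t\<bar>" .
qed

section \<open>The nuclear norm in terms of eigenvalues\<close>

lemma eigensystem_parseval:
  assumes "eigensystem U a d u" "finite U"
  shows "(\<Sum>k\<in>U. (\<Sum>i\<in>U. u k i * x i)\<^sup>2) = (\<Sum>i\<in>U. (x i)\<^sup>2)"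
proof -
  have "(\<Sum>k\<in>U. (\<Sum>i\<in>U. u k i * x i)\<^sup>2) = (\<Sum>k\<in>U. \<Sum>i\<in>U. \<Sum>j\<in>U. u k i * u k j * (x i * x j))"
    by (simp add: power2_eq_square sum_product mult_ac)
  also have "\<dots> = (\<Sum>i\<in>U. \<Sum>k\<in>U. \<Sum>j\<in>U. u k i * u k j * (x i * x j))"
    by (rule sum.swap)
  also have "\<dots> = (\<Sum>i\<in>U. \<Sum>j\<in>U. \<Sum>k\<in>U. u k i * u k j * (x i * x j))"
    by (intro sum.cong refl sum.swap)
  also have "\<dots> = (\<Sum>i\<in>U. \<Sum>j\<in>U. unit_matrix i j * (x i * x j))"
    using assms by (intro sum.cong refl) (simp add: eigensystem_def flip: sum_distrib_right)
  also have "\<dots> = (\<Sum>i\<in>U. (x i)\<^sup>2)"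
    using assms(2) by (intro sum.cong refl)
      (simp add: unit_matrix_def if_distrib[of "\<lambda>z. z * _"] power2_eq_square cong: if_cong)
  finally show ?thesis .
qed

text \<open>In the eigenbasis the pairing with \<open>c\<close> combines the diagonal values of
  \<open>c\<close>, each at most 1 in absolute value. Equality is attained at the sign of the
  matrix, where every eigenvalue is replaced by its sign.\<close>

lemma nuc_eigensystem:
  assumes e: "eigensystem U a d u" and U: "finite U"
  shows "nuc U a = (\<Sum>k\<in>U. \<bar>d k\<bar>)"
proof (rule antisym)
  have expand: "(\<Sum>i\<in>U. \<Sum>j\<in>U. a i j * c i j) = (\<Sum>k\<in>U. d k * (\<Sum>i\<in>U. \<Sum>j\<in>U. c i j * (u k i * u k j)))" for c
  proof -
    have "(\<Sum>i\<in>U. \<Sum>j\<in>U. a i j * c i j) = (\<Sum>i\<in>U. \<Sum>j\<in>U. \<Sum>k\<in>U. d k * (c i j * (u k i * u k j)))"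
      using e by (intro sum.cong refl) (simp add: eigensystem_def sum_distrib_left mult_ac)
    also have "\<dots> = (\<Sum>i\<in>U. \<Sum>k\<in>U. \<Sum>j\<in>U. d k * (c i j * (u k i * u k j)))"
      by (intro sum.cong refl sum.swap)
    also have "\<dots> = (\<Sum>k\<in>U. \<Sum>i\<in>U. \<Sum>j\<in>U. d k * (c i j * (u k i * u k j)))"
      by (rule sum.swap)
    finally show ?thesis by (simp add: sum_distrib_left)
  qed
  have norm1: "(\<Sum>i\<in>U. (u k i)\<^sup>2) = 1" if "k \<in> U" for k
    using e that by (simp add: eigensystem_def power2_eq_square unit_matrix_def)
  show "nuc U a \<le> (\<Sum>k\<in>U. \<bar>d k\<bar>)"
  proof (rule nuc_least)
    fix c assume c: "contraction U c"
    show "(\<Sum>i\<in>U. \<Sum>j\<in>U. a i j * c i j) \<le> (\<Sum>k\<in>U. \<bar>d k\<bar>)"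
      unfolding expand
    proof (rule sum_mono)
      fix k assume k: "k \<in> U"
      let ?q = "\<lambda>c. \<Sum>i\<in>U. \<Sum>j\<in>U. c i j * (u k i * u k j)"
      have "?q c \<le> 1" "?q (\<lambda>i j. - c i j) \<le> 1"
        using c contraction_uminus[OF c] norm1[OF k] unfolding contraction_def by auto
      then have "\<bar>?q c\<bar> \<le> 1" by (simp add: sum_negf)
      then have "\<bar>d k\<bar> * \<bar>?q c\<bar> \<le> \<bar>d k\<bar> * 1"
        by (intro mult_left_mono) auto
      then show "d k * ?q c \<le> \<bar>d k\<bar>" by (simp flip: abs_mult)
    qed
  qed
  define c where "c = (\<lambda>i j. \<Sum>k\<in>U. sgn (d k) * (u k i * u k j))"
  have "contraction U c"
    unfolding contraction_def
  proof (intro allI impI)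
    fix x y :: "'a \<Rightarrow> real"
    assume xy: "(\<Sum>i\<in>U. (x i)\<^sup>2) \<le> 1" "(\<Sum>i\<in>U. (y i)\<^sup>2) \<le> 1"
    let ?h = "\<lambda>x k. \<Sum>i\<in>U. u k i * x i"
    have "(\<Sum>i\<in>U. \<Sum>j\<in>U. c i j * (x i * y j)) = (\<Sum>i\<in>U. \<Sum>j\<in>U. \<Sum>k\<in>U. sgn (d k) * (u k i * x i * (u k j * y j)))"
      by (simp add: c_def sum_distrib_left sum_distrib_right mult_ac)
    also have "\<dots> = (\<Sum>i\<in>U. \<Sum>k\<in>U. \<Sum>j\<in>U. sgn (d k) * (u k i * x i * (u k j * y j)))"
      by (intro sum.cong refl sum.swap)
    also have "\<dots> = (\<Sum>k\<in>U. \<Sum>i\<in>U. \<Sum>j\<in>U. sgn (d k) * (u k i * x i * (u k j * y j)))"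
      by (rule sum.swap)
    also have "\<dots> = (\<Sum>k\<in>U. sgn (d k) * (?h x k * ?h y k))"
      by (simp only: sum_product, simp only: sum_distrib_left)
    \<comment> \<open>The arithmetic-geometric mean inequality suffices, because Parseval bounds
      both sums of squares by 1.\<close>
    also have "\<dots> \<le> (\<Sum>k\<in>U. ((?h x k)\<^sup>2 + (?h y k)\<^sup>2) / 2)"
    proof (rule sum_mono)
      fix k assume "k \<in> U"
      have "0 \<le> (?h x k + ?h y k)\<^sup>2" "0 \<le> (?h x k - ?h y k)\<^sup>2" by simp_all
      then show "sgn (d k) * (?h x k * ?h y k) \<le> ((?h x k)\<^sup>2 + (?h y k)\<^sup>2) / 2"
        by (auto simp: sgn_if power2_sum power2_diff)
    qed
    also have "\<dots> = ((\<Sum>k\<in>U. (?h x k)\<^sup>2) + (\<Sum>k\<in>U. (?h y k)\<^sup>2)) / 2"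
      by (simp add: sum.distrib flip: sum_divide_distrib)
    also have "\<dots> \<le> 1"
      using xy unfolding eigensystem_parseval[OF e U] by simp
    finally show "(\<Sum>i\<in>U. \<Sum>j\<in>U. c i j * (x i * y j)) \<le> 1" .
  qed
  have "(\<Sum>i\<in>U. \<Sum>j\<in>U. c i j * (u k i * u k j)) = sgn (d k)" if k: "k \<in> U" for k
  proof -
    have "(\<Sum>i\<in>U. \<Sum>j\<in>U. c i j * (u k i * u k j)) = (\<Sum>i\<in>U. \<Sum>j\<in>U. \<Sum>l\<in>U. sgn (d l) * ((u k i * u l i) * (u k j * u l j)))"
      by (simp add: c_def sum_distrib_left sum_distrib_right mult_ac)
    also have "\<dots> = (\<Sum>i\<in>U. \<Sum>l\<in>U. \<Sum>j\<in>U. sgn (d l) * ((u k i * u l i) * (u k j * u l j)))"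
      by (intro sum.cong refl sum.swap)
    also have "\<dots> = (\<Sum>l\<in>U. \<Sum>i\<in>U. \<Sum>j\<in>U. sgn (d l) * ((u k i * u l i) * (u k j * u l j)))"
      by (rule sum.swap)
    also have "\<dots> = (\<Sum>l\<in>U. sgn (d l) * ((\<Sum>i\<in>U. u k i * u l i) * (\<Sum>j\<in>U. u k j * u l j)))"
      by (simp only: sum_product, simp only: sum_distrib_left)
    also have "\<dots> = (\<Sum>l\<in>U. if k = l then sgn (d l) else 0)"
      using e k by (intro sum.cong refl) (auto simp: eigensystem_def unit_matrix_def)
    finally show ?thesis using U k by simp
  qed
  then have "(\<Sum>k\<in>U. \<bar>d k\<bar>) = (\<Sum>k\<in>U. d k * (\<Sum>i\<in>U. \<Sum>j\<in>U. c i j * (u k i * u k j)))"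
    by (intro sum.cong refl) (simp add: abs_sgn)
  also have "\<dots> \<le> nuc U a"
    unfolding expand[symmetric] by (rule nuc_upper[OF U \<open>contraction U c\<close>])
  finally show "(\<Sum>k\<in>U. \<bar>d k\<bar>) \<le> nuc U a" .
qed

section \<open>From the characteristic polynomial to the energy\<close>

lemma order_prod:
  assumes "finite I" "\<And>i. i \<in> I \<Longrightarrow> f i \<noteq> (0::'c::idom poly)"
  shows "Polynomial.order x (\<Prod>i\<in>I. f i) = (\<Sum>i\<in>I. Polynomial.order x (f i))"
  using assms
proof (induction I rule: finite_induct)
  case (insert i I)
  then show ?case by (subst prod.insert) (auto simp: order_mult)
qed simp

lemma eigensystem_char_poly:
  fixes a :: "nat \<Rightarrow> nat \<Rightarrow> real"
  assumes e: "eigensystem {..<n} a d u"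
  shows "char_poly (mat n n (\<lambda>(i, j). a i j)) = (\<Prod>k<n. [:- d k, 1:])"
proof -
  let ?A = "mat n n (\<lambda>(i, j). a i j)"
  define P where "P = mat n n (\<lambda>(i, k). u k i)"
  define Q where "Q = mat n n (\<lambda>(k, i). u k i)"
  define D where "D = mat n n (\<lambda>(k, l). if k = l then d k else 0)"
  have car: "P \<in> carrier_mat n n" "Q \<in> carrier_mat n n" "D \<in> carrier_mat n n"
    by (simp_all add: P_def Q_def D_def)
  have PQ: "P * Q = 1\<^sub>m n" "Q * P = 1\<^sub>m n"
    using e by (auto intro!: eq_matI simp: P_def Q_def scalar_prod_def eigensystem_def unit_matrix_def
        lessThan_atLeast0)
  have mult: "(X * Y) $$ (i, j) = (\<Sum>k<n. X $$ (i, k) * Y $$ (k, j))"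
    if "X \<in> carrier_mat n n" "Y \<in> carrier_mat n n" "i < n" "j < n" for X Y :: "real mat" and i j
    using that by (auto simp: scalar_prod_def lessThan_atLeast0)
  have "?A = P * D * Q"
  proof (rule eq_matI)
    fix i j assume "i < dim_row (P * D * Q)" "j < dim_col (P * D * Q)"
    then have ij: "i < n" "j < n" using car by auto
    have PD: "(P * D) $$ (i, k) = u k i * d k" if "k < n" for k
      using ij that by (simp add: P_def D_def scalar_prod_def if_distrib[of "\<lambda>z. _ * z"] cong: if_cong)
    have "(P * D * Q) $$ (i, j) = (\<Sum>k<n. (P * D) $$ (i, k) * Q $$ (k, j))"
      using ij car by (intro mult) auto
    also have "\<dots> = (\<Sum>k<n. d k * u k i * u k j)"
      using ij by (intro sum.cong refl) (simp add: PD, simp add: Q_def)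
    finally show "?A $$ (i, j) = (P * D * Q) $$ (i, j)"
      using ij e by (simp add: eigensystem_def)
  qed (use car in auto)
  with PQ have "similar_mat_wit ?A D P Q"
    using car by (intro similar_mat_witI[of _ _ n]) auto
  then have "char_poly ?A = char_poly D"
    by (intro char_poly_similar) (auto simp: similar_mat_def)
  also have "\<dots> = (\<Prod>x\<leftarrow>diag_mat D. [:- x, 1:])"
    using car by (intro char_poly_upper_triangular) (auto simp: D_def)
  also have "\<dots> = (\<Prod>k\<leftarrow>[0..<n]. [:- d k, 1:])"
    by (auto simp: diag_mat_def D_def intro!: arg_cong[where f = prod_list])
  also have "\<dots> = (\<Prod>k<n. [:- d k, 1:])"
    by (subst prod.distinct_set_conv_list[symmetric]) (auto simp: lessThan_atLeast0)
  finally show ?thesis .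
qed

definition sign_value :: "edge_sign option \<Rightarrow> real" where
  "sign_value x = (case x of Some Pos \<Rightarrow> 1 | Some Neg \<Rightarrow> - 1 | None \<Rightarrow> 0)"

text \<open>The order of \<open>x\<close> in the characteristic polynomial counts the
  \<open>k\<close> with \<open>d k = x\<close>, so the sum over distinct eigenvalues with
  multiplicity becomes a sum over indices.\<close>

lemma energy_eq_nuc: "energy n G = nuc {..<n} (\<lambda>i j. sign_value (G {i, j}))"
proof -
  define A where "A = adjacency_matrix n G"
  have A: "A = mat n n (\<lambda>(i, j). sign_value (G {i, j}))"
    by (auto simp: A_def adjacency_matrix_def sign_value_def)
  have Ac: "A \<in> carrier_mat n n" by (simp add: A)
  obtain d u where e: "eigensystem {..<n} (\<lambda>i j. sign_value (G {i, j})) d u"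
    using symmetric_eigensystem[of "{..<n}" "\<lambda>i j. sign_value (G {i, j})"]
    by (auto simp: insert_commute)
  have cp: "char_poly A = (\<Prod>k<n. [:- d k, 1:])"
    using eigensystem_char_poly[OF e] by (simp add: A)
  have ev: "{x. eigenvalue A x} = d ` {..<n}"
    using Ac by (auto simp: eigenvalue_root_char_poly cp poly_prod)
  have ord: "real (Polynomial.order x (char_poly A)) = (\<Sum>k<n. if d k = x then 1 else 0)" for x
  proof -
    have "Polynomial.order x [:- y, 1:] = (if y = x then 1 else 0)" for y :: real
    proof (cases "y = x")
      case True
      then show ?thesis using order_power_n_n[of x 1] by simp
    next
      case False
      then show ?thesis by (simp add: order_0I)
    qed
    then show ?thesis
      by (simp add: cp order_prod if_distrib[of real] cong: if_cong)
  qed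
  have "energy n G = (\<Sum>x\<in>d ` {..<n}. (\<Sum>k<n. if d k = x then \<bar>x\<bar> else 0))"
    unfolding energy_def Let_def A_def[symmetric] ev ord
    by (simp add: sum_distrib_right if_distrib[of "\<lambda>z. z * _"] cong: if_cong)
  also have "\<dots> = (\<Sum>k<n. \<Sum>x\<in>d ` {..<n}. if d k = x then \<bar>x\<bar> else 0)"
    by (rule sum.swap)
  also have "\<dots> = (\<Sum>k<n. \<bar>d k\<bar>)"
    by (intro sum.cong refl) simp
  also have "\<dots> = nuc {..<n} (\<lambda>i j. sign_value (G {i, j}))"
    using nuc_eigensystem[OF e] by simp
  finally show ?thesis .
qed

section \<open>Resolvent on the imaginary axis\<close>

text \<open>A fixed choice makes the spectrum a function of the matrix, so that it can stand inside
  an expectation. Eigenvalues and eigenvectors are the components of the same chosen pair and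
  therefore match.\<close>

definition eigvals :: "'i set \<Rightarrow> ('i \<Rightarrow> 'i \<Rightarrow> real) \<Rightarrow> 'i \<Rightarrow> real" where
  "eigvals U a = fst (SOME p. eigensystem U a (fst p) (snd p))"

definition eigvecs :: "'i set \<Rightarrow> ('i \<Rightarrow> 'i \<Rightarrow> real) \<Rightarrow> 'i \<Rightarrow> 'i \<Rightarrow> real" where
  "eigvecs U a = snd (SOME p. eigensystem U a (fst p) (snd p))"

definition symmetric_on :: "'i set \<Rightarrow> ('i \<Rightarrow> 'i \<Rightarrow> real) \<Rightarrow> bool" where
  "symmetric_on U a \<longleftrightarrow> (\<forall>i\<in>U. \<forall>j\<in>U. a i j = a j i)"

lemma eigensystem_eig:
  assumes "finite U" "symmetric_on U a"
  shows "eigensystem U a (eigvals U a) (eigvecs U a)"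
proof -
  have "\<exists>p. eigensystem U a (fst p) (snd p)"
    using symmetric_eigensystem[of U a] assms by (auto simp: symmetric_on_def)
  from someI_ex[OF this] show ?thesis
    by (simp add: eigvals_def eigvecs_def)
qed

text \<open>This is the inverse of \<open>a + i y\<close> on \<open>U\<close>, for a symmetric matrix \<open>a\<close>.\<close>

definition resolvent :: "'i set \<Rightarrow> ('i \<Rightarrow> 'i \<Rightarrow> real) \<Rightarrow> real \<Rightarrow> 'i \<Rightarrow> 'i \<Rightarrow> complex" where
  "resolvent U a y i j =
    (\<Sum>k\<in>U. complex_of_real (eigvecs U a k i * eigvecs U a k j) / Complex (eigvals U a k) y)"

definition shift :: "('i \<Rightarrow> 'i \<Rightarrow> real) \<Rightarrow> real \<Rightarrow> 'i \<Rightarrow> 'i \<Rightarrow> complex" where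
  "shift a y i j = complex_of_real (a i j) + \<i> * y * unit_matrix i j"

lemma resolvent_sym: "resolvent U a y i j = resolvent U a y j i"
  by (simp add: resolvent_def mult.commute)

lemma norm_inverse_Complex_le:
  assumes "y > 0"
  shows "cmod (1 / Complex d y) \<le> 1 / y"
proof -
  have "y \<le> cmod (Complex d y)"
    using abs_Im_le_cmod[of "Complex d y"] by simp
  then show ?thesis using assms by (simp add: norm_divide frac_le)
qed

lemma eigensystem_parseval_dual:
  assumes "eigensystem U a d u" "finite U"
  shows "(\<Sum>j\<in>U. (\<Sum>k\<in>U. u k j * x k)\<^sup>2) = (\<Sum>k\<in>U. (x k)\<^sup>2)"
proof -
  \<comment> \<open>The transposed vectors are orthonormal as well; with all eigenvalues 0 they form
    an eigensystem of the zero matrix.\<close>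
  have "eigensystem U (\<lambda>k l. \<Sum>i\<in>U. 0 * u k i * u l i) (\<lambda>_. 0) (\<lambda>i k. u k i)"
    using assms by (auto simp: eigensystem_def unit_matrix_def)
  from eigensystem_parseval[OF this assms(2)] show ?thesis .
qed

context
  fixes U :: "'i set" and a :: "'i \<Rightarrow> 'i \<Rightarrow> real" and y :: real
  assumes U: "finite U" and sym: "symmetric_on U a" and y: "y > 0"
begin

private lemma es:
  shows es1: "i \<in> U \<Longrightarrow> j \<in> U \<Longrightarrow> (\<Sum>k\<in>U. eigvecs U a k i * eigvecs U a k j) = unit_matrix i j"
    and es2: "k \<in> U \<Longrightarrow> l \<in> U \<Longrightarrow> (\<Sum>i\<in>U. eigvecs U a k i * eigvecs U a l i) = unit_matrix k l"
    and es3: "i \<in> U \<Longrightarrow> j \<in> U \<Longrightarrow> a i j = (\<Sum>k\<in>U. eigvals U a k * eigvecs U a k i * eigvecs U a k j)"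
  using eigensystem_eig[OF U sym] by (auto simp: eigensystem_def)

lemma shift_resolvent:
  assumes ij: "i \<in> U" "j \<in> U"
  shows "mmul U (shift a y) (resolvent U a y) i j = unit_matrix i j"
proof -
  let ?u = "\<lambda>k i. complex_of_real (eigvecs U a k i)" and ?d = "\<lambda>k. complex_of_real (eigvals U a k)"
  let ?z = "\<lambda>k. Complex (eigvals U a k) y"
  have u2: "(\<Sum>l\<in>U. ?u k l * ?u m l) = (if k = m then 1 else 0)" if "k \<in> U" "m \<in> U" for k m
    using es2[OF that] by (simp add: unit_matrix_def flip: of_real_mult of_real_sum)
  have "mmul U (shift a y) (resolvent U a y) i j =
      (\<Sum>l\<in>U. complex_of_real (a i l) * resolvent U a y l j) + \<i> * y * mmul U unit_matrix (resolvent U a y) i j"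
    by (simp add: mmul_def shift_def algebra_simps sum.distrib sum_distrib_left)
  also have "mmul U unit_matrix (resolvent U a y) i j = resolvent U a y i j"
    using U ij by simp
  also have "(\<Sum>l\<in>U. complex_of_real (a i l) * resolvent U a y l j)
     = (\<Sum>l\<in>U. \<Sum>k\<in>U. \<Sum>m\<in>U. ?d k * ?u k i * ?u m j / ?z m * (?u k l * ?u m l))"
    by (intro sum.cong refl) (simp add: es3[OF ij(1)] resolvent_def sum_product mult_ac)
  also have "\<dots> = (\<Sum>k\<in>U. \<Sum>l\<in>U. \<Sum>m\<in>U. ?d k * ?u k i * ?u m j / ?z m * (?u k l * ?u m l))"
    by (rule sum.swap)
  also have "\<dots> = (\<Sum>k\<in>U. \<Sum>m\<in>U. \<Sum>l\<in>U. ?d k * ?u k i * ?u m j / ?z m * (?u k l * ?u m l))"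
    by (intro sum.cong refl sum.swap)
  also have "\<dots> = (\<Sum>k\<in>U. \<Sum>m\<in>U. if k = m then ?d k * ?u k i * ?u m j / ?z m else 0)"
    by (intro sum.cong refl) (simp only: sum_distrib_left[symmetric] u2, simp)
  also have "\<dots> = (\<Sum>k\<in>U. ?d k * ?u k i * ?u k j / ?z k)"
    using U by (intro sum.cong refl) simp
  also have "\<dots> + \<i> * y * resolvent U a y i j = (\<Sum>k\<in>U. (?d k + \<i> * y) * (?u k i * ?u k j / ?z k))"
    by (simp add: resolvent_def sum_distrib_left distrib_right sum.distrib add_divide_distrib mult.assoc)
  also have "\<dots> = (\<Sum>k\<in>U. ?u k i * ?u k j)"
  proof (intro sum.cong refl)
    fix k
    have "?d k + \<i> * y = ?z k" "?z k \<noteq> 0"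
      using y by (simp_all add: complex_eq_iff)
    then show "(?d k + \<i> * y) * (?u k i * ?u k j / ?z k) = ?u k i * ?u k j"
      by simp
  qed
  also have "\<dots> = unit_matrix i j"
    using es1[OF ij] by (simp add: unit_matrix_def flip: of_real_mult of_real_sum)
  finally show ?thesis .
qed

lemma resolvent_shift:
  assumes ij: "i \<in> U" "j \<in> U"
  shows "mmul U (resolvent U a y) (shift a y) i j = unit_matrix i j"
proof -
  have "mmul U (resolvent U a y) (shift a y) i j = mmul U (shift a y) (resolvent U a y) j i"
    unfolding mmul_def using sym ij
    by (intro sum.cong refl) (auto simp: symmetric_on_def shift_def unit_matrix_def resolvent_sym[of _ _ _ i])
  then show ?thesis
    using shift_resolvent[OF ij(2,1)] by (simp add: unit_matrix_def)
qed

text \<open>A whole row, not just an entry, is bounded uniformly in \<open>card U\<close>. This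
  gains a factor \<open>card U\<close> both in the error of the trace equation and in the effect of
  one entry on the trace.\<close>

lemma resolvent_row:
  assumes i: "i \<in> U"
  shows "(\<Sum>j\<in>U. (cmod (resolvent U a y i j))\<^sup>2) \<le> 1 / y\<^sup>2"
proof -
  let ?u = "eigvecs U a" and ?w = "\<lambda>k. 1 / Complex (eigvals U a k) y"
  have R: "resolvent U a y i j = (\<Sum>k\<in>U. complex_of_real (?u k j) * (?u k i * ?w k))" for j
    by (simp add: resolvent_def mult_ac)
  \<comment> \<open>Parseval is available for real vectors, so real and imaginary parts are treated
    separately.\<close>
  have "(\<Sum>j\<in>U. (cmod (resolvent U a y i j))\<^sup>2)
      = (\<Sum>j\<in>U. (\<Sum>k\<in>U. ?u k j * (?u k i * Re (?w k)))\<^sup>2) + (\<Sum>j\<in>U. (\<Sum>k\<in>U. ?u k j * (?u k i * Im (?w k)))\<^sup>2)"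
    unfolding R cmod_power2 by (simp add: sum.distrib del: times_divide_eq_right)
  also have "\<dots> = (\<Sum>k\<in>U. (?u k i)\<^sup>2 * (cmod (?w k))\<^sup>2)"
    unfolding eigensystem_parseval_dual[OF eigensystem_eig[OF U sym] U] cmod_power2
    by (simp only: power_mult_distrib sum.distrib[symmetric] distrib_left[symmetric])
  also have "\<dots> \<le> (\<Sum>k\<in>U. (?u k i)\<^sup>2 * (1 / y)\<^sup>2)"
    using y by (intro sum_mono mult_left_mono power_mono norm_inverse_Complex_le) auto
  also have "\<dots> = 1 / y\<^sup>2"
    using es1[OF i i] by (simp add: power2_eq_square unit_matrix_def flip: sum_divide_distrib)
  finally show ?thesis .
qed

lemma norm_resolvent_le:
  assumes ij: "i \<in> U" "j \<in> U"
  shows "cmod (resolvent U a y i j) \<le> 1 / y"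
proof (rule power2_le_imp_le)
  have "(cmod (resolvent U a y i j))\<^sup>2 \<le> (\<Sum>j\<in>U. (cmod (resolvent U a y i j))\<^sup>2)"
    using U ij by (intro member_le_sum) auto
  also have "\<dots> \<le> (1 / y)\<^sup>2"
    using resolvent_row[OF ij(1)] by (simp add: power_divide)
  finally show "(cmod (resolvent U a y i j))\<^sup>2 \<le> (1 / y)\<^sup>2" .
qed (use y in auto)

lemma resolvent_trace: "(\<Sum>i\<in>U. resolvent U a y i i) = (\<Sum>k\<in>U. 1 / Complex (eigvals U a k) y)"
proof -
  have "(\<Sum>i\<in>U. resolvent U a y i i) = (\<Sum>k\<in>U. \<Sum>i\<in>U. complex_of_real (eigvecs U a k i * eigvecs U a k i) / Complex (eigvals U a k) y)"
    unfolding resolvent_def by (rule sum.swap)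
  also have "\<dots> = (\<Sum>k\<in>U. complex_of_real (\<Sum>i\<in>U. eigvecs U a k i * eigvecs U a k i) / Complex (eigvals U a k) y)"
    by (simp add: sum_divide_distrib)
  also have "\<dots> = (\<Sum>k\<in>U. 1 / Complex (eigvals U a k) y)"
    by (intro sum.cong refl) (simp add: es2 unit_matrix_def)
  finally show ?thesis .
qed

text \<open>The imaginary part of 1 / (d + i y) is - y / (d^2 + y^2). This links Coulson's integrand
  to the trace.\<close>

lemma Im_resolvent_trace:
  "(\<Sum>k\<in>U. (eigvals U a k)\<^sup>2 / ((eigvals U a k)\<^sup>2 + y\<^sup>2)) = card U + y * Im (\<Sum>i\<in>U. resolvent U a y i i)"
proof -
  have "(\<Sum>k\<in>U. (eigvals U a k)\<^sup>2 / ((eigvals U a k)\<^sup>2 + y\<^sup>2))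
      = (\<Sum>k\<in>U. 1 + y * Im (1 / Complex (eigvals U a k) y))"
  proof (intro sum.cong refl)
    fix k
    have "(eigvals U a k)\<^sup>2 + y\<^sup>2 > 0" using y by (simp add: add_nonneg_pos)
    then show "(eigvals U a k)\<^sup>2 / ((eigvals U a k)\<^sup>2 + y\<^sup>2) = 1 + y * Im (1 / Complex (eigvals U a k) y)"
      using y by (simp add: Im_divide power2_eq_square divide_simps)
  qed
  then show ?thesis
    by (simp add: resolvent_trace sum.distrib sum_distrib_left)
qed

text \<open>Each 1 / (d + i y) lies in the lower half plane; this later selects the root of the
  limiting quadratic.\<close>

lemma Im_resolvent_trace_nonpos: "Im (\<Sum>i\<in>U. resolvent U a y i i) \<le> 0"
  unfolding resolvent_trace Im_sum
  using y by (intro sum_nonpos) (auto simp: Im_divide intro!: divide_nonneg_nonneg)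

end

section \<open>Changing one symmetric pair of entries\<close>

lemma mmul_diff_left:
  fixes a :: "'i \<Rightarrow> 'i \<Rightarrow> 'c::comm_ring_1"
  shows "mmul U a c i j - mmul U b c i j = mmul U (\<lambda>i j. a i j - b i j) c i j"
  by (simp add: mmul_def left_diff_distrib sum_subtractf)

lemma mmul_diff_right:
  fixes a :: "'i \<Rightarrow> 'i \<Rightarrow> 'c::comm_ring_1"
  shows "mmul U c a i j - mmul U c b i j = mmul U c (\<lambda>i j. a i j - b i j) i j"
  by (simp add: mmul_def right_diff_distrib sum_subtractf)

text \<open>Inserting a + i y between the two resolvents gives \<open>resolvent U b y\<close>,
  inserting b + i y gives \<open>resolvent U a y\<close>; the difference is the middle term.\<close>

lemma resolvent_identity:
  assumes U: "finite U" and a: "symmetric_on U a" and b: "symmetric_on U b" and y: "y > 0"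
    and ij: "i \<in> U" "j \<in> U"
  shows "resolvent U b y i j = resolvent U a y i j -
    mmul U (mmul U (resolvent U a y) (\<lambda>k l. complex_of_real (b k l - a k l))) (resolvent U b y) i j"
proof -
  let ?R = "resolvent U a y" and ?S = "resolvent U b y"
  have "?S i j = mmul U (mmul U ?R (shift a y)) ?S i j"
    using U ij resolvent_shift[OF U a y] by (intro mmul_unit_left'[symmetric]) auto
  moreover have "?R i j = mmul U ?R (mmul U (shift b y) ?S) i j"
    using U ij shift_resolvent[OF U b y] by (intro mmul_unit_right'[symmetric]) auto
  then have "?R i j = mmul U (mmul U ?R (shift b y)) ?S i j"
    by (simp add: mmul_assoc)
  moreover have "mmul U (mmul U ?R (shift b y)) ?S i j - mmul U (mmul U ?R (shift a y)) ?S i j =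
      mmul U (mmul U ?R (\<lambda>k l. complex_of_real (b k l - a k l))) ?S i j"
    unfolding mmul_diff_left mmul_diff_right by (simp add: shift_def)
  ultimately show ?thesis by (simp add: algebra_simps)
qed

definition edge_update :: "('i \<Rightarrow> 'i \<Rightarrow> real) \<Rightarrow> 'i \<Rightarrow> 'i \<Rightarrow> real \<Rightarrow> 'i \<Rightarrow> 'i \<Rightarrow> real" where
  "edge_update a p q t i j = a i j + (if {i, j} = {p, q} then t else 0)"

lemma symmetric_on_edge_update: "symmetric_on U a \<Longrightarrow> symmetric_on U (edge_update a p q t)"
  by (auto simp: symmetric_on_def edge_update_def insert_commute)

context
  fixes U :: "'i set" and a :: "'i \<Rightarrow> 'i \<Rightarrow> real" and y t :: real and p q
  assumes U: "finite U" and sym: "symmetric_on U a" and y: "y > 0"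
    and pq: "p \<in> U" "q \<in> U" "p \<noteq> q"
begin

private abbreviation (input) "R \<equiv> resolvent U a y"
private abbreviation (input) "S \<equiv> resolvent U (edge_update a p q t) y"

private lemmas symb = symmetric_on_edge_update[OF sym, of p q t]

text \<open>Only two entries change, so the product in the resolvent identity collapses to two
  terms. The identity is exact, with the new resolvent on the right, and can be iterated.\<close>

lemma resolvent_update:
  assumes ij: "i \<in> U" "j \<in> U"
  shows "S i j = R i j - t * (R i p * S q j + R i q * S p j)"
proof -
  have "mmul U (mmul U R (\<lambda>k l. complex_of_real (edge_update a p q t k l - a k l))) S i j
      = (\<Sum>l\<in>U. (\<Sum>k\<in>U. (if k = p \<and> l = q then t * R i k else 0) + (if k = q \<and> l = p then t * R i k else 0)) * S l j)"
    unfolding mmul_def using pq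
    by (intro sum.cong refl arg_cong2[where f = "(*)"]) (auto simp: edge_update_def doubleton_eq_iff)
  also have "\<dots> = (\<Sum>l\<in>U. (if l = q then t * R i p * S l j else 0) + (if l = p then t * R i q * S l j else 0))"
  proof (intro sum.cong refl)
    fix l
    have "(\<Sum>k\<in>U. (if k = p \<and> l = q then t * R i k else 0) + (if k = q \<and> l = p then t * R i k else 0))
       = (\<Sum>k\<in>U. (if k = p then if l = q then t * R i p else 0 else 0)) + (\<Sum>k\<in>U. (if k = q then if l = p then t * R i q else 0 else 0))"
      unfolding sum.distrib by (intro arg_cong2[where f = "(+)"] sum.cong) auto
    also have "\<dots> = (if l = q then t * R i p else 0) + (if l = p then t * R i q else 0)"
      using U pq by simp
    finally show "(\<Sum>k\<in>U. (if k = p \<and> l = q then t * R i k else 0) + (if k = q \<and> l = p then t * R i k else 0)) * S l j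
        = (if l = q then t * R i p * S l j else 0) + (if l = p then t * R i q * S l j else 0)"
      by (simp add: distrib_right)
  qed
  also have "\<dots> = t * (R i p * S q j + R i q * S p j)"
    using U pq by (simp add: sum.distrib algebra_simps)
  finally show ?thesis
    using resolvent_identity[OF U sym symb y ij] by simp
qed

private lemma nR: "i \<in> U \<Longrightarrow> j \<in> U \<Longrightarrow> cmod (R i j) \<le> 1 / y"
  by (rule norm_resolvent_le[OF U sym y])

private lemma nS: "i \<in> U \<Longrightarrow> j \<in> U \<Longrightarrow> cmod (S i j) \<le> 1 / y"
  by (rule norm_resolvent_le[OF U symb y])

private lemma norm_mult_le:
  assumes "cmod x \<le> X" "cmod z \<le> Z"
  shows "cmod (x * z) \<le> X * Z"
proof -
  have "0 \<le> X" using norm_ge_zero[of x] assms by linarith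
  then show ?thesis unfolding norm_mult by (intro mult_mono assms) auto
qed

lemma resolvent_update_norm:
  assumes ij: "i \<in> U" "j \<in> U"
  shows "cmod (S i j - R i j) \<le> 2 * \<bar>t\<bar> / y\<^sup>2"
proof -
  have "cmod (R i p * S q j + R i q * S p j) \<le> 1 / y * (1 / y) + 1 / y * (1 / y)"
    using ij pq nR nS by (intro order.trans[OF norm_triangle_ineq] add_mono norm_mult_le) auto
  then have "cmod (t * (R i p * S q j + R i q * S p j)) \<le> \<bar>t\<bar> * (1 / y * (1 / y) + 1 / y * (1 / y))"
    by (intro norm_mult_le) auto
  then show ?thesis
    using resolvent_update[OF ij] by (simp add: power2_eq_square norm_minus_commute mult.commute[of 2])
qed

text \<open>The quadratic expression is minus the derivative in \<open>t\<close> of the updated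
  entry. Replacing one factor at a time costs four differences of size 2 |t| / y^2, each times a
  factor at most 1 / y.\<close>

lemma resolvent_update_quadratic:
  "cmod (((S q p)\<^sup>2 + S q q * S p p) - ((R q p)\<^sup>2 + R q q * R p p)) \<le> 8 * \<bar>t\<bar> / y ^ 3"
proof -
  have ring: "(a\<^sup>2 + c * e) - (b\<^sup>2 + d * f) = (a - b) * a + b * (a - b) + (c - d) * e + d * (e - f)"
    for a b c d e f :: complex
    by (simp add: power2_eq_square algebra_simps)
  let ?D = "(S q p - R q p) * S q p + R q p * (S q p - R q p) + (S q q - R q q) * S p p + R q q * (S p p - R p p)"
  have b: "2 * \<bar>t\<bar> / y\<^sup>2 * (1 / y) = 2 * \<bar>t\<bar> / y ^ 3" "1 / y * (2 * \<bar>t\<bar> / y\<^sup>2) = 2 * \<bar>t\<bar> / y ^ 3"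
    by (simp_all add: power2_eq_square power3_eq_cube)
  have "cmod ?D \<le> 2 * \<bar>t\<bar> / y\<^sup>2 * (1 / y) + 1 / y * (2 * \<bar>t\<bar> / y\<^sup>2) + 2 * \<bar>t\<bar> / y\<^sup>2 * (1 / y) + 1 / y * (2 * \<bar>t\<bar> / y\<^sup>2)"
    by (intro order.trans[OF norm_triangle_ineq] add_mono norm_mult_le resolvent_update_norm nR nS pq)
  then have "cmod ?D \<le> 8 * \<bar>t\<bar> / y ^ 3"
    unfolding b by simp
  then show ?thesis
    unfolding ring .
qed

text \<open>First-order Taylor expansion in \<open>t\<close>: one use of the exact identity leaves
  only differences of the two resolvents, again of order |t|.\<close>

lemma resolvent_update_expand:
  "cmod (S q p - (R q p - t * ((R q p)\<^sup>2 + R q q * R p p))) \<le> 4 * t\<^sup>2 / y ^ 3"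
proof -
  have ring: "s - (r - x * (r\<^sup>2 + q * v)) = (- x) * (r * (s - r) + q * (u - v))"
    if m: "s = r - m" "m = x * (r * s + q * u)" for s r x q u v m :: complex
  proof -
    have "s - (r - x * (r\<^sup>2 + q * v)) = x * (r\<^sup>2 + q * v) - m"
      using m(1) by simp
    also have "\<dots> = (- x) * (r * (s - r) + q * (u - v))"
      unfolding m(2) by (simp add: power2_eq_square algebra_simps)
    finally show ?thesis .
  qed
  have "S q p - (R q p - t * ((R q p)\<^sup>2 + R q q * R p p))
      = (- complex_of_real t) * (R q p * (S q p - R q p) + R q q * (S p p - R p p))"
    by (rule ring[OF resolvent_update[OF pq(2,1)] refl])
  also have "cmod \<dots> \<le> \<bar>t\<bar> * (1 / y * (2 * \<bar>t\<bar> / y\<^sup>2) + 1 / y * (2 * \<bar>t\<bar> / y\<^sup>2))"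
    by (intro norm_mult_le order.trans[OF norm_triangle_ineq] add_mono resolvent_update_norm nR pq) simp
  also have "\<dots> = 4 * t\<^sup>2 / y ^ 3"
    using y unfolding power2_abs[symmetric, of t]
    by (simp add: field_simps power2_eq_square power3_eq_cube)
  finally show ?thesis .
qed

text \<open>The bound does not grow with \<open>card U\<close>, since the sums over \<open>i\<close>
  run along rows of two resolvents and every row has a bounded sum of squares.\<close>

lemma resolvent_update_trace:
  "cmod ((\<Sum>i\<in>U. S i i) - (\<Sum>i\<in>U. R i i)) \<le> 2 * \<bar>t\<bar> / y\<^sup>2"
proof -
  have *: "cmod (\<Sum>i\<in>U. R i k * S l i) \<le> 1 / y\<^sup>2" if kl: "k \<in> U" "l \<in> U" for k l
  proof -
    have "cmod (\<Sum>i\<in>U. R i k * S l i) \<le> (\<Sum>i\<in>U. ((cmod (R k i))\<^sup>2 + (cmod (S l i))\<^sup>2) / 2)"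
    proof (intro order.trans[OF norm_sum] sum_mono)
      fix i
      have "0 \<le> (cmod (R k i) - cmod (S l i))\<^sup>2" by simp
      then show "cmod (R i k * S l i) \<le> ((cmod (R k i))\<^sup>2 + (cmod (S l i))\<^sup>2) / 2"
        by (simp add: norm_mult power2_diff resolvent_sym[of _ _ _ i])
    qed
    also have "\<dots> \<le> (1 / y\<^sup>2 + 1 / y\<^sup>2) / 2"
      using resolvent_row[OF U sym y kl(1)] resolvent_row[OF U symb y kl(2)]
      by (simp add: sum.distrib flip: sum_divide_distrib)
    finally show ?thesis by simp
  qed
  have "(\<Sum>i\<in>U. S i i) - (\<Sum>i\<in>U. R i i) = - t * ((\<Sum>i\<in>U. R i p * S q i) + (\<Sum>i\<in>U. R i q * S p i))"
  proof -
    have "(\<Sum>i\<in>U. S i i) = (\<Sum>i\<in>U. R i i - t * (R i p * S q i + R i q * S p i))"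
      by (intro sum.cong refl resolvent_update)
    then show ?thesis
      by (simp add: sum_subtractf sum_distrib_left sum.distrib sum_negf algebra_simps)
  qed
  also have "cmod \<dots> \<le> \<bar>t\<bar> * (1 / y\<^sup>2 + 1 / y\<^sup>2)"
    using pq by (intro norm_mult_le order.trans[OF norm_triangle_ineq] add_mono *) auto
  finally show ?thesis by (simp add: mult.commute[of _ 2])
qed

end

section \<open>Independent entries\<close>

lemma finite_set_Pi_pmf:
  "finite A \<Longrightarrow> finite (set_pmf D) \<Longrightarrow> finite (set_pmf (Pi_pmf A dflt (\<lambda>_. D)))"
  by (simp add: set_Pi_pmf finite_PiE_dflt)

lemma expectation_mono_finite:
  fixes f g :: "'a \<Rightarrow> real"
  assumes "finite (set_pmf p)" "\<And>x. x \<in> set_pmf p \<Longrightarrow> f x \<le> g x"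
  shows "measure_pmf.expectation p f \<le> measure_pmf.expectation p g"
  using assms by (intro integral_mono_AE integrable_measure_pmf_finite) (auto simp: AE_measure_pmf_iff)

lemma expectation_Pi_pmf_insert:
  fixes f :: "('a \<Rightarrow> 'b) \<Rightarrow> 'c::{banach, second_countable_topology}"
  assumes A: "finite A" "e \<notin> A" and D: "finite (set_pmf D)"
  shows "measure_pmf.expectation (Pi_pmf (insert e A) dflt (\<lambda>_. D)) f =
    measure_pmf.expectation (Pi_pmf A dflt (\<lambda>_. D)) (\<lambda>G. measure_pmf.expectation D (\<lambda>x. f (G(e := x))))"
proof -
  let ?P = "Pi_pmf A dflt (\<lambda>_. D)"
  have fin: "finite (set_pmf ?P)" by (rule finite_set_Pi_pmf[OF A(1) D])
  have "Pi_pmf (insert e A) dflt (\<lambda>_. D) = bind_pmf ?P (\<lambda>G. map_pmf (\<lambda>x. G(e := x)) D)"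
    using A by (simp add: Pi_pmf_insert' map_pmf_def bind_commute_pmf[of D])
  then have "measure_pmf.expectation (Pi_pmf (insert e A) dflt (\<lambda>_. D)) f =
      (\<Sum>G\<in>set_pmf ?P. pmf ?P G *\<^sub>R measure_pmf.expectation (map_pmf (\<lambda>x. G(e := x)) D) f)"
    using D by (simp add: pmf_expectation_bind[OF fin])
  also have "\<dots> = measure_pmf.expectation ?P (\<lambda>G. measure_pmf.expectation D (\<lambda>x. f (G(e := x))))"
    by (subst integral_measure_pmf[OF fin]) auto
  finally show ?thesis .
qed

text \<open>Both sides reduce to the law on the other coordinates, because a second update at
  \<open>e\<close> overwrites the first. This lets one entry be averaged with all others
  fixed.\<close>

lemma expectation_resample:
  fixes f :: "('a \<Rightarrow> 'b) \<Rightarrow> 'c::{banach, second_countable_topology}"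
  assumes A: "finite A" "e \<in> A" and D: "finite (set_pmf D)"
  shows "measure_pmf.expectation (Pi_pmf A dflt (\<lambda>_. D)) f =
    measure_pmf.expectation (Pi_pmf A dflt (\<lambda>_. D)) (\<lambda>G. measure_pmf.expectation D (\<lambda>x. f (G(e := x))))"
proof -
  have *: "measure_pmf.expectation (Pi_pmf A dflt (\<lambda>_. D)) g =
      measure_pmf.expectation (Pi_pmf (A - {e}) dflt (\<lambda>_. D)) (\<lambda>G. measure_pmf.expectation D (\<lambda>x. g (G(e := x))))"
    for g :: "('a \<Rightarrow> 'b) \<Rightarrow> 'c"
    using expectation_Pi_pmf_insert[of "A - {e}" e D dflt g] A D by (simp add: insert_absorb)
  show ?thesis
    by (subst (1 2) *) simp
qed

lemma expectation_sq_centered: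
  fixes f :: "'a \<Rightarrow> real"
  assumes "finite (set_pmf p)"
  shows "measure_pmf.expectation p (\<lambda>x. (f x - m)\<^sup>2) =
    measure_pmf.expectation p (\<lambda>x. (f x - measure_pmf.expectation p f)\<^sup>2) + (measure_pmf.expectation p f - m)\<^sup>2"
proof -
  let ?E = "measure_pmf.expectation p" and ?\<mu> = "measure_pmf.expectation p f"
  note [simp] = integrable_measure_pmf_finite[OF assms]
  have "?E (\<lambda>x. (f x - m)\<^sup>2) = ?E (\<lambda>x. (f x - ?\<mu>)\<^sup>2 + 2 * (?\<mu> - m) * (f x - ?\<mu>) + (?\<mu> - m)\<^sup>2)"
    by (intro Bochner_Integration.integral_cong refl) (simp add: power2_eq_square algebra_simps)
  then show ?thesis by simp
qed

text \<open>A crude form of the Efron--Stein inequality.\<close>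

lemma variance_Pi_pmf_le:
  fixes f :: "('a \<Rightarrow> 'b) \<Rightarrow> real" and c :: real
  assumes A: "finite A" and D: "finite (set_pmf D)"
    and f: "\<And>G e x x'. e \<in> A \<Longrightarrow> \<bar>f (G(e := x)) - f (G(e := x'))\<bar> \<le> c"
  shows "measure_pmf.expectation (Pi_pmf A dflt (\<lambda>_. D))
      (\<lambda>G. (f G - measure_pmf.expectation (Pi_pmf A dflt (\<lambda>_. D)) f)\<^sup>2) \<le> card A * c\<^sup>2"
  using A f
proof (induction A arbitrary: f rule: finite_induct)
  case (insert e A)
  let ?P = "Pi_pmf A dflt (\<lambda>_. D)" and ?E = "measure_pmf.expectation D"
  \<comment> \<open>Averaging over the new coordinate leaves a function of the old ones, which
    inherits the bound \<open>c\<close> on single changes by \<open>average\<close>.\<close>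
  define F where "F = (\<lambda>G. ?E (\<lambda>x. f (G(e := x))))"
  define \<mu> where "\<mu> = measure_pmf.expectation ?P F"
  note [simp] = integrable_measure_pmf_finite[OF D]
    integrable_measure_pmf_finite[OF finite_set_Pi_pmf[OF insert.hyps(1) D]]
  have c: "\<bar>f (G(e := x)) - f (G(e := x'))\<bar> \<le> c" for G x x'
    by (rule insert.prems) simp
  then have c0: "c \<ge> 0" using abs_ge_zero order.trans by blast
  have average: "\<bar>?E g - ?E k\<bar> \<le> c" if "\<And>x. \<bar>g x - k x\<bar> \<le> c" for g k :: "'b \<Rightarrow> real"
  proof -
    have "\<bar>?E (\<lambda>x. g x - k x)\<bar> \<le> ?E (\<lambda>x. \<bar>g x - k x\<bar>)"
      using integral_norm_bound[of D "\<lambda>x. g x - k x"] by simp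
    also have "\<dots> \<le> ?E (\<lambda>_. c)"
      by (intro expectation_mono_finite D that)
    finally show ?thesis by simp
  qed
  have "\<bar>F (G(d := x)) - F (G(d := x'))\<bar> \<le> c" if "d \<in> A" for G d x x'
    unfolding F_def
  proof (rule average)
    fix z
    have "d \<noteq> e" using that insert.hyps by auto
    then have tw: "G(d := w, e := z) = (G(e := z))(d := w)" for w by (rule fun_upd_twist)
    show "\<bar>f (G(d := x, e := z)) - f (G(d := x', e := z))\<bar> \<le> c"
      unfolding tw using that by (intro insert.prems) simp
  qed
  then have IH: "measure_pmf.expectation ?P (\<lambda>G. (F G - \<mu>)\<^sup>2) \<le> card A * c\<^sup>2"
    unfolding \<mu>_def by (rule insert.IH)
  have "\<bar>f (G(e := x)) - F G\<bar> \<le> c" for G x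
    using average[of "\<lambda>_. f (G(e := x))" "\<lambda>x. f (G(e := x))"] c by (simp add: F_def)
  then have "(f (G(e := x)) - F G)\<^sup>2 \<le> c\<^sup>2" for G x
    using c0 by (simp add: abs_le_square_iff[symmetric])
  then have "?E (\<lambda>x. (f (G(e := x)) - F G)\<^sup>2) \<le> ?E (\<lambda>_. c\<^sup>2)" for G
    by (intro expectation_mono_finite D)
  \<comment> \<open>The squared deviation from \<open>\<mu>\<close> splits into the spread around
    \<open>F G\<close>, at most c^2, and a squared bias, which the induction hypothesis
    covers.\<close>
  then have inner: "?E (\<lambda>x. (f (G(e := x)) - \<mu>)\<^sup>2) \<le> c\<^sup>2 + (F G - \<mu>)\<^sup>2" for G
    using expectation_sq_centered[OF D, of "\<lambda>x. f (G(e := x))" \<mu>] by (simp add: F_def)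
  have \<mu>: "measure_pmf.expectation (Pi_pmf (insert e A) dflt (\<lambda>_. D)) f = \<mu>"
    unfolding \<mu>_def F_def by (rule expectation_Pi_pmf_insert[OF insert.hyps D])
  have "measure_pmf.expectation (Pi_pmf (insert e A) dflt (\<lambda>_. D)) (\<lambda>G. (f G - \<mu>)\<^sup>2)
      = measure_pmf.expectation ?P (\<lambda>G. ?E (\<lambda>x. (f (G(e := x)) - \<mu>)\<^sup>2))"
    by (rule expectation_Pi_pmf_insert[OF insert.hyps D])
  also have "\<dots> \<le> measure_pmf.expectation ?P (\<lambda>G. c\<^sup>2 + (F G - \<mu>)\<^sup>2)"
    by (intro expectation_mono_finite finite_set_Pi_pmf insert.hyps D inner)
  also have "\<dots> \<le> card (insert e A) * c\<^sup>2"
    using IH insert.hyps by (simp add: algebra_simps)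
  finally show ?case unfolding \<mu> .
qed simp

section \<open>Wigner matrices over unordered pairs\<close>

definition pairs :: "'i set \<Rightarrow> 'i set set" where
  "pairs U = {{i, j} | i j. i \<in> U \<and> j \<in> U \<and> i \<noteq> j}"

lemma pairs_subset_image: "pairs U \<subseteq> (\<lambda>(i, j). {i, j}) ` (U \<times> U)"
  by (auto simp: pairs_def)

lemma finite_pairs: "finite U \<Longrightarrow> finite (pairs U)"
  using pairs_subset_image by (rule finite_subset) auto

lemma card_pairs_le:
  assumes "finite U"
  shows "card (pairs U) \<le> (card U)\<^sup>2"
proof -
  have "card (pairs U) \<le> card ((\<lambda>(i, j). {i, j}) ` (U \<times> U))"
    using assms by (intro card_mono pairs_subset_image) auto
  also have "\<dots> \<le> card (U \<times> U)"
    using assms by (intro card_image_le) auto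
  finally show ?thesis by (simp add: card_cartesian_product power2_eq_square)
qed

lemma pairs_mono: "V \<subseteq> U \<Longrightarrow> pairs V \<subseteq> pairs U"
  by (auto simp: pairs_def)

lemma in_pairs: "{i, j} \<in> pairs U \<longleftrightarrow> i \<in> U \<and> j \<in> U \<and> i \<noteq> j"
  by (auto simp: pairs_def doubleton_eq_iff)

text \<open>Entries are read off at unordered pairs, which makes symmetry automatic; the diagonal is
  zero whatever \<open>G\<close> is at singletons.\<close>

definition wigner :: "('b \<Rightarrow> real) \<Rightarrow> ('i set \<Rightarrow> 'b) \<Rightarrow> 'i \<Rightarrow> 'i \<Rightarrow> real" where
  "wigner h G i j = (if i = j then 0 else h (G {i, j}))"

lemma symmetric_on_wigner: "symmetric_on U (wigner h G)"
  by (auto simp: symmetric_on_def wigner_def insert_commute)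

text \<open>Erasing the entry first gives a base matrix that does not depend on the resampled
  value.\<close>

lemma wigner_update:
  assumes "p \<noteq> q"
  shows "wigner h (G({p, q} := x)) = edge_update (\<lambda>i j. if {i, j} = {p, q} then 0 else wigner h G i j) p q (h x)"
  using assms by (intro ext) (auto simp: wigner_def edge_update_def)

lemma wigner_update_diff:
  assumes "p \<noteq> q"
  shows "wigner h (G({p, q} := x)) = edge_update (wigner h (G({p, q} := x'))) p q (h x - h x')"
  using assms by (intro ext) (auto simp: wigner_def edge_update_def)

text \<open>\<open>K\<close> bounds \<open>h\<close> everywhere, not only on the support, so that
  estimates hold for every \<open>G\<close>; finite support makes every function integrable.\<close>

locale entry_law =
  fixes D :: "'b pmf" and h :: "'b \<Rightarrow> real" and v K :: real
  assumes finite_law: "finite (set_pmf D)"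
    and mean: "measure_pmf.expectation D h = 0"
    and second_moment: "measure_pmf.expectation D (\<lambda>x. (h x)\<^sup>2) = v"
    and bounded: "\<And>x. \<bar>h x\<bar> \<le> K"
begin

lemma v_nonneg: "v \<ge> 0"
  unfolding second_moment[symmetric] by (rule Bochner_Integration.integral_nonneg) simp

lemma K_nonneg: "K \<ge> 0"
  using bounded abs_ge_zero order.trans by blast

lemma scaled: "entry_law D (\<lambda>x. t * h x) (t\<^sup>2 * v) (\<bar>t\<bar> * K)"
  using finite_law mean second_moment bounded
  by unfold_locales (auto simp: power_mult_distrib abs_mult mult_left_mono)

definition law :: "'i set \<Rightarrow> 'b \<Rightarrow> ('i set \<Rightarrow> 'b) pmf" where
  "law U dflt = Pi_pmf (pairs U) dflt (\<lambda>_. D)"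

lemma finite_set_law: "finite U \<Longrightarrow> finite (set_pmf (law U dflt))"
  unfolding law_def by (intro finite_set_Pi_pmf finite_pairs finite_law)

lemma integrable_law:
  fixes f :: "('i set \<Rightarrow> 'b) \<Rightarrow> 'c::{banach, second_countable_topology}"
  shows "finite U \<Longrightarrow> integrable (measure_pmf (law U dflt)) f"
  by (intro integrable_measure_pmf_finite finite_set_law)

text \<open>
  This is the cumulant expansion \<open>E[x f(x)] \<approx> v E[f'(x)]\<close> for a matrix entry \<open>x\<close> and a resolvent entry \<open>f\<close>.
\<close>

lemma resolvent_cumulant:
  fixes U :: "'i set" and y :: real and dflt :: 'b and Rs :: "('i set \<Rightarrow> 'b) \<Rightarrow> 'i \<Rightarrow> 'i \<Rightarrow> complex"
  defines "Rs \<equiv> \<lambda>G. resolvent U (wigner h G) y"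
  assumes U: "finite U" and y: "y > 0" and pq: "p \<in> U" "q \<in> U" "p \<noteq> q"
  shows "cmod (measure_pmf.expectation (law U dflt)
      (\<lambda>G. wigner h G p q * Rs G q p + v * ((Rs G q p)\<^sup>2 + Rs G q q * Rs G p p))) \<le> 12 * K * v / y ^ 3"
proof -
  note [simp] = integrable_measure_pmf_finite[OF finite_law]
  let ?E = "measure_pmf.expectation D"
  let ?f = "\<lambda>G. wigner h G p q * Rs G q p + v * ((Rs G q p)\<^sup>2 + Rs G q q * Rs G p p)"
  have inner: "cmod (?E (\<lambda>x. ?f (G({p, q} := x)))) \<le> 12 * K * v / y ^ 3" for G
  proof -
    \<comment> \<open>With this entry erased, \<open>R\<close> and \<open>T0\<close> are constants
      for the average over \<open>x\<close>.\<close>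
    define a where "a = (\<lambda>i j. if {i, j} = {p, q} then 0 else wigner h G i j)"
    have sym: "symmetric_on U a"
      using symmetric_on_wigner[of U h G] by (auto simp: symmetric_on_def a_def insert_commute)
    have W: "wigner h (G({p, q} := x)) = edge_update a p q (h x)" for x
      unfolding a_def by (rule wigner_update[OF pq(3)])
    have wpq: "wigner h (G({p, q} := x)) p q = h x" for x
      using pq by (simp add: wigner_def)
    define S where "S = (\<lambda>x. resolvent U (edge_update a p q (h x)) y)"
    define R where "R = resolvent U a y"
    define T0 where "T0 = (R q p)\<^sup>2 + R q q * R p p"
    define T where "T = (\<lambda>x. (S x q p)\<^sup>2 + S x q q * S x p p)"
    have f: "?f (G({p, q} := x)) = h x * S x q p + v * T x" for x
      by (simp only: Rs_def W[symmetric] wpq T_def S_def)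
    \<comment> \<open>What remains after the first-order expansion: \<open>mean\<close> kills the
      linear term, and \<open>second_moment\<close> makes the two multiples of \<open>T0\<close>
      cancel.\<close>
    define r where "r = (\<lambda>x. h x * (S x q p - (R q p - h x * T0)) + v * (T x - T0))"
    have "?E (\<lambda>x. ?f (G({p, q} := x))) = ?E (\<lambda>x. r x + (complex_of_real (h x) * R q p - complex_of_real ((h x)\<^sup>2) * T0 + v * T0))"
      unfolding f by (intro Bochner_Integration.integral_cong refl) (simp add: r_def power2_eq_square algebra_simps)
    also have "\<dots> = ?E r + (complex_of_real (?E h) * R q p - complex_of_real (?E (\<lambda>x. (h x)\<^sup>2)) * T0 + v * T0)"
      by (simp del: of_real_power)
    finally have "?E (\<lambda>x. ?f (G({p, q} := x))) = ?E r"
      by (simp add: mean second_moment)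
    \<comment> \<open>The constant 12 is 4 from the Taylor remainder, averaged by the second moment,
      plus 8 from replacing \<open>T x\<close> by \<open>T0\<close>.\<close>
    moreover have "cmod (?E r) \<le> ?E (\<lambda>x. 4 * K / y ^ 3 * (h x)\<^sup>2 + 8 * K * v / y ^ 3)"
    proof (rule order.trans[OF integral_norm_bound], rule expectation_mono_finite[OF finite_law])
      fix x
      have "cmod (h x * (S x q p - (R q p - h x * T0))) \<le> K * (4 * (h x)\<^sup>2 / y ^ 3)"
        unfolding norm_mult S_def R_def T0_def norm_of_real
        by (intro mult_mono bounded K_nonneg resolvent_update_expand U sym y pq norm_ge_zero)
      moreover have "cmod (v * (T x - T0)) \<le> v * (8 * K / y ^ 3)"
      proof -
        have "cmod (T x - T0) \<le> 8 * \<bar>h x\<bar> / y ^ 3"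
          unfolding T_def S_def R_def T0_def by (rule resolvent_update_quadratic[OF U sym y pq])
        also have "\<dots> \<le> 8 * K / y ^ 3"
          using y bounded[of x] by (intro divide_right_mono) auto
        finally show ?thesis
          using v_nonneg by (simp add: norm_mult mult_left_mono del: times_divide_eq_right)
      qed
      ultimately have "cmod (r x) \<le> K * (4 * (h x)\<^sup>2 / y ^ 3) + v * (8 * K / y ^ 3)"
        unfolding r_def by (rule norm_triangle_mono)
      then show "cmod (r x) \<le> 4 * K / y ^ 3 * (h x)\<^sup>2 + 8 * K * v / y ^ 3"
        by (simp add: algebra_simps)
    qed
    moreover have "?E (\<lambda>x. 4 * K / y ^ 3 * (h x)\<^sup>2 + 8 * K * v / y ^ 3) = 12 * K * v / y ^ 3"
      by (simp add: second_moment add_divide_distrib[symmetric])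
    ultimately show ?thesis by simp
  qed
  have "{p, q} \<in> pairs U" using pq by (auto simp: pairs_def)
  then have resample: "measure_pmf.expectation (law U dflt) ?f = measure_pmf.expectation (law U dflt) (\<lambda>G. ?E (\<lambda>x. ?f (G({p, q} := x))))"
    unfolding law_def by (intro expectation_resample finite_pairs U finite_law)
  have "cmod (measure_pmf.expectation (law U dflt) (\<lambda>G. ?E (\<lambda>x. ?f (G({p, q} := x))))) \<le> measure_pmf.expectation (law U dflt) (\<lambda>G. cmod (?E (\<lambda>x. ?f (G({p, q} := x)))))"
    by (rule integral_norm_bound)
  also have "\<dots> \<le> measure_pmf.expectation (law U dflt) (\<lambda>_. 12 * K * v / y ^ 3)"
    by (intro expectation_mono_finite finite_set_law U inner)
  finally show ?thesis unfolding resample by simp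
qed

end

section \<open>The self-consistent equation\<close>

context entry_law
begin

text \<open>The trace of (W + i y) R = 1 contains the sum of the W_ij R_ji. The cumulant expansion
  turns each expected term into that of - v (R_ji^2 + R_ii R_jj), and the products R_ii R_jj add up
  to the squared trace.\<close>

lemma trace_equation:
  fixes U :: "'i set" and y :: real and dflt :: 'b and tr :: "('i set \<Rightarrow> 'b) \<Rightarrow> complex"
  defines "tr \<equiv> \<lambda>G. \<Sum>i\<in>U. resolvent U (wigner h G) y i i"
  assumes U: "finite U" and y: "y > 0"
  shows "cmod (card U - \<i> * y * measure_pmf.expectation (law U dflt) tr
      + v * measure_pmf.expectation (law U dflt) (\<lambda>G. (tr G)\<^sup>2))
    \<le> 12 * K * v * (card U)\<^sup>2 / y ^ 3 + 3 * v * card U / y\<^sup>2"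
proof -
  let ?E = "measure_pmf.expectation (law U dflt)"
  note [simp] = integrable_law[OF U, of dflt]
  define R where "R = (\<lambda>G. resolvent U (wigner h G) y)"
  define X where "X = (\<lambda>i j G. if i = j then 0 else wigner h G i j * R G j i + v * ((R G j i)\<^sup>2 + R G j j * R G i i))"
  \<comment> \<open>All quadratic terms except the squared trace: the squares R_ij^2, less the
    correction 2 R_ii^2 for the diagonal positions, where \<open>X\<close> is set to 0. Row bounds
    give 1 + 2 = 3 times v \<open>card U\<close> / y^2.\<close>
  define Z where "Z = (\<lambda>G. v * ((\<Sum>i\<in>U. \<Sum>j\<in>U. (R G i j)\<^sup>2) - 2 * (\<Sum>i\<in>U. (R G i i)\<^sup>2)))"
  have point: "card U - \<i> * y * tr G + v * (tr G)\<^sup>2 = (\<Sum>i\<in>U. \<Sum>j\<in>U. X i j G) - Z G" for G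
  proof -
    have "(\<Sum>j\<in>U. wigner h G i j * R G j i) + \<i> * y * R G i i = 1" if i: "i \<in> U" for i
    proof -
      have "mmul U (shift (wigner h G) y) (R G) i i = (\<Sum>j\<in>U. wigner h G i j * R G j i) + \<i> * y * mmul U unit_matrix (R G) i i"
        by (simp add: mmul_def shift_def distrib_right sum.distrib sum_distrib_left mult.assoc)
      then show ?thesis
        using shift_resolvent[OF U symmetric_on_wigner y i i, of h G] U i by (simp add: R_def unit_matrix_def)
    qed
    then have "(\<Sum>i\<in>U. (\<Sum>j\<in>U. wigner h G i j * R G j i) + \<i> * y * R G i i) = card U"
      by simp
    then have A: "(\<Sum>i\<in>U. \<Sum>j\<in>U. wigner h G i j * R G j i) = card U - \<i> * y * tr G"
      by (simp add: sum.distrib tr_def R_def sum_distrib_left algebra_simps)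
    have "(\<Sum>i\<in>U. \<Sum>j\<in>U. X i j G) = (\<Sum>i\<in>U. \<Sum>j\<in>U. wigner h G i j * R G j i + v * ((R G i j)\<^sup>2 + R G i i * R G j j)
        - (if i = j then 2 * v * (R G i i)\<^sup>2 else 0))"
      by (intro sum.cong refl) (simp add: X_def R_def wigner_def resolvent_sym[of U _ y] power2_eq_square algebra_simps)
    also have "\<dots> = (\<Sum>i\<in>U. \<Sum>j\<in>U. wigner h G i j * R G j i)
        + v * ((\<Sum>i\<in>U. \<Sum>j\<in>U. (R G i j)\<^sup>2) + (\<Sum>i\<in>U. \<Sum>j\<in>U. R G i i * R G j j)) - (\<Sum>i\<in>U. 2 * v * (R G i i)\<^sup>2)"
      using U by (simp add: sum.distrib sum_subtractf sum_distrib_left distrib_left)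
    also have "(\<Sum>i\<in>U. \<Sum>j\<in>U. R G i i * R G j j) = (tr G)\<^sup>2"
      by (simp add: tr_def R_def sum_product power2_eq_square)
    finally show ?thesis
      unfolding A by (simp add: Z_def sum_distrib_left algebra_simps)
  qed
  have ZG: "cmod (Z G) \<le> 3 * v * card U / y\<^sup>2" for G
  proof -
    define B where "B = card U / y\<^sup>2"
    have sumB: "(\<Sum>i\<in>U. 1 / y\<^sup>2) = B" by (simp add: B_def)
    have row: "(\<Sum>j\<in>U. (cmod (R G i j))\<^sup>2) \<le> 1 / y\<^sup>2" if "i \<in> U" for i
      unfolding R_def by (rule resolvent_row[OF U symmetric_on_wigner y that])
    have "cmod (\<Sum>i\<in>U. \<Sum>j\<in>U. (R G i j)\<^sup>2) \<le> (\<Sum>i\<in>U. 1 / y\<^sup>2)"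
    proof (rule order.trans[OF norm_sum], rule sum_mono)
      fix i assume "i \<in> U"
      then show "cmod (\<Sum>j\<in>U. (R G i j)\<^sup>2) \<le> 1 / y\<^sup>2"
        using row[of i] by (intro order.trans[OF norm_sum]) (simp add: norm_power)
    qed
    moreover have "cmod (2 * (\<Sum>i\<in>U. (R G i i)\<^sup>2)) \<le> 2 * (\<Sum>i\<in>U. 1 / y\<^sup>2)"
    proof -
      have "cmod (\<Sum>i\<in>U. (R G i i)\<^sup>2) \<le> (\<Sum>i\<in>U. 1 / y\<^sup>2)"
      proof (rule order.trans[OF norm_sum], rule sum_mono)
        fix i assume i: "i \<in> U"
        have "(cmod (R G i i))\<^sup>2 \<le> (\<Sum>j\<in>U. (cmod (R G i j))\<^sup>2)"
          using U i by (intro member_le_sum) auto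
        then show "cmod ((R G i i)\<^sup>2) \<le> 1 / y\<^sup>2"
          using row[OF i] by (simp add: norm_power)
      qed
      then show ?thesis by (simp add: norm_mult)
    qed
    ultimately have "cmod ((\<Sum>i\<in>U. \<Sum>j\<in>U. (R G i j)\<^sup>2) - 2 * (\<Sum>i\<in>U. (R G i i)\<^sup>2)) \<le> 3 * B"
      unfolding sumB by (intro order.trans[OF norm_triangle_ineq4]) linarith
    then have "v * cmod ((\<Sum>i\<in>U. \<Sum>j\<in>U. (R G i j)\<^sup>2) - 2 * (\<Sum>i\<in>U. (R G i i)\<^sup>2)) \<le> v * (3 * B)"
      by (rule mult_left_mono[OF _ v_nonneg])
    then show ?thesis
      using v_nonneg by (simp add: Z_def B_def norm_mult mult_ac)
  qed
  have "?E (\<lambda>G. cmod (Z G)) \<le> ?E (\<lambda>_. 3 * v * card U / y\<^sup>2)"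
    by (intro expectation_mono_finite finite_set_law U ZG)
  then have Z: "cmod (?E Z) \<le> 3 * v * card U / y\<^sup>2"
    using integral_norm_bound[of "law U dflt" Z] by (simp del: integral_norm_bound)
  have "cmod (?E (X i j)) \<le> 12 * K * v / y ^ 3" if ij: "i \<in> U" "j \<in> U" for i j
  proof (cases "i = j")
    case True
    then show ?thesis using K_nonneg v_nonneg y by (simp add: X_def)
  next
    case False
    then show ?thesis
      using resolvent_cumulant[OF U y ij False, of dflt] by (simp add: X_def R_def)
  qed
  then have "cmod (\<Sum>i\<in>U. \<Sum>j\<in>U. ?E (X i j)) \<le> (\<Sum>i\<in>U. \<Sum>j\<in>U. 12 * K * v / y ^ 3)"
    by (intro order.trans[OF norm_sum] order.trans[OF sum_mono[OF norm_sum]] sum_mono)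
  then have XX: "cmod (\<Sum>i\<in>U. \<Sum>j\<in>U. ?E (X i j)) \<le> 12 * K * v * (card U)\<^sup>2 / y ^ 3"
    by (simp add: power2_eq_square mult_ac)
  have "?E (\<lambda>G. card U - \<i> * y * tr G + v * (tr G)\<^sup>2) = (\<Sum>i\<in>U. \<Sum>j\<in>U. ?E (X i j)) - ?E Z"
    unfolding point by simp
  moreover have "?E (\<lambda>G. card U - \<i> * y * tr G + v * (tr G)\<^sup>2) = card U - \<i> * y * ?E tr + v * ?E (\<lambda>G. (tr G)\<^sup>2)"
    by simp
  ultimately have eq: "card U - \<i> * y * ?E tr + v * ?E (\<lambda>G. (tr G)\<^sup>2) = (\<Sum>i\<in>U. \<Sum>j\<in>U. ?E (X i j)) - ?E Z"
    by simp
  show ?thesis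
    unfolding eq by (rule order.trans[OF norm_triangle_ineq4 add_mono[OF XX Z]])
qed

text \<open>The trace is complex, so this is not a variance, but its modulus is at most the variance
  of the real part plus that of the imaginary part. One entry changes the trace by at most 4 K /
  y^2, whence the constant 32 = 2 * 16.\<close>

lemma trace_variance:
  fixes U :: "'i set" and y :: real and dflt :: 'b and tr :: "('i set \<Rightarrow> 'b) \<Rightarrow> complex"
  defines "tr \<equiv> \<lambda>G. \<Sum>i\<in>U. resolvent U (wigner h G) y i i"
  assumes U: "finite U" and y: "y > 0"
  shows "cmod (measure_pmf.expectation (law U dflt) (\<lambda>G. (tr G)\<^sup>2) - (measure_pmf.expectation (law U dflt) tr)\<^sup>2)
    \<le> 32 * K\<^sup>2 * (card U)\<^sup>2 / y ^ 4"
proof -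
  let ?E = "measure_pmf.expectation (law U dflt)"
  note [simp] = integrable_law[OF U, of dflt]
  define c where "c = 4 * K / y\<^sup>2"
  define \<tau> where "\<tau> = ?E tr"
  have diff: "cmod (tr (G(e := x)) - tr (G(e := x'))) \<le> c" if e_pair: "e \<in> pairs U" for G e x x'
  proof -
    obtain p q where e: "e = {p, q}" "p \<in> U" "q \<in> U" "p \<noteq> q"
      using e_pair by (auto simp: pairs_def)
    have "cmod (tr (G(e := x)) - tr (G(e := x'))) \<le> 2 * \<bar>h x - h x'\<bar> / y\<^sup>2"
      unfolding tr_def e(1) wigner_update_diff[OF e(4), of h G x x']
      by (rule resolvent_update_trace[OF U symmetric_on_wigner y e(2-4)])
    also have "\<dots> \<le> 2 * (2 * K) / y\<^sup>2"
      using bounded[of x] bounded[of x'] by (intro divide_right_mono mult_left_mono) auto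
    finally show ?thesis by (simp add: c_def)
  qed
  \<comment> \<open>Stated for an additive functional bounded by the modulus, to be used with
    \<open>Re\<close> and \<open>Im\<close>.\<close>
  have var: "?E (\<lambda>G. (f (tr G) - f \<tau>)\<^sup>2) \<le> card (pairs U) * c\<^sup>2"
    if f: "\<And>x y. f x - f y = f (x - y)" "\<And>x. \<bar>f x\<bar> \<le> cmod x" "f \<tau> = ?E (\<lambda>G. f (tr G))" for f :: "complex \<Rightarrow> real"
    unfolding f(3) law_def
    by (intro variance_Pi_pmf_le finite_pairs U finite_law)
       (use f(2) diff order.trans in \<open>unfold f(1), blast\<close>)
  have "?E (\<lambda>G. (tr G - \<tau>)\<^sup>2) = ?E (\<lambda>G. (tr G)\<^sup>2 - 2 * \<tau> * tr G + \<tau>\<^sup>2)"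
    by (intro Bochner_Integration.integral_cong refl) (simp add: power2_eq_square algebra_simps)
  then have "?E (\<lambda>G. (tr G)\<^sup>2) - \<tau>\<^sup>2 = ?E (\<lambda>G. (tr G - \<tau>)\<^sup>2)"
    by (simp add: \<tau>_def[symmetric]) (simp add: power2_eq_square)
  then have "cmod (?E (\<lambda>G. (tr G)\<^sup>2) - \<tau>\<^sup>2) \<le> ?E (\<lambda>G. cmod ((tr G - \<tau>)\<^sup>2))"
    by (simp only: integral_norm_bound)
  also have "?E (\<lambda>G. cmod ((tr G - \<tau>)\<^sup>2)) = ?E (\<lambda>G. (Re (tr G) - Re \<tau>)\<^sup>2 + (Im (tr G) - Im \<tau>)\<^sup>2)"
    by (simp add: norm_power cmod_power2)
  also have "\<dots> = ?E (\<lambda>G. (Re (tr G) - Re \<tau>)\<^sup>2) + ?E (\<lambda>G. (Im (tr G) - Im \<tau>)\<^sup>2)"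
    by simp
  also have "\<dots> \<le> card (pairs U) * c\<^sup>2 + card (pairs U) * c\<^sup>2"
    by (intro add_mono var) (simp_all add: abs_Re_le_cmod abs_Im_le_cmod \<tau>_def)
  also have "\<dots> \<le> real ((card U)\<^sup>2) * c\<^sup>2 + real ((card U)\<^sup>2) * c\<^sup>2"
    using card_pairs_le[OF U] by (intro add_mono mult_right_mono) (auto simp del: of_nat_power)
  also have "\<dots> = 32 * K\<^sup>2 * (card U)\<^sup>2 / y ^ 4"
    by (simp add: c_def power_divide power_mult_distrib power2_eq_square power4_eq_xxxx)
  finally show ?thesis unfolding \<tau>_def .
qed

end

text \<open>
  The limiting equation \<open>s\<^sup>2 - i y s + 1 = 0\<close> has one root in each half plane; a solution with error
  \<open>\<eta>\<close> in the lower half plane is at distance at least 1 from the wrong root.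
\<close>

lemma quadratic_stability:
  assumes y: "y > 0" and s: "Im s \<le> 0" "cmod (s\<^sup>2 - \<i> * y * s + 1) \<le> \<eta>"
  shows "\<bar>Im s - (y - sqrt (y\<^sup>2 + 4)) / 2\<bar> \<le> \<eta>"
proof -
  \<comment> \<open>The roots are i r and i l, with sum i y and product 1, so r l = -1; the wrong
    root i r lies at height at least 1.\<close>
  define r l where "r = (y + sqrt (y\<^sup>2 + 4)) / 2" and "l = (y - sqrt (y\<^sup>2 + 4)) / 2"
  have sum: "r + l = y" by (simp add: r_def l_def field_simps)
  have "(y + sqrt (y\<^sup>2 + 4)) * (y - sqrt (y\<^sup>2 + 4)) = y\<^sup>2 - (sqrt (y\<^sup>2 + 4))\<^sup>2"
    by (simp add: power2_eq_square algebra_simps)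
  then have prod: "r * l = -1"
    by (simp add: r_def l_def)
  have "sqrt (y\<^sup>2 + 4) \<ge> 2"
    by (rule real_le_rsqrt) simp
  then have r: "r \<ge> 1" using y by (simp add: r_def)
  have "(s - \<i> * r) * (s - \<i> * l) = s\<^sup>2 - \<i> * complex_of_real (r + l) * s - complex_of_real (r * l)"
    by (simp add: power2_eq_square algebra_simps)
  then have "cmod ((s - \<i> * r) * (s - \<i> * l)) \<le> \<eta>"
    using s(2) by (simp add: sum prod)
  then have *: "cmod (s - \<i> * r) * cmod (s - \<i> * l) \<le> \<eta>"
    by (simp add: norm_mult)
  have "1 \<le> cmod (s - \<i> * r)"
    using abs_Im_le_cmod[of "s - \<i> * r"] r s(1) by simp
  then have "1 * cmod (s - \<i> * l) \<le> cmod (s - \<i> * r) * cmod (s - \<i> * l)"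
    by (intro mult_right_mono) auto
  with * have "cmod (s - \<i> * l) \<le> \<eta>" by simp
  then show ?thesis
    using abs_Im_le_cmod[of "s - \<i> * l"] by (simp add: l_def)
qed

text \<open>With v = 1 / \<open>card U\<close>, dividing the trace equation by \<open>card U\<close>
  yields the limiting quadratic for the normalised mean trace. The three errors come from the
  cumulants, the leftover quadratic terms and the fluctuation of the trace.\<close>

lemma (in entry_law) spectral_mean_estimate:
  fixes U :: "'i set" and y :: real and dflt :: 'b
  assumes U: "finite U" "card U > 0" and v: "v = 1 / card U" and y: "y > 0"
  shows "\<bar>measure_pmf.expectation (law U dflt)
        (\<lambda>G. \<Sum>k\<in>U. (eigvals U (wigner h G) k)\<^sup>2 / ((eigvals U (wigner h G) k)\<^sup>2 + y\<^sup>2)) / card U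
      - (1 + y * ((y - sqrt (y\<^sup>2 + 4)) / 2))\<bar>
    \<le> y * (12 * K / y ^ 3 + 3 / (card U * y\<^sup>2) + 32 * K\<^sup>2 / y ^ 4)"
proof -
  let ?E = "measure_pmf.expectation (law U dflt)"
  note [simp] = integrable_law[OF U(1), of dflt]
  define tr where "tr = (\<lambda>G. \<Sum>i\<in>U. resolvent U (wigner h G) y i i)"
  define m where "m = real (card U)"
  have m: "m > 0" using U by (simp add: m_def)
  define \<tau> where "\<tau> = ?E tr"
  define \<eta> where "\<eta> = 12 * K / y ^ 3 + 3 / (m * y\<^sup>2) + 32 * K\<^sup>2 / y ^ 4"
  have 1: "cmod (m - \<i> * y * \<tau> + v * ?E (\<lambda>G. (tr G)\<^sup>2)) \<le> 12 * K * v * m\<^sup>2 / y ^ 3 + 3 * v * m / y\<^sup>2"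
    using trace_equation[OF U(1) y, of dflt] by (simp add: tr_def \<tau>_def m_def)
  have 2: "cmod (?E (\<lambda>G. (tr G)\<^sup>2) - \<tau>\<^sup>2) \<le> 32 * K\<^sup>2 * m\<^sup>2 / y ^ 4"
    using trace_variance[OF U(1) y, of dflt] by (simp add: tr_def \<tau>_def m_def)
  have "m - \<i> * y * \<tau> + v * \<tau>\<^sup>2 = (m - \<i> * y * \<tau> + v * ?E (\<lambda>G. (tr G)\<^sup>2)) - v * (?E (\<lambda>G. (tr G)\<^sup>2) - \<tau>\<^sup>2)"
    by (simp add: algebra_simps)
  moreover have "cmod (v * (?E (\<lambda>G. (tr G)\<^sup>2) - \<tau>\<^sup>2)) \<le> v * (32 * K\<^sup>2 * m\<^sup>2 / y ^ 4)"
    using mult_left_mono[OF 2 v_nonneg] v_nonneg by (simp add: norm_mult)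
  ultimately have "cmod (m - \<i> * y * \<tau> + v * \<tau>\<^sup>2) \<le> 12 * K * v * m\<^sup>2 / y ^ 3 + 3 * v * m / y\<^sup>2 + v * (32 * K\<^sup>2 * m\<^sup>2 / y ^ 4)"
    using 1 by (metis norm_triangle_le_diff add_mono)
  also have "\<dots> = m * \<eta>"
    using m by (simp add: v m_def[symmetric] \<eta>_def power2_eq_square field_simps)
  finally have 3: "cmod (m - \<i> * y * \<tau> + v * \<tau>\<^sup>2) \<le> m * \<eta>" .
  have "m * ((\<tau> / m)\<^sup>2 - \<i> * y * (\<tau> / m) + 1) = m - \<i> * y * \<tau> + v * \<tau>\<^sup>2"
    using m by (simp add: v m_def[symmetric] power2_eq_square field_simps)
  then have "m * cmod ((\<tau> / m)\<^sup>2 - \<i> * y * (\<tau> / m) + 1) \<le> m * \<eta>"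
    using 3 m by (metis abs_of_pos norm_mult norm_of_real)
  then have "cmod ((\<tau> / m)\<^sup>2 - \<i> * y * (\<tau> / m) + 1) \<le> \<eta>"
    using m by simp
  moreover have Im\<tau>: "Im \<tau> = ?E (\<lambda>G. Im (tr G))"
    by (simp add: \<tau>_def)
  have "?E (\<lambda>G. Im (tr G)) \<le> ?E (\<lambda>_. 0)"
    unfolding tr_def
    by (intro expectation_mono_finite finite_set_law U Im_resolvent_trace_nonpos symmetric_on_wigner y)
  then have "Im (\<tau> / m) \<le> 0"
    using m Im\<tau> by (simp add: divide_nonpos_pos)
  ultimately have 4: "\<bar>Im (\<tau> / m) - (y - sqrt (y\<^sup>2 + 4)) / 2\<bar> \<le> \<eta>"
    by (intro quadratic_stability y)
  have "?E (\<lambda>G. \<Sum>k\<in>U. (eigvals U (wigner h G) k)\<^sup>2 / ((eigvals U (wigner h G) k)\<^sup>2 + y\<^sup>2)) = ?E (\<lambda>G. m + y * Im (tr G))"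
    by (simp only: m_def tr_def Im_resolvent_trace[OF U(1) symmetric_on_wigner y])
  then have 5: "?E (\<lambda>G. \<Sum>k\<in>U. (eigvals U (wigner h G) k)\<^sup>2 / ((eigvals U (wigner h G) k)\<^sup>2 + y\<^sup>2)) = m + y * Im \<tau>"
    by (simp add: Im\<tau>)
  have "\<bar>(m + y * Im \<tau>) / m - (1 + y * ((y - sqrt (y\<^sup>2 + 4)) / 2))\<bar> = y * \<bar>Im (\<tau> / m) - (y - sqrt (y\<^sup>2 + 4)) / 2\<bar>"
  proof -
    have "(m + y * Im \<tau>) / m - (1 + y * ((y - sqrt (y\<^sup>2 + 4)) / 2)) = y * (Im (\<tau> / m) - (y - sqrt (y\<^sup>2 + 4)) / 2)"
      using m by (simp add: add_divide_distrib right_diff_distrib)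
    then show ?thesis using y by (simp only: abs_mult abs_of_pos)
  qed
  then show ?thesis
    using mult_left_mono[OF 4, of y] y unfolding 5 m_def[symmetric] \<eta>_def[symmetric] by simp
qed

section \<open>Mean nuclear norm of a Wigner matrix\<close>

lemma has_bochner_integral_FTC_atLeast:
  fixes f F :: "real \<Rightarrow> real"
  assumes f: "f \<in> borel_measurable borel" and nonneg: "\<And>x. a \<le> x \<Longrightarrow> 0 \<le> f x"
    and F: "\<And>x. a \<le> x \<Longrightarrow> (F has_real_derivative f x) (at x)" and T: "(F \<longlongrightarrow> T) at_top"
  shows "has_bochner_integral lborel (\<lambda>x. indicator {a..} x * f x) (T - F a)"
proof (rule has_bochner_integral_nn_integral)
  have "(\<integral>\<^sup>+x. ennreal (indicator {a..} x * f x) \<partial>lborel) = (\<integral>\<^sup>+x\<in>{a..}. ennreal (f x) \<partial>lborel)"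
    by (intro nn_integral_cong) (auto split: split_indicator)
  also have "\<dots> = ennreal (T - F a)"
    by (rule nn_integral_FTC_atLeast[OF f F nonneg T])
  finally show "(\<integral>\<^sup>+x. ennreal (indicator {a..} x * f x) \<partial>lborel) = ennreal (T - F a)" .
  have "F a \<le> F x" if "a \<le> x" for x
    using that nonneg F by (intro DERIV_nonneg_imp_nondecreasing[of a x F]) auto
  then have "F a \<le> T"
    by (intro tendsto_lowerbound[OF T]) (auto simp: eventually_at_top_linorder)
  then show "0 \<le> T - F a" by simp
qed (use f nonneg in \<open>auto split: split_indicator\<close>)

lemma coulson_integral:
  "has_bochner_integral lborel (\<lambda>y. indicator {0..} y * (d\<^sup>2 / (d\<^sup>2 + y\<^sup>2))) (\<bar>d\<bar> * (pi / 2))"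
proof (cases "d = 0")
  case True
  then show ?thesis by (simp add: has_bochner_integral_zero)
next
  case False
  define e where "e = \<bar>d\<bar>"
  have e: "e > 0" "d\<^sup>2 = e\<^sup>2" using False by (simp_all add: e_def)
  define F where "F = (\<lambda>y. e * arctan (y / e))"
  have "has_bochner_integral lborel (\<lambda>y. indicator {0..} y * (d\<^sup>2 / (d\<^sup>2 + y\<^sup>2))) (e * (pi / 2) - F 0)"
  proof (rule has_bochner_integral_FTC_atLeast)
    fix y :: real
    have "1 + (y / e)\<^sup>2 = (e\<^sup>2 + y\<^sup>2) / e\<^sup>2"
      using e by (simp add: power_divide add_divide_distrib)
    then have "e * (inverse (1 + (y / e)\<^sup>2) * (1 / e)) = d\<^sup>2 / (d\<^sup>2 + y\<^sup>2)"
      using e by simp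
    moreover have "(F has_real_derivative e * (inverse (1 + (y / e)\<^sup>2) * (1 / e))) (at y)"
      unfolding F_def
      by (intro DERIV_cmult DERIV_chain2[where f = arctan] DERIV_arctan DERIV_cdivide DERIV_ident)
    ultimately show "(F has_real_derivative d\<^sup>2 / (d\<^sup>2 + y\<^sup>2)) (at y)" by simp
  next
    have "filterlim (\<lambda>y. y / e) at_top at_top"
      using e(1) by real_asymp
    then show "(F \<longlongrightarrow> e * (pi / 2)) at_top"
      unfolding F_def by (intro tendsto_mult tendsto_const filterlim_compose[OF tendsto_arctan_at_top])
  qed auto
  then show ?thesis by (simp add: F_def e_def)
qed

text \<open>For y > 0 this is the integral of x^2 / (x^2 + y^2) against the semicircle law,
  expressed by the root in the lower half plane.\<close>

definition semicircle_kernel :: "real \<Rightarrow> real" where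
  "semicircle_kernel y = 1 + y * ((y - sqrt (y\<^sup>2 + 4)) / 2)"

lemma semicircle_kernel_integral:
  "has_bochner_integral lborel (\<lambda>y. indicator {0..} y * semicircle_kernel y) (4 / 3)"
proof -
  \<comment> \<open>The antiderivative is normalised to vanish at infinity, since (y^2 + 4)^(3/2) =
    y^3 + 6 y + o(1). The integral is therefore - F 0 = 4 * 2 / 6.\<close>
  define F where "F = (\<lambda>y::real. y + y ^ 3 / 6 - (y\<^sup>2 + 4) * sqrt (y\<^sup>2 + 4) / 6)"
  have "has_bochner_integral lborel (\<lambda>y. indicator {0..} y * semicircle_kernel y) (0 - F 0)"
  proof (rule has_bochner_integral_FTC_atLeast)
    fix y :: real
    define w where "w = sqrt (y\<^sup>2 + 4)"
    have pos: "y\<^sup>2 + 4 > 0" by (simp add: add_nonneg_pos)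
    have w: "w > 0" "w\<^sup>2 = y\<^sup>2 + 4" using pos by (auto simp: w_def)
    have k: "semicircle_kernel y = 1 + y * ((y - w) / 2)"
      by (simp add: semicircle_kernel_def w_def)
    have "((\<lambda>y. sqrt (y\<^sup>2 + 4)) has_real_derivative inverse (sqrt (y\<^sup>2 + 4)) / 2 * (2 * y)) (at y)"
      by (rule DERIV_chain2[where f = sqrt and g = "\<lambda>y. y\<^sup>2 + 4"], rule DERIV_real_sqrt[OF pos])
        (auto intro!: derivative_eq_intros)
    then have W: "((\<lambda>y. sqrt (y\<^sup>2 + 4)) has_real_derivative y / w) (at y)"
      by (simp add: w_def field_simps)
    have P: "((\<lambda>y. y ^ 3 / 6) has_real_derivative 3 * y\<^sup>2 / 6) (at y)"
      and Q: "((\<lambda>y. y\<^sup>2 + 4) has_real_derivative 2 * y) (at y)"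
      by (auto intro!: derivative_eq_intros)
    have "(F has_real_derivative 1 + 3 * y\<^sup>2 / 6 - (2 * y * w + y / w * (y\<^sup>2 + 4)) / 6) (at y)"
      unfolding F_def
      using DERIV_diff[OF DERIV_add[OF DERIV_ident P] DERIV_cdivide[OF DERIV_mult[OF Q W], of 6]]
      by (simp add: w_def)
    moreover have "y / w * (y\<^sup>2 + 4) = y * w"
      unfolding w(2)[symmetric] using w(1) by (simp add: power2_eq_square)
    moreover have "1 + 3 * y\<^sup>2 / 6 - (2 * y * w + y * w) / 6 = semicircle_kernel y"
      unfolding k by (simp add: power2_eq_square field_simps)
    ultimately show "(F has_real_derivative semicircle_kernel y) (at y)"
      by simp
    show "0 \<le> semicircle_kernel y"
    proof -
      have "y * w \<le> y\<^sup>2 + 2"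
      proof (rule power2_le_imp_le)
        have "(y * w)\<^sup>2 = y\<^sup>2 * (y\<^sup>2 + 4)" by (simp add: power_mult_distrib w(2))
        then show "(y * w)\<^sup>2 \<le> (y\<^sup>2 + 2)\<^sup>2" by (simp add: power2_eq_square algebra_simps)
      qed simp
      then have "0 \<le> (y\<^sup>2 + 2 - y * w) / 2" by simp
      also have "(y\<^sup>2 + 2 - y * w) / 2 = semicircle_kernel y"
        unfolding k by (simp add: power2_eq_square field_simps)
      finally show ?thesis .
    qed
  next
    show "(F \<longlongrightarrow> 0) at_top" unfolding F_def by real_asymp
  qed (auto simp: semicircle_kernel_def)
  moreover have "sqrt 4 = (2::real)" by (rule real_sqrt_unique) auto
  ultimately show ?thesis by (simp add: F_def)
qed

lemma has_bochner_integral_expectation: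
  fixes f :: "'a \<Rightarrow> 'b \<Rightarrow> real"
  assumes p: "finite (set_pmf p)" and f: "\<And>x. has_bochner_integral M (f x) (I x)"
  shows "has_bochner_integral M (\<lambda>y. measure_pmf.expectation p (\<lambda>x. f x y)) (measure_pmf.expectation p I)"
  unfolding integral_measure_pmf[OF p, simplified]
  using f by (subst (1 2) integral_measure_pmf[OF p]) (auto intro!: has_bochner_integral_sum has_bochner_integral_mult_left)

text \<open>The squared Frobenius norm in two bases; it controls the spectrum through entry bounds
  alone and leads to the integrable majorant.\<close>

lemma eigensystem_sum_squares:
  assumes e: "eigensystem U a d u" and U: "finite U"
  shows "(\<Sum>k\<in>U. (d k)\<^sup>2) = (\<Sum>i\<in>U. \<Sum>j\<in>U. (a i j)\<^sup>2)"
proof -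
  have "(\<Sum>j\<in>U. (a i j)\<^sup>2) = (\<Sum>k\<in>U. (d k)\<^sup>2 * (u k i)\<^sup>2)" if i: "i \<in> U" for i
  proof -
    have "(\<Sum>j\<in>U. (a i j)\<^sup>2) = (\<Sum>j\<in>U. (\<Sum>k\<in>U. u k j * (d k * u k i))\<^sup>2)"
      using e i by (intro sum.cong refl arg_cong[where f = "\<lambda>x. x\<^sup>2"]) (auto simp: eigensystem_def mult_ac)
    then show ?thesis
      by (simp add: eigensystem_parseval_dual[OF e U] power_mult_distrib)
  qed
  then have "(\<Sum>i\<in>U. \<Sum>j\<in>U. (a i j)\<^sup>2) = (\<Sum>i\<in>U. \<Sum>k\<in>U. (d k)\<^sup>2 * (u k i)\<^sup>2)"
    by simp
  also have "\<dots> = (\<Sum>k\<in>U. \<Sum>i\<in>U. (d k)\<^sup>2 * (u k i)\<^sup>2)"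
    by (rule sum.swap)
  also have "\<dots> = (\<Sum>k\<in>U. (d k)\<^sup>2 * (\<Sum>i\<in>U. u k i * u k i))"
    by (simp add: sum_distrib_left power2_eq_square)
  also have "\<dots> = (\<Sum>k\<in>U. (d k)\<^sup>2)"
    using e by (intro sum.cong refl) (simp add: eigensystem_def unit_matrix_def)
  finally show ?thesis by simp
qed

section \<open>Passing to the limit\<close>

context entry_law
begin

definition mean_nuc :: "'i set \<Rightarrow> 'b \<Rightarrow> real" where
  "mean_nuc U dflt = measure_pmf.expectation (law U dflt) (\<lambda>G. nuc U (wigner h G))"

end

lemma wigner_scale: "wigner (\<lambda>x. t * h x) G = (\<lambda>i j. t * wigner h G i j)"
  by (intro ext) (simp add: wigner_def)

theorem (in entry_law) mean_nuc_limit: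
  fixes U :: "nat \<Rightarrow> 'i set" and dflt :: 'b
  assumes U: "\<And>n. finite (U n)" and lim: "filterlim (\<lambda>n. card (U n)) at_top sequentially" and v: "v > 0"
  shows "(\<lambda>n. mean_nuc (U n) dflt / real (card (U n)) powr (3/2)) \<longlonglongrightarrow> 8 / (3 * pi) * sqrt v"
proof -
  define m where "m = (\<lambda>n. real (card (U n)))"
  \<comment> \<open>Rescales the entries to variance 1 / m, as \<open>spectral_mean_estimate\<close>
    requires.\<close>
  define t where "t = (\<lambda>n. 1 / sqrt (v * m n))"
  define W where "W = (\<lambda>n. wigner (\<lambda>x. t n * h x) :: ('i set \<Rightarrow> 'b) \<Rightarrow> 'i \<Rightarrow> 'i \<Rightarrow> real)"
  define d where "d = (\<lambda>n G. eigvals (U n) (W n G))"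
  let ?E = "\<lambda>n. measure_pmf.expectation (law (U n) dflt)"
  note [simp] = integrable_law[OF U, of _ dflt]
  define \<phi> where "\<phi> = (\<lambda>n y. ?E n (\<lambda>G. indicator {0..} y * (\<Sum>k\<in>U n. (d n G k)\<^sup>2 / ((d n G k)\<^sup>2 + y\<^sup>2)) / m n))"
  have m_lim: "filterlim m at_top sequentially"
    unfolding m_def by (intro filterlim_compose[OF filterlim_real_sequentially] lim)
  have m_pos: "eventually (\<lambda>n. m n > 0) sequentially"
    using m_lim by (simp add: filterlim_at_top_dense)
  have es: "eigensystem (U n) (W n G) (d n G) (eigvecs (U n) (W n G))" for n G
    unfolding d_def W_def by (intro eigensystem_eig U symmetric_on_wigner)
  have nucW: "nuc (U n) (W n G) = (\<Sum>k\<in>U n. \<bar>d n G k\<bar>)" for n G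
    by (rule nuc_eigensystem[OF es U])

  have int: "has_bochner_integral lborel (\<phi> n) (?E n (\<lambda>G. nuc (U n) (W n G) * (pi / 2) / m n))" for n
  proof -
    have "has_bochner_integral lborel (\<lambda>y. (\<Sum>k\<in>U n. indicator {0..} y * ((d n G k)\<^sup>2 / ((d n G k)\<^sup>2 + y\<^sup>2))) / m n)
        ((\<Sum>k\<in>U n. \<bar>d n G k\<bar> * (pi / 2)) / m n)" for G
      by (intro has_bochner_integral_divide has_bochner_integral_sum coulson_integral)
    then show ?thesis
      unfolding \<phi>_def nucW sum_distrib_left sum_distrib_right
      by (intro has_bochner_integral_expectation finite_set_law U)
  qed

  \<comment> \<open>The error bound blows up as y tends to 0, so convergence is only pointwise; the
    point 0 is a null set.\<close>
  have lim_pointwise: "(\<lambda>n. \<phi> n y) \<longlonglongrightarrow> indicator {0..} y * semicircle_kernel y" if "y \<noteq> 0" for y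
  proof (cases "y > 0")
    case False
    then show ?thesis using that by (simp add: \<phi>_def)
  next
    case True
    define \<eta> where "\<eta> = (\<lambda>n. y * (12 * (t n * K) / y ^ 3 + 3 / (m n * y\<^sup>2) + 32 * (t n * K)\<^sup>2 / y ^ 4))"
    have t_lim: "t \<longlonglongrightarrow> 0"
    proof -
      have "((\<lambda>x. 1 / sqrt (v * x)) \<longlongrightarrow> 0) at_top" using v by real_asymp
      then show ?thesis unfolding t_def by (rule filterlim_compose[OF _ m_lim])
    qed
    have "(\<lambda>n. 3 / (m n * y\<^sup>2)) \<longlonglongrightarrow> 0"
    proof -
      have "((\<lambda>x. 3 / (x * y\<^sup>2)) \<longlongrightarrow> 0) at_top" using True by real_asymp
      then show ?thesis by (rule filterlim_compose[OF _ m_lim])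
    qed
    with t_lim have "\<eta> \<longlonglongrightarrow> y * (12 * (0 * K) / y ^ 3 + 0 + 32 * (0 * K)\<^sup>2 / y ^ 4)"
      unfolding \<eta>_def using True by (intro tendsto_intros) auto
    then have \<eta>: "\<eta> \<longlonglongrightarrow> 0" by simp
    have "eventually (\<lambda>n. \<bar>\<phi> n y - indicator {0..} y * semicircle_kernel y\<bar> \<le> \<eta> n) sequentially"
      using m_pos
    proof eventually_elim
      case (elim n)
      have t: "t n > 0" "(t n)\<^sup>2 * v = 1 / card (U n)"
        using elim v by (simp_all add: t_def m_def power_divide)
      interpret scaled: entry_law D "\<lambda>x. t n * h x" "(t n)\<^sup>2 * v" "\<bar>t n\<bar> * K"
        by (rule scaled)
      have "\<bar>?E n (\<lambda>G. \<Sum>k\<in>U n. (d n G k)\<^sup>2 / ((d n G k)\<^sup>2 + y\<^sup>2)) / m n - semicircle_kernel y\<bar> \<le> \<eta> n"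
      proof -
        have "card (U n) > 0" using elim by (simp add: m_def)
        from scaled.spectral_mean_estimate[OF U this t(2) True, of dflt] show ?thesis
          unfolding d_def W_def \<eta>_def m_def semicircle_kernel_def abs_of_pos[OF t(1)] .
      qed
      then show ?case
        using True by (simp add: \<phi>_def)
    qed
    then have "eventually (\<lambda>n. norm (\<phi> n y - indicator {0..} y * semicircle_kernel y) \<le> \<eta> n) sequentially"
      by (simp only: real_norm_def)
    from Lim_null_comparison[OF this \<eta>] show ?thesis
      by (rule LIM_zero_cancel)
  qed

  \<comment> \<open>The 1 takes care of y near 0, and K^2 / v bounds the mean squared eigenvalue,
    which governs the decay at infinity. The scale \<open>t\<close> cancels, so one majorant serves
    all \<open>n\<close>.\<close>
  define C where "C = 1 + K\<^sup>2 / v"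
  have bound: "norm (\<phi> n y) \<le> indicator {0..} y * (C * (1 / (1 + y\<^sup>2)))" for n y
  proof (cases "m n = 0")
    \<comment> \<open>For an empty index set, division by 0 makes \<open>\<phi>\<close>
      vanish.\<close>
    case True
    have "0 \<le> C" using v by (simp add: C_def)
    then show ?thesis using True by (simp add: \<phi>_def)
  next
    case False
    then have mn: "m n > 0" by (simp add: m_def)
    have "(\<Sum>k\<in>U n. (d n G k)\<^sup>2 / ((d n G k)\<^sup>2 + y\<^sup>2)) / m n \<le> C * (1 / (1 + y\<^sup>2))" for G
    proof -
      have "(\<Sum>k\<in>U n. (d n G k)\<^sup>2) = (\<Sum>i\<in>U n. \<Sum>j\<in>U n. (W n G i j)\<^sup>2)"
        by (rule eigensystem_sum_squares[OF es U])
      also have "\<dots> \<le> (\<Sum>i\<in>U n. \<Sum>j\<in>U n. (t n)\<^sup>2 * K\<^sup>2)"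
      proof (intro sum_mono)
        fix i j
        have "\<bar>W n G i j\<bar> \<le> \<bar>t n\<bar> * K"
          using bounded K_nonneg by (auto simp: W_def wigner_def abs_mult mult_left_mono)
        then have "(W n G i j)\<^sup>2 \<le> (\<bar>t n\<bar> * K)\<^sup>2"
          using K_nonneg by (simp add: abs_le_square_iff[symmetric])
        then show "(W n G i j)\<^sup>2 \<le> (t n)\<^sup>2 * K\<^sup>2" by (simp add: power_mult_distrib)
      qed
      also have "\<dots> = m n * (K\<^sup>2 / v)"
        using mn v by (simp add: t_def m_def power_divide field_simps)
      finally have sq: "(\<Sum>k\<in>U n. (d n G k)\<^sup>2) \<le> m n * (K\<^sup>2 / v)" .
      have "(\<Sum>k\<in>U n. (d n G k)\<^sup>2 / ((d n G k)\<^sup>2 + y\<^sup>2)) \<le> (\<Sum>k\<in>U n. (1 + (d n G k)\<^sup>2) * (1 / (1 + y\<^sup>2)))"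
      proof (intro sum_mono)
        fix k
        \<comment> \<open>After clearing denominators this reads 0 \<le> z + x^2.\<close>
        have "x / (x + z) \<le> (1 + x) * (1 / (1 + z))" if "x \<ge> 0" "z \<ge> 0" for x z :: real
        proof (cases "x = 0")
          case False
          then have "x > 0" using that by simp
          then show ?thesis using that by (simp add: divide_simps) (simp add: algebra_simps)
        qed (use that in simp)
        then show "(d n G k)\<^sup>2 / ((d n G k)\<^sup>2 + y\<^sup>2) \<le> (1 + (d n G k)\<^sup>2) * (1 / (1 + y\<^sup>2))" by simp
      qed
      also have "\<dots> = (m n + (\<Sum>k\<in>U n. (d n G k)\<^sup>2)) * (1 / (1 + y\<^sup>2))"
        by (simp only: sum_distrib_right[symmetric] sum.distrib) (simp add: m_def)
      also have "\<dots> \<le> (C * m n) * (1 / (1 + y\<^sup>2))"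
        using sq by (intro mult_right_mono) (auto simp: C_def algebra_simps)
      finally show ?thesis using mn by (simp add: pos_divide_le_eq mult_ac)
    qed
    then have "indicator {0..} y * (\<Sum>k\<in>U n. (d n G k)\<^sup>2 / ((d n G k)\<^sup>2 + y\<^sup>2)) / m n \<le> indicator {0..} y * (C * (1 / (1 + y\<^sup>2)))" for G
      by (simp split: split_indicator)
    then have "\<phi> n y \<le> ?E n (\<lambda>_. indicator {0..} y * (C * (1 / (1 + y\<^sup>2))))"
      unfolding \<phi>_def by (intro expectation_mono_finite finite_set_law U)
    moreover have "\<phi> n y \<ge> 0"
      unfolding \<phi>_def using mn
      by (intro Bochner_Integration.integral_nonneg divide_nonneg_nonneg mult_nonneg_nonneg sum_nonneg) auto
    ultimately show ?thesis by simp
  qed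

  have "has_bochner_integral lborel (\<lambda>y. C * (indicator {0..} y * (1\<^sup>2 / (1\<^sup>2 + y\<^sup>2)))) (C * (\<bar>1\<bar> * (pi / 2)))"
    by (intro has_bochner_integral_mult_right coulson_integral)
  then have "integrable lborel (\<lambda>y. indicator {0..} y * (C * (1 / (1 + y\<^sup>2))))"
    by (auto simp: has_bochner_integral_iff mult_ac)
  then have dominating: "integrable lborel (\<lambda>y. indicator {0..} y * (C * (1 / (1 + y\<^sup>2))))" .
  have "(\<lambda>n. integral\<^sup>L lborel (\<phi> n)) \<longlonglongrightarrow> integral\<^sup>L lborel (\<lambda>y. indicator {0..} y * semicircle_kernel y)"
  proof (rule integral_dominated_convergence[OF _ _ dominating])
    show "(\<lambda>y. indicator {0..} y * semicircle_kernel y) \<in> borel_measurable lborel"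
      by (rule borel_measurable_has_bochner_integral[OF semicircle_kernel_integral])
    show "\<phi> n \<in> borel_measurable lborel" for n
      by (rule borel_measurable_has_bochner_integral[OF int])
    show "AE y in lborel. norm (\<phi> n y) \<le> indicator {0..} y * (C * (1 / (1 + y\<^sup>2)))" for n
      by (intro AE_I2 bound)
    show "AE y in lborel. (\<lambda>n. \<phi> n y) \<longlonglongrightarrow> indicator {0..} y * semicircle_kernel y"
      using AE_lborel_singleton[of 0] by eventually_elim (rule lim_pointwise)
  qed
  then have L: "(\<lambda>n. ?E n (\<lambda>G. nuc (U n) (W n G) * (pi / 2) / m n)) \<longlonglongrightarrow> 4 / 3"
    unfolding has_bochner_integral_integral_eq[OF int] has_bochner_integral_integral_eq[OF semicircle_kernel_integral] .
  \<comment> \<open>Undoes the scaling: t / m is 1 / (sqrt v m^(3/2)). The limit 4 / 3 then becomes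
    (2 / pi) (4 / 3) = 8 / (3 pi).\<close>
  have "eventually (\<lambda>n. sqrt v * (2 / pi) * ?E n (\<lambda>G. nuc (U n) (W n G) * (pi / 2) / m n)
      = mean_nuc (U n) dflt / real (card (U n)) powr (3/2)) sequentially"
    using m_pos
  proof eventually_elim
    case (elim n)
    have t: "t n > 0" using elim v by (simp add: t_def)
    have "nuc (U n) (W n G) = t n * nuc (U n) (wigner h G)" for G
      unfolding W_def wigner_scale nuc_scale[OF U] using t by simp
    then have E: "?E n (\<lambda>G. nuc (U n) (W n G) * (pi / 2) / m n) = t n * (pi / 2) / m n * mean_nuc (U n) dflt"
      by (simp add: mean_nuc_def)
    have powr: "m n powr (3/2) = m n * sqrt (m n)"
      using elim by (simp add: powr_half_sqrt[symmetric] powr_mult_base)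
    have "real (card (U n)) = m n" by (simp add: m_def)
    then show ?case
      unfolding E using elim v by (simp add: powr t_def real_sqrt_mult)
  qed
  moreover have "(\<lambda>n. sqrt v * (2 / pi) * ?E n (\<lambda>G. nuc (U n) (W n G) * (pi / 2) / m n)) \<longlonglongrightarrow> sqrt v * (2 / pi) * (4 / 3)"
    by (intro tendsto_mult tendsto_const L)
  ultimately have "(\<lambda>n. mean_nuc (U n) dflt / real (card (U n)) powr (3/2)) \<longlonglongrightarrow> sqrt v * (2 / pi) * (4 / 3)"
    by (rule Lim_transform_eventually[rotated])
  then show ?thesis by (simp add: mult_ac)
qed

section \<open>Random multipartite signed graphs\<close>

text \<open>The block on \<open>V\<close> reads only pairs inside \<open>V\<close>, and the product
  law restricts to them; the block is thus itself a Wigner matrix on \<open>V\<close>.\<close>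

lemma (in entry_law) expectation_nuc_subset:
  assumes U: "finite U" and V: "V \<subseteq> U"
  shows "measure_pmf.expectation (law U dflt) (\<lambda>G. nuc V (wigner h G)) = mean_nuc V dflt"
proof -
  have "law V dflt = map_pmf (\<lambda>f x. if x \<in> pairs V then f x else dflt) (law U dflt)"
    unfolding law_def by (intro Pi_pmf_subset finite_pairs U pairs_mono V)
  moreover have "nuc V (wigner h (\<lambda>x. if x \<in> pairs V then G x else dflt)) = nuc V (wigner h G)" for G
    by (intro nuc_cong) (auto simp: wigner_def in_pairs)
  ultimately show ?thesis
    by (simp add: mean_nuc_def)
qed

section \<open>Complete multipartite graphs\<close>

text \<open>The edge set is kept apart from the weights, because centring gives an absent edge the
  weight q - p while positions inside the parts must stay 0.\<close>

definition edge_matrix :: "'i set set \<Rightarrow> ('i set \<Rightarrow> real) \<Rightarrow> 'i \<Rightarrow> 'i \<Rightarrow> real" where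
  "edge_matrix E w i j = (if {i, j} \<in> E then w {i, j} else 0)"

lemma edge_matrix_nuc_update:
  assumes "finite U" "\<And>e. e \<noteq> {p, q} \<Longrightarrow> w e = w' e"
  shows "\<bar>nuc U (edge_matrix E w) - nuc U (edge_matrix E w')\<bar> \<le> 2 * \<bar>w {p, q} - w' {p, q}\<bar>"
proof -
  define t where "t = (if {p, q} \<in> E then w {p, q} - w' {p, q} else 0)"
  have "edge_matrix E w i j - edge_matrix E w' i j = (if {i, j} = {p, q} then t else 0)" for i j
    using assms(2)[of "{i, j}"] by (auto simp: edge_matrix_def t_def)
  then have "\<bar>nuc U (edge_matrix E w) - nuc U (edge_matrix E w')\<bar> \<le> nuc U (\<lambda>i j. if {i, j} = {p, q} then t else 0)"
    using nuc_diff[OF assms(1), of "edge_matrix E w" "edge_matrix E w'"] by simp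
  also have "\<dots> \<le> 2 * \<bar>t\<bar>"
    by (rule nuc_two_entries[OF assms(1)])
  also have "\<dots> \<le> 2 * \<bar>w {p, q} - w' {p, q}\<bar>"
    by (simp add: t_def)
  finally show ?thesis .
qed

locale vertex_partition =
  fixes k :: nat and V :: "nat \<Rightarrow> nat set" and U :: "nat set"
  assumes finite_vertices: "finite U"
    and cover: "(\<Union>i\<in>{1..k}. V i) = U"
    and disjoint: "disjoint_family_on V {1..k}"
begin

lemma part_subset: "l \<in> {1..k} \<Longrightarrow> V l \<subseteq> U"
  using cover by blast

lemma part_unique: "i \<in> V l \<Longrightarrow> i \<in> V l' \<Longrightarrow> l \<in> {1..k} \<Longrightarrow> l' \<in> {1..k} \<Longrightarrow> l = l'"
  using disjoint unfolding disjoint_family_on_def by blast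

lemma sum_card_parts: "(\<Sum>l\<in>{1..k}. card (V l)) = card U"
  unfolding cover[symmetric]
  by (rule card_UN_disjoint'[OF disjoint, symmetric])
    (rule finite_subset[OF part_subset finite_vertices], assumption, simp)

text \<open>Having no part in common excludes loops as well as edges inside a part, and needs no
  choice of the two parts.\<close>

lemma multipartite_edges_iff:
  "{i, j} \<in> multipartite_edges k V \<longleftrightarrow> i \<in> U \<and> j \<in> U \<and> (\<forall>l\<in>{1..k}. \<not> (i \<in> V l \<and> j \<in> V l))"
proof
  assume "{i, j} \<in> multipartite_edges k V"
  then obtain u v a b where *: "{i, j} = {u, v}" "a \<in> {1..k}" "b \<in> {1..k}" "a \<noteq> b" "u \<in> V a" "v \<in> V b"
    unfolding multipartite_edges_def by blast
  have "u \<in> U" "v \<in> U"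
    using part_subset[OF *(2)] part_subset[OF *(3)] *(5,6) by auto
  moreover have "\<not> (u \<in> V l \<and> v \<in> V l)" if "l \<in> {1..k}" for l
    using part_unique[OF *(5) _ *(2) that] part_unique[OF *(6) _ *(3) that] *(4) by auto
  ultimately have uv: "u \<in> U" "v \<in> U" "\<forall>l\<in>{1..k}. \<not> (u \<in> V l \<and> v \<in> V l)"
    by auto
  from *(1) have "i = u \<and> j = v \<or> i = v \<and> j = u"
    by (simp add: doubleton_eq_iff)
  with uv show "i \<in> U \<and> j \<in> U \<and> (\<forall>l\<in>{1..k}. \<not> (i \<in> V l \<and> j \<in> V l))"
    by blast
next
  assume *: "i \<in> U \<and> j \<in> U \<and> (\<forall>l\<in>{1..k}. \<not> (i \<in> V l \<and> j \<in> V l))"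
  then have "i \<in> (\<Union>l\<in>{1..k}. V l)" "j \<in> (\<Union>l\<in>{1..k}. V l)"
    by (simp_all only: cover)
  then obtain a b where ab: "a \<in> {1..k}" "i \<in> V a" "b \<in> {1..k}" "j \<in> V b"
    by (elim UN_E)
  then have "a \<noteq> b" using * by auto
  then show "{i, j} \<in> multipartite_edges k V"
    unfolding multipartite_edges_def
    by (intro CollectI exI[of _ i] exI[of _ j] exI[of _ a] exI[of _ b] conjI refl ab)
qed

lemma multipartite_edges_subset: "multipartite_edges k V \<subseteq> pairs U"
proof
  fix e assume e: "e \<in> multipartite_edges k V"
  then obtain i j where ij: "e = {i, j}"
    unfolding multipartite_edges_def by blast
  with e have *: "i \<in> U" "j \<in> U" "\<forall>l\<in>{1..k}. \<not> (i \<in> V l \<and> j \<in> V l)"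
    unfolding ij multipartite_edges_iff by simp_all
  from *(1) have "i \<in> (\<Union>l\<in>{1..k}. V l)"
    by (simp only: cover)
  then have "i \<noteq> j" using *(3) by (elim UN_E) auto
  with *(1,2) ij show "e \<in> pairs U" by (auto simp: pairs_def)
qed

text \<open>Disjointness leaves at most one nonzero term. The diagonal blocks thus add up to the
  complement of the edge pattern, diagonal included.\<close>

lemma sum_same_part:
  assumes "i \<in> U" "j \<in> U"
  shows "(\<Sum>l\<in>{1..k}. if i \<in> V l \<and> j \<in> V l then x else 0) = (if {i, j} \<in> multipartite_edges k V then 0 else x :: real)"
proof (cases "{i, j} \<in> multipartite_edges k V")
  case True
  then have "\<forall>l\<in>{1..k}. \<not> (i \<in> V l \<and> j \<in> V l)"
    unfolding multipartite_edges_iff by blast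
  then have "(\<Sum>l\<in>{1..k}. if i \<in> V l \<and> j \<in> V l then x else 0) = 0"
    by (intro sum.neutral) auto
  then show ?thesis using True by simp
next
  case False
  then obtain a where a: "a \<in> {1..k}" "i \<in> V a" "j \<in> V a"
    using assms unfolding multipartite_edges_iff by blast
  have "(\<Sum>l\<in>{1..k}. if i \<in> V l \<and> j \<in> V l then x else 0) = (\<Sum>l\<in>{1..k}. if l = a then x else 0)"
    using a part_unique by (intro sum.cong refl) auto
  then show ?thesis using a False by simp
qed

text \<open>The pattern is the all-ones matrix minus the all-ones blocks on the parts; their norms
  are at most the part sizes, which add up to \<open>card U\<close> once more.\<close>

lemma nuc_multipartite_le: "nuc U (edge_matrix (multipartite_edges k V) (\<lambda>_. 1)) \<le> 2 * card U"
proof -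
  let ?K = "edge_matrix (multipartite_edges k V) (\<lambda>_. 1)"
  let ?J = "\<lambda>l i j. if i \<in> V l \<and> j \<in> V l then 1 else 0 :: real"
  have "\<bar>nuc U ?K - nuc U (\<lambda>_ _. 1)\<bar> \<le> nuc U (\<lambda>i j. ?K i j - 1)"
    by (rule nuc_diff[OF finite_vertices])
  also have "\<dots> = nuc U (\<lambda>i j. - 1 * (\<Sum>l\<in>{1..k}. ?J l i j))"
    by (intro nuc_cong) (simp only: sum_same_part edge_matrix_def, simp)
  also have "\<dots> = nuc U (\<lambda>i j. \<Sum>l\<in>{1..k}. ?J l i j)"
    by (subst nuc_scale[OF finite_vertices]) simp
  also have "\<dots> \<le> (\<Sum>l\<in>{1..k}. nuc U (?J l))"
    by (rule nuc_sum[OF finite_vertices])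
  also have "\<dots> \<le> (\<Sum>l\<in>{1..k}. real (card (V l)))"
    by (intro sum_mono order.trans[OF nuc_restrict[OF finite_vertices part_subset]] nuc_const_le
        finite_subset[OF part_subset finite_vertices])
  also have "\<dots> = card U"
    unfolding sum_card_parts[symmetric] by simp
  finally show ?thesis
    using nuc_const_le[OF finite_vertices] by linarith
qed

text \<open>On every outcome the masked matrix differs from the full Wigner matrix by its diagonal
  blocks, so the estimate holds before averaging.\<close>

lemma expectation_multipartite:
  fixes D :: "'b pmf"
  assumes "entry_law D h v K"
  shows "\<bar>measure_pmf.expectation (entry_law.law D U dflt) (\<lambda>G. nuc U (edge_matrix (multipartite_edges k V) (\<lambda>e. h (G e))))
      - entry_law.mean_nuc D h U dflt\<bar> \<le> (\<Sum>l\<in>{1..k}. entry_law.mean_nuc D h (V l) dflt)"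
proof -
  interpret entry_law D h v K by fact
  note integrable = integrable_law[OF finite_vertices, of dflt]
  let ?E = "measure_pmf.expectation (law U dflt)"
  let ?M = "\<lambda>G. edge_matrix (multipartite_edges k V) (\<lambda>e. h (G e))"
  have "\<bar>nuc U (?M G) - nuc U (wigner h G)\<bar> \<le> (\<Sum>l\<in>{1..k}. nuc (V l) (wigner h G))" for G
  proof -
    let ?W = "\<lambda>l i j. if i \<in> V l \<and> j \<in> V l then wigner h G i j else 0"
    have "\<bar>nuc U (?M G) - nuc U (wigner h G)\<bar> \<le> nuc U (\<lambda>i j. ?M G i j - wigner h G i j)"
      by (rule nuc_diff[OF finite_vertices])
    also have "\<dots> = nuc U (\<lambda>i j. - 1 * (\<Sum>l\<in>{1..k}. ?W l i j))"
    proof (rule nuc_cong)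
      fix i j assume ij: "i \<in> U" "j \<in> U"
      have "i \<noteq> j" if "{i, j} \<in> multipartite_edges k V"
        using subsetD[OF multipartite_edges_subset that] by (simp add: in_pairs)
      then show "?M G i j - wigner h G i j = - 1 * (\<Sum>l\<in>{1..k}. ?W l i j)"
        unfolding sum_same_part[OF ij] by (auto simp: edge_matrix_def wigner_def)
    qed
    also have "\<dots> = nuc U (\<lambda>i j. \<Sum>l\<in>{1..k}. ?W l i j)"
      by (subst nuc_scale[OF finite_vertices]) simp
    also have "\<dots> \<le> (\<Sum>l\<in>{1..k}. nuc U (?W l))"
      by (rule nuc_sum[OF finite_vertices])
    also have "\<dots> \<le> (\<Sum>l\<in>{1..k}. nuc (V l) (wigner h G))"
      by (intro sum_mono nuc_restrict[OF finite_vertices part_subset])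
    finally show ?thesis .
  qed
  then have 1: "?E (\<lambda>G. \<bar>nuc U (?M G) - nuc U (wigner h G)\<bar>) \<le> ?E (\<lambda>G. \<Sum>l\<in>{1..k}. nuc (V l) (wigner h G))"
    by (intro expectation_mono_finite finite_set_law finite_vertices)
  have 2: "?E (\<lambda>G. \<Sum>l\<in>{1..k}. nuc (V l) (wigner h G)) = (\<Sum>l\<in>{1..k}. ?E (\<lambda>G. nuc (V l) (wigner h G)))"
    by (rule Bochner_Integration.integral_sum) (rule integrable)
  have 3: "(\<Sum>l\<in>{1..k}. ?E (\<lambda>G. nuc (V l) (wigner h G))) = (\<Sum>l\<in>{1..k}. mean_nuc (V l) dflt)"
  proof (rule sum.cong[OF refl])
    fix l assume "l \<in> {1..k}"
    then show "?E (\<lambda>G. nuc (V l) (wigner h G)) = mean_nuc (V l) dflt"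
      by (rule expectation_nuc_subset[OF finite_vertices part_subset])
  qed
  have 4: "\<bar>?E (\<lambda>G. nuc U (?M G) - nuc U (wigner h G))\<bar> \<le> ?E (\<lambda>G. \<bar>nuc U (?M G) - nuc U (wigner h G)\<bar>)"
    using integral_norm_bound[of "law U dflt" "\<lambda>G. nuc U (?M G) - nuc U (wigner h G)"]
    by (simp only: real_norm_def)
  have 5: "?E (\<lambda>G. nuc U (?M G) - nuc U (wigner h G)) = ?E (\<lambda>G. nuc U (?M G)) - mean_nuc U dflt"
    unfolding mean_nuc_def by (rule Bochner_Integration.integral_diff) (rule integrable)+
  from order.trans[OF 4 1] show ?thesis
    unfolding 2 3 5 .
qed

end

section \<open>The law of a signed edge\<close>

lemma pmf_of_list_edge_wf:
  fixes p q :: real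
  assumes "p \<ge> 0" "q \<ge> 0" "p + q \<le> 1"
  shows "pmf_of_list_wf [(Some Pos, p), (Some Neg, q), (None, 1 - p - q)]"
proof -
  have "0 \<le> 1 - p - q" using assms by linarith
  moreover have "p + (q + (1 - p - q)) = 1" by linarith
  ultimately show ?thesis using assms by (auto simp: pmf_of_list_wf_def)
qed

lemma set_edge_pmf: "set_pmf D \<subseteq> {Some Pos, Some Neg, None}"
proof
  fix x :: "edge_sign option"
  show "x \<in> {Some Pos, Some Neg, None}"
  proof (cases x)
    case (Some s)
    then show ?thesis by (cases s) auto
  qed simp
qed

lemma expectation_edge_pmf:
  fixes f :: "edge_sign option \<Rightarrow> real" and p q :: real
  assumes "p \<ge> 0" "q \<ge> 0" "p + q \<le> 1"
  shows "measure_pmf.expectation (edge_pmf p q) f = p * f (Some Pos) + q * f (Some Neg) + (1 - p - q) * f None"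
proof -
  have "measure_pmf.expectation (edge_pmf p q) f
      = (\<Sum>x\<in>{Some Pos, Some Neg, None}. pmf (edge_pmf p q) x *\<^sub>R f x)"
    using set_edge_pmf by (intro integral_measure_pmf) auto
  then show ?thesis
    using pmf_of_list_edge_wf[OF assms] by (simp add: edge_pmf_def pmf_pmf_of_list)
qed

lemma sign_value_simps: "sign_value (Some Pos) = 1" "sign_value (Some Neg) = -1" "sign_value None = 0"
  by (simp_all add: sign_value_def)

lemma edge_law:
  fixes p q :: real
  assumes pq: "p \<ge> 0" "q \<ge> 0" "p + q \<le> 1"
  shows "entry_law (edge_pmf p q) (\<lambda>x. sign_value x - (p - q)) (p + q - (p - q)\<^sup>2) 2"
proof
  show "finite (set_pmf (edge_pmf p q))"
    using set_edge_pmf by (rule finite_subset) auto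
  show "measure_pmf.expectation (edge_pmf p q) (\<lambda>x. sign_value x - (p - q)) = 0"
    unfolding expectation_edge_pmf[OF pq] sign_value_simps by (simp add: power2_eq_square algebra_simps)
  show "measure_pmf.expectation (edge_pmf p q) (\<lambda>x. (sign_value x - (p - q))\<^sup>2) = p + q - (p - q)\<^sup>2"
    unfolding expectation_edge_pmf[OF pq] sign_value_simps by (simp add: power2_eq_square algebra_simps)
  show "\<bar>sign_value x - (p - q)\<bar> \<le> 2" for x
    using pq by (auto simp: sign_value_def split: option.split edge_sign.split)
qed

section \<open>Mean and fluctuations of the energy\<close>

context
  fixes k n :: nat and V :: "nat \<Rightarrow> nat set" and p q :: real
  assumes pq: "p \<ge> 0" "q \<ge> 0" "p + q \<le> 1" and partition: "vertex_partition k V {..<n}"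
begin

interpretation vertex_partition k V "{..<n}" by (fact partition)

interpretation entry_law "edge_pmf p q" "\<lambda>x. sign_value x - (p - q)" "p + q - (p - q)\<^sup>2" 2
  by (rule edge_law[OF pq])

lemma finite_multipartite_edges: "finite (multipartite_edges k V)"
  using multipartite_edges_subset by (rule finite_subset) (simp add: finite_pairs)

text \<open>A coupling: signs are drawn on all pairs and those inside parts forgotten, so that the
  graph and the full Wigner matrix live on one probability space.\<close>

lemma random_multipartite_restrict:
  "random_multipartite k V p q = map_pmf (\<lambda>G e. if e \<in> multipartite_edges k V then G e else None) (law {..<n} None)"
  unfolding random_multipartite_def law_def
  by (intro Pi_pmf_subset finite_pairs multipartite_edges_subset) simp

lemma finite_set_random_multipartite: "finite (set_pmf (random_multipartite k V p q))"
  unfolding random_multipartite_def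
  by (intro finite_set_Pi_pmf finite_multipartite_edges finite_law)

lemma energy_edge_matrix:
  assumes "G \<in> set_pmf (random_multipartite k V p q)"
  shows "energy n G = nuc {..<n} (edge_matrix (multipartite_edges k V) (\<lambda>e. sign_value (G e)))"
proof -
  have "G e = None" if "e \<notin> multipartite_edges k V" for e
    using assms that set_Pi_pmf_subset[OF finite_multipartite_edges] by (force simp: random_multipartite_def)
  then show ?thesis
    unfolding energy_eq_nuc by (intro nuc_cong) (auto simp: edge_matrix_def sign_value_def)
qed

lemma mean_energy:
  "\<bar>measure_pmf.expectation (random_multipartite k V p q) (energy n) - mean_nuc {..<n} None\<bar>
    \<le> 2 * n + (\<Sum>l\<in>{1..k}. mean_nuc (V l) None)"
proof -
  let ?E = "measure_pmf.expectation (law {..<n} None)"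
  let ?M = "edge_matrix (multipartite_edges k V) :: _ \<Rightarrow> nat \<Rightarrow> nat \<Rightarrow> real"
  note [simp] = integrable_law[OF finite_vertices, of None]
  have diff: "\<bar>energy n (\<lambda>e. if e \<in> multipartite_edges k V then G e else None)
      - nuc {..<n} (?M (\<lambda>e. sign_value (G e) - (p - q)))\<bar> \<le> 2 * n" for G
  proof -
    have "energy n (\<lambda>e. if e \<in> multipartite_edges k V then G e else None) = nuc {..<n} (?M (\<lambda>e. sign_value (G e)))"
      unfolding energy_eq_nuc by (intro nuc_cong) (auto simp: edge_matrix_def sign_value_def)
    moreover have "\<bar>nuc {..<n} (?M (\<lambda>e. sign_value (G e))) - nuc {..<n} (?M (\<lambda>e. sign_value (G e) - (p - q)))\<bar>
        \<le> nuc {..<n} (\<lambda>i j. ?M (\<lambda>e. sign_value (G e)) i j - ?M (\<lambda>e. sign_value (G e) - (p - q)) i j)"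
      by (rule nuc_diff) simp
    moreover have "nuc {..<n} (\<lambda>i j. ?M (\<lambda>e. sign_value (G e)) i j - ?M (\<lambda>e. sign_value (G e) - (p - q)) i j)
        = nuc {..<n} (\<lambda>i j. (p - q) * ?M (\<lambda>_. 1) i j)"
      by (intro nuc_cong) (auto simp: edge_matrix_def)
    moreover have "\<bar>p - q\<bar> * nuc {..<n} (?M (\<lambda>_. 1)) \<le> 1 * (2 * real n)"
    proof (rule mult_mono)
      show "nuc {..<n} (?M (\<lambda>_. 1)) \<le> 2 * real n"
        using nuc_multipartite_le by simp
    qed (use pq in \<open>auto simp: nuc_nonneg\<close>)
    ultimately show ?thesis by (simp add: nuc_scale)
  qed
  define X where "X = (\<lambda>G. energy n (\<lambda>e. if e \<in> multipartite_edges k V then G e else None)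
        - nuc {..<n} (?M (\<lambda>e. sign_value (G e) - (p - q))))"
  have "\<bar>?E X\<bar> \<le> ?E (\<lambda>G. \<bar>X G\<bar>)"
    using integral_norm_bound[of "law {..<n} None" X] by (simp only: real_norm_def)
  also have "\<dots> \<le> ?E (\<lambda>_. 2 * n)"
    unfolding X_def by (intro expectation_mono_finite finite_set_law finite_vertices diff)
  finally have "\<bar>?E X\<bar> \<le> 2 * n" by simp
  then have "\<bar>measure_pmf.expectation (random_multipartite k V p q) (energy n)
      - ?E (\<lambda>G. nuc {..<n} (?M (\<lambda>e. sign_value (G e) - (p - q))))\<bar> \<le> 2 * n"
    by (simp add: random_multipartite_restrict X_def)
  then show ?thesis
    using expectation_multipartite[OF entry_law_axioms, of None] by linarith
qed

lemma energy_concentration: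
  assumes a: "a > 0"
  shows "measure_pmf.prob (random_multipartite k V p q)
      {G. \<bar>energy n G - measure_pmf.expectation (random_multipartite k V p q) (energy n)\<bar> < a}
    \<ge> 1 - 16 * n\<^sup>2 / a\<^sup>2"
proof -
  let ?P = "random_multipartite k V p q" and ?E = "multipartite_edges k V"
  \<comment> \<open>On the support \<open>f\<close> is the energy; in this form
    \<open>edge_matrix_nuc_update\<close> controls the effect of one edge.\<close>
  define f where "f = (\<lambda>G. nuc {..<n} (edge_matrix ?E (\<lambda>e. sign_value (G e))))"
  define \<mu> where "\<mu> = measure_pmf.expectation ?P f"
  have fe: "f G = energy n G" if "G \<in> set_pmf ?P" for G
    using energy_edge_matrix[OF that] by (simp add: f_def)
  have \<mu>: "\<mu> = measure_pmf.expectation ?P (energy n)"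
    unfolding \<mu>_def by (intro integral_cong_AE) (auto simp: AE_measure_pmf_iff fe)
  have "measure_pmf.expectation ?P (\<lambda>G. (f G - \<mu>)\<^sup>2) \<le> real (card ?E) * 4\<^sup>2"
    unfolding \<mu>_def random_multipartite_def
  proof (rule variance_Pi_pmf_le[OF finite_multipartite_edges finite_law])
    fix G e x x' assume "e \<in> ?E"
    then obtain i j where e: "e = {i, j}" unfolding multipartite_edges_def by blast
    have "\<bar>f (G(e := x)) - f (G(e := x'))\<bar> \<le> 2 * \<bar>sign_value x - sign_value x'\<bar>"
      using edge_matrix_nuc_update[of "{..<n}" i j "\<lambda>e'. sign_value ((G(e := x)) e')" "\<lambda>e'. sign_value ((G(e := x')) e')" ?E]
      by (simp add: f_def e)
    \<comment> \<open>Two sign values differ by at most 2, and an edge fills two positions.\<close>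
    also have "\<dots> \<le> 4"
      by (auto simp: sign_value_def split: option.split edge_sign.split)
    finally show "\<bar>f (G(e := x)) - f (G(e := x'))\<bar> \<le> 4" .
  qed
  also have "\<dots> \<le> 16 * (real n)\<^sup>2"
  proof -
    have "card ?E \<le> card (pairs {..<n})"
      by (intro card_mono finite_pairs multipartite_edges_subset) simp
    also have "\<dots> \<le> n\<^sup>2" using card_pairs_le[of "{..<n}"] by simp
    finally have "real (card ?E) \<le> real (n\<^sup>2)" by (simp only: of_nat_le_iff)
    then show ?thesis by simp
  qed
  finally have var: "measure_pmf.expectation ?P (\<lambda>G. (f G - \<mu>)\<^sup>2) \<le> 16 * (real n)\<^sup>2" .
  have "measure_pmf.prob ?P {G \<in> space (measure_pmf ?P). a \<le> \<bar>f G - \<mu>\<bar>} \<le> measure_pmf.expectation ?P (\<lambda>G. (f G - \<mu>)\<^sup>2) / a\<^sup>2"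
    unfolding \<mu>_def
    by (intro measure_pmf.Chebyshev_inequality integrable_measure_pmf_finite finite_set_random_multipartite a) simp
  then have "measure_pmf.prob ?P {G. a \<le> \<bar>f G - \<mu>\<bar>} \<le> measure_pmf.expectation ?P (\<lambda>G. (f G - \<mu>)\<^sup>2) / a\<^sup>2"
    by (simp only: space_measure_pmf UNIV_I simp_thms)
  also have "\<dots> \<le> 16 * (real n)\<^sup>2 / a\<^sup>2"
    by (intro divide_right_mono var) simp
  finally have "measure_pmf.prob ?P {G. a \<le> \<bar>f G - \<mu>\<bar>} \<le> 16 * (real n)\<^sup>2 / a\<^sup>2" .
  moreover have "measure_pmf.prob ?P {G. \<bar>f G - \<mu>\<bar> < a} = 1 - measure_pmf.prob ?P {G. a \<le> \<bar>f G - \<mu>\<bar>}"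
  proof -
    have "{G. \<bar>f G - \<mu>\<bar> < a} = space (measure_pmf ?P) - {G. a \<le> \<bar>f G - \<mu>\<bar>}" by auto
    then show ?thesis
      using measure_pmf.prob_compl[of "{G. a \<le> \<bar>f G - \<mu>\<bar>}" ?P] by (simp only: sets_measure_pmf UNIV_I simp_thms)
  qed
  moreover have "measure_pmf.prob ?P {G. \<bar>f G - \<mu>\<bar> < a} = measure_pmf.prob ?P {G. \<bar>energy n G - \<mu>\<bar> < a}"
    by (intro measure_pmf.finite_measure_eq_AE) (auto simp: AE_measure_pmf_iff fe)
  ultimately show ?thesis
    unfolding \<mu> by simp
qed

text \<open>A sign of variance 0 is constant on its support, so the graph is complete multipartite
  with a single sign, or empty.\<close>

lemma energy_degenerate:
  assumes "p + q - (p - q)\<^sup>2 = 0" and G: "G \<in> set_pmf (random_multipartite k V p q)"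
  shows "energy n G = \<bar>p - q\<bar> * nuc {..<n} (edge_matrix (multipartite_edges k V) (\<lambda>_. 1))"
proof -
  have "measure_pmf.expectation (edge_pmf p q) (\<lambda>x. (sign_value x - (p - q))\<^sup>2) = 0"
    unfolding second_moment by (rule assms(1))
  then have "AE x in edge_pmf p q. (sign_value x - (p - q))\<^sup>2 = 0"
    by (rule integral_nonneg_eq_0_iff_AE[THEN iffD1, rotated 2])
      (auto intro: integrable_measure_pmf_finite finite_law)
  then have "sign_value x = p - q" if "x \<in> set_pmf (edge_pmf p q)" for x
    using that by (auto simp: AE_measure_pmf_iff)
  moreover have "G e \<in> set_pmf (edge_pmf p q)" if "e \<in> multipartite_edges k V" for e
    using G that by (auto simp: random_multipartite_def set_Pi_pmf[OF finite_multipartite_edges] PiE_dflt_def)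
  ultimately have "energy n G = nuc {..<n} (\<lambda>i j. (p - q) * edge_matrix (multipartite_edges k V) (\<lambda>_. 1) i j)"
    unfolding energy_edge_matrix[OF G] by (intro nuc_cong) (auto simp: edge_matrix_def)
  then show ?thesis by (simp add: nuc_scale)
qed

end

text \<open>
  One deterministic error sequence has to serve both inequalities. When \<open>e n\<close> is below \<open>C\<close>, the upper
  bound has room to spare and a slightly decreased constant works; otherwise the lower bound does.
\<close>

lemma common_error_sequence:
  fixes e S \<delta> :: "nat \<Rightarrow> real"
  assumes C: "C > 0" and S: "S \<longlonglongrightarrow> s" "0 < s" "s < 1" and \<delta>: "\<delta> \<longlonglongrightarrow> 0" "\<And>n. \<delta> n \<ge> 0"
    and e: "eventually (\<lambda>n. (1 - S n) * C - \<delta> n \<le> e n \<and> e n \<le> (1 + S n) * C + \<delta> n) sequentially"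
  shows "\<exists>\<epsilon>. \<epsilon> \<longlonglongrightarrow> 0 \<and> eventually (\<lambda>n. C + \<epsilon> n > 0 \<and>
    (\<forall>x. \<bar>x - e n\<bar> \<le> \<delta> n \<longrightarrow> (1 - S n) * (C + \<epsilon> n) \<le> x \<and> x \<le> (1 + S n) * (C + \<epsilon> n))) sequentially"
proof -
  \<comment> \<open>Chosen so that (1 - S n) B \<ge> 2 eventually: one \<delta> absorbs the error in
    \<open>e\<close>, the other the distance from \<open>x\<close> to \<open>e\<close>.\<close>
  define B where "B = 4 / (1 - s)"
  have B: "B > 0" using S by (simp add: B_def)
  define \<epsilon> where "\<epsilon> = (\<lambda>n. if e n \<le> C then - (B * \<delta> n) else B * \<delta> n)"
  have abs: "\<bar>\<epsilon> n\<bar> = B * \<delta> n" for n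
    using B \<delta>(2)[of n] by (simp add: \<epsilon>_def abs_mult)
  have B\<delta>: "(\<lambda>n. B * \<delta> n) \<longlonglongrightarrow> 0"
    using tendsto_mult_right_zero[OF \<delta>(1)] by simp
  have lim: "\<epsilon> \<longlonglongrightarrow> 0"
    by (rule Lim_null_comparison[OF _ B\<delta>]) (simp add: abs)
  have "eventually (\<lambda>n. 1 - S n > (1 - s) / 2) sequentially"
    using S by (intro order_tendstoD(1)[of _ "1 - s"] tendsto_intros) auto
  moreover have "eventually (\<lambda>n. S n > 0) sequentially"
    using S by (intro order_tendstoD(1)[of _ s]) auto
  moreover have "eventually (\<lambda>n. C + \<epsilon> n > 0) sequentially"
    using C by (intro order_tendstoD(1)[of _ "C + 0"] tendsto_add lim) auto
  \<comment> \<open>The room to spare: the left side tends to (1 + s) C, strictly above C because s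
    > 0. The next fact is its mirror image for the lower bound.\<close>
  moreover have "eventually (\<lambda>n. (1 + S n) * (C + \<epsilon> n) - \<delta> n > C) sequentially"
  proof (rule order_tendstoD(1))
    show "(\<lambda>n. (1 + S n) * (C + \<epsilon> n) - \<delta> n) \<longlonglongrightarrow> (1 + s) * (C + 0) - 0"
      by (intro tendsto_intros S lim \<delta>)
    show "C < (1 + s) * (C + 0) - 0" using S C by (simp add: algebra_simps)
  qed
  moreover have "eventually (\<lambda>n. (1 - S n) * (C + \<epsilon> n) + \<delta> n < C) sequentially"
  proof (rule order_tendstoD(2))
    show "(\<lambda>n. (1 - S n) * (C + \<epsilon> n) + \<delta> n) \<longlonglongrightarrow> (1 - s) * (C + 0) + 0"
      by (intro tendsto_intros S lim \<delta>)
    show "(1 - s) * (C + 0) + 0 < C" using S C by (simp add: algebra_simps)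
  qed
  ultimately have "eventually (\<lambda>n. C + \<epsilon> n > 0 \<and>
    (\<forall>x. \<bar>x - e n\<bar> \<le> \<delta> n \<longrightarrow> (1 - S n) * (C + \<epsilon> n) \<le> x \<and> x \<le> (1 + S n) * (C + \<epsilon> n))) sequentially"
    using e
  proof eventually_elim
    case (elim n)
    have "(1 - s) / 2 * (B * \<delta> n) = 2 * \<delta> n"
      using S by (simp add: B_def)
    moreover have "(1 - s) / 2 * (B * \<delta> n) \<le> (1 - S n) * (B * \<delta> n)"
      using elim(1) B \<delta>(2)[of n] by (intro mult_right_mono) auto
    ultimately have low: "2 * \<delta> n \<le> (1 - S n) * (B * \<delta> n)" by linarith
    also have "\<dots> \<le> (1 + S n) * (B * \<delta> n)"
      using elim(2) B \<delta>(2)[of n] by (intro mult_right_mono) auto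
    finally have high: "2 * \<delta> n \<le> (1 + S n) * (B * \<delta> n)" .
    have "(1 - S n) * (C + \<epsilon> n) \<le> x \<and> x \<le> (1 + S n) * (C + \<epsilon> n)" if x: "\<bar>x - e n\<bar> \<le> \<delta> n" for x
    proof (cases "e n \<le> C")
      case True
      then have "(1 - S n) * (C + \<epsilon> n) = (1 - S n) * C - (1 - S n) * (B * \<delta> n)"
        by (simp add: \<epsilon>_def right_diff_distrib)
      then show ?thesis using True x low elim(4,6) by linarith
    next
      case False
      then have "(1 + S n) * (C + \<epsilon> n) = (1 + S n) * C + (1 + S n) * (B * \<delta> n)"
        by (simp add: \<epsilon>_def distrib_left)
      then show ?thesis using False x high elim(5,6) by linarith
    qed
    with elim(3) show ?case by blast
  qed
  with lim show ?thesis by blast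
qed

text \<open>With at least two positive summands every \<open>b i\<close> is below 1, and the power
  3/2 strictly decreases it. These strict bounds provide the room needed in
  \<open>common_error_sequence\<close>.\<close>

lemma sum_powr_limit:
  fixes b :: "nat \<Rightarrow> real"
  assumes k: "k \<ge> 2" and b: "\<And>i. i \<in> {1..k} \<Longrightarrow> b i > 0" and sum: "(\<Sum>i\<in>{1..k}. b i) = 1"
  shows "0 < (\<Sum>i\<in>{1..k}. b i powr (3/2))" "(\<Sum>i\<in>{1..k}. b i powr (3/2)) < 1"
proof -
  have b1: "b i < 1" if i: "i \<in> {1..k}" for i
  proof -
    \<comment> \<open>Some index other than \<open>i\<close>, available because k \<ge> 2.\<close>
    define j where "j = (if i = 1 then 2 else 1 :: nat)"
    have j: "j \<in> {1..k}" "j \<noteq> i" using k by (auto simp: j_def)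
    have "b i + b j = (\<Sum>l\<in>{i, j}. b l)" using j by simp
    also have "\<dots> \<le> (\<Sum>l\<in>{1..k}. b l)"
      using i j b by (intro sum_mono2) (auto intro: less_imp_le)
    finally show ?thesis using b[OF j(1)] sum by linarith
  qed
  show "0 < (\<Sum>i\<in>{1..k}. b i powr (3/2))"
  proof (rule sum_pos)
    fix i assume "i \<in> {1..k}"
    from b[OF this] show "0 < b i powr (3/2)" by simp
  qed (use k in auto)
  have "(\<Sum>i\<in>{1..k}. b i powr (3/2)) < (\<Sum>i\<in>{1..k}. b i)"
  proof (rule sum_strict_mono)
    fix i assume i: "i \<in> {1..k}"
    have "b i powr (3/2) < b i powr 1"
      by (rule powr_less_mono'[OF b[OF i] b1[OF i]]) simp
    then show "b i powr (3/2) < b i" using b[OF i] by simp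
  qed (use k in auto)
  then show "(\<Sum>i\<in>{1..k}. b i powr (3/2)) < 1" using sum by simp
qed

theorem theorem3p1:
  fixes k :: nat and p q :: real
    and \<beta> :: "nat \<Rightarrow> nat \<Rightarrow> real"
    and V :: "nat \<Rightarrow> nat \<Rightarrow> nat set"
  assumes k: "k \<ge> 2"
    and pq: "p \<ge> 0" "q \<ge> 0" "p + q \<le> 1"
    and parts_cover: "\<And>n. (\<Union>i\<in>{1..k}. V n i) = {0..<n}"
    and parts_disjoint: "\<And>n. disjoint_family_on (V n) {1..k}"
    and parts_card: "\<And>n i. i \<in> {1..k} \<Longrightarrow> real (card (V n i)) = real n * \<beta> i n"
    and \<beta>_lim: "\<And>i. i \<in> {1..k} \<Longrightarrow> \<exists>b>0. \<beta> i \<longlonglongrightarrow> b"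
  shows "\<exists>\<epsilon> :: nat \<Rightarrow> real. \<epsilon> \<longlonglongrightarrow> 0 \<and>
    (\<lambda>n. measure_pmf.prob (random_multipartite k (V n) p q)
       {G. let c = 8 / (3 * pi) * sqrt (p + q - (p - q)^2) + \<epsilon> n;
               S = (\<Sum>i=1..k. \<beta> i n powr (3/2))
           in if c = 0 then energy n G = 0
              else real n powr (3/2) * (1 - S) \<le> energy n G * inverse c \<and>
                   energy n G * inverse c \<le> real n powr (3/2) * (1 + S)})
    \<longlonglongrightarrow> 1"
proof -
  define v where "v = p + q - (p - q)\<^sup>2"
  define S where "S = (\<lambda>n. \<Sum>i\<in>{1..k}. \<beta> i n powr (3/2))"
  define N where "N = (\<lambda>n. real n powr (3/2))"
  define P where "P = (\<lambda>n. random_multipartite k (V n) p q)"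
  define C where "C = 8 / (3 * pi) * sqrt v"
  define good where "good = (\<lambda>\<epsilon> n. {G. if C + \<epsilon> n = 0 then energy n G = 0
      else N n * (1 - S n) \<le> energy n G * inverse (C + \<epsilon> n) \<and> energy n G * inverse (C + \<epsilon> n) \<le> N n * (1 + S n)})"
  have partition: "vertex_partition k (V n) {..<n}" for n
    using parts_cover[of n] parts_disjoint[of n] by unfold_locales (simp_all add: lessThan_atLeast0)
  interpret entry_law "edge_pmf p q" "\<lambda>x. sign_value x - (p - q)" v 2
    unfolding v_def by (rule edge_law[OF pq])
  have N_pos: "eventually (\<lambda>n. N n > 0) sequentially"
    using eventually_gt_at_top[of 0] by eventually_elim (simp add: N_def)
  have S_nonneg: "S n \<ge> 0" for n
    unfolding S_def by (intro sum_nonneg) simp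
  have "\<exists>\<epsilon> :: nat \<Rightarrow> real. \<epsilon> \<longlonglongrightarrow> 0 \<and> (\<lambda>n. measure_pmf.prob (P n) (good \<epsilon> n)) \<longlonglongrightarrow> 1"
  proof (cases "v = 0")
    case True
    define Q where "Q = (\<lambda>n. \<bar>p - q\<bar> * nuc {..<n} (edge_matrix (multipartite_edges k (V n)) (\<lambda>_. 1)))"
    \<comment> \<open>Here C = 0 and the energy is the constant \<open>Q n\<close>, only O(n). When
      \<open>\<epsilon> n\<close> is nonzero, this choice makes the quotient exactly
      \<open>N n\<close>, which lies between the bounds because \<open>S n\<close> is
      nonnegative.\<close>
    define \<epsilon> where "\<epsilon> = (\<lambda>n. Q n / N n)"
    have Q: "0 \<le> Q n" "Q n \<le> 2 * real n" for n
    proof -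
      have nn: "0 \<le> nuc {..<n} (edge_matrix (multipartite_edges k (V n)) (\<lambda>_. 1))"
        by (intro nuc_nonneg) simp
      then show "0 \<le> Q n" by (simp add: Q_def)
      have "Q n \<le> 1 * (2 * real n)"
        unfolding Q_def
      proof (rule mult_mono)
        show "nuc {..<n} (edge_matrix (multipartite_edges k (V n)) (\<lambda>_. 1)) \<le> 2 * real n"
          using vertex_partition.nuc_multipartite_le[OF partition[of n]] by simp
      qed (use pq nn in auto)
      then show "Q n \<le> 2 * real n" by simp
    qed
    have "(\<lambda>n. 2 * real n / real n powr (3/2)) \<longlonglongrightarrow> 0" by real_asymp
    then have "\<epsilon> \<longlonglongrightarrow> 0"
    proof (rule Lim_null_comparison[rotated])
      show "eventually (\<lambda>n. norm (\<epsilon> n) \<le> 2 * real n / real n powr (3/2)) sequentially"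
        using Q by (intro always_eventually) (auto simp: \<epsilon>_def N_def divide_right_mono)
    qed
    moreover have "measure_pmf.prob (P n) (good \<epsilon> n) = 1" for n
    proof -
      have E: "energy n G = Q n" if "G \<in> set_pmf (P n)" for G
        using energy_degenerate[OF pq partition _ that[unfolded P_def]] True by (simp add: v_def Q_def)
      have "G \<in> good \<epsilon> n" if G: "G \<in> set_pmf (P n)" for G
      proof (cases "\<epsilon> n = 0")
        case True
        \<comment> \<open>At n = 0 the quotient vanishes only because \<open>N n\<close> is 0; the
          bound on \<open>Q\<close> still gives energy 0.\<close>
        then have "Q n = 0 \<or> n = 0" by (auto simp: \<epsilon>_def N_def)
        then have "Q n = 0" using Q[of n] by auto
        then show ?thesis using True \<open>v = 0\<close> E[OF G] by (simp add: good_def C_def)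
      next
        case False
        then have "Q n * inverse (\<epsilon> n) = N n" by (simp add: \<epsilon>_def)
        moreover have "N n * (1 - S n) \<le> N n * 1" "N n * 1 \<le> N n * (1 + S n)"
          using S_nonneg[of n] by (intro mult_left_mono; simp add: N_def)+
        ultimately show ?thesis using False \<open>v = 0\<close> E[OF G] by (simp add: good_def C_def)
      qed
      then show ?thesis by (simp add: measure_pmf.prob_eq_1 AE_measure_pmf_iff)
    qed
    ultimately show ?thesis by (intro exI[of _ \<epsilon>]) simp
  next
    case False
    then have v: "v > 0" using v_nonneg by simp
    have C: "C > 0" using v by (simp add: C_def)
    have "\<forall>i\<in>{1..k}. \<exists>b>0. \<beta> i \<longlonglongrightarrow> b"
      using \<beta>_lim by (intro ballI)
    from bchoice[OF this] obtain b where "\<forall>i\<in>{1..k}. 0 < b i \<and> \<beta> i \<longlonglongrightarrow> b i"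
      by (elim exE)
    then have b: "\<And>i. i \<in> {1..k} \<Longrightarrow> b i > 0" "\<And>i. i \<in> {1..k} \<Longrightarrow> \<beta> i \<longlonglongrightarrow> b i"
      by simp_all
    have sum_lim: "(\<lambda>n. \<Sum>i\<in>{1..k}. \<beta> i n) \<longlonglongrightarrow> (\<Sum>i\<in>{1..k}. b i)"
      by (intro tendsto_sum b)
    \<comment> \<open>Only for n > 0, as the part sizes say nothing about \<beta> at n = 0.\<close>
    have sum_1: "eventually (\<lambda>n. (\<Sum>i\<in>{1..k}. \<beta> i n) = 1) sequentially"
      using eventually_gt_at_top[of 0]
    proof eventually_elim
      case (elim n)
      have "real n * (\<Sum>i\<in>{1..k}. \<beta> i n) = (\<Sum>i\<in>{1..k}. real (card (V n i)))"
        unfolding sum_distrib_left by (intro sum.cong refl) (simp only: parts_card)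
      also have "\<dots> = real n"
        using vertex_partition.sum_card_parts[OF partition[of n]] by (simp flip: of_nat_sum)
      finally show ?case using elim by simp
    qed
    have sum_b: "(\<Sum>i\<in>{1..k}. b i) = 1"
      by (rule LIMSEQ_unique[OF sum_lim tendsto_eventually[OF sum_1]])
    define s where "s = (\<Sum>i\<in>{1..k}. b i powr (3/2))"
    have s: "0 < s" "s < 1"
      unfolding s_def using sum_powr_limit[OF k b(1) sum_b] by auto
    have pow_lim: "(\<lambda>n. \<beta> i n powr (3/2)) \<longlonglongrightarrow> b i powr (3/2)" if "i \<in> {1..k}" for i
      using b[OF that] by (intro tendsto_powr tendsto_const) auto
    have S_lim: "S \<longlonglongrightarrow> s"
      unfolding S_def s_def by (intro tendsto_sum pow_lim)

    define m where "m = (\<lambda>n. mean_nuc {..<n} None / N n)"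
    define r where "r = (\<lambda>n. (\<Sum>i\<in>{1..k}. mean_nuc (V n i) None) / N n)"
    have m_lim: "m \<longlonglongrightarrow> C"
      using mean_nuc_limit[of "\<lambda>n. {..<n}" None] v by (simp add: m_def N_def C_def filterlim_ident)
    have part_lim: "(\<lambda>n. mean_nuc (V n i) None / N n) \<longlonglongrightarrow> C * b i powr (3/2)" if i: "i \<in> {1..k}" for i
    proof -
      have fin: "finite (V n i)" for n
        using vertex_partition.part_subset[OF partition[of n] i] finite_subset by blast
      have "filterlim (\<lambda>n. \<beta> i n * real n) at_top sequentially"
        by (rule filterlim_tendsto_pos_mult_at_top[OF b(2)[OF i] b(1)[OF i] filterlim_real_sequentially])
      then have "filterlim (\<lambda>n. real (card (V n i))) at_top sequentially"
        by (simp add: parts_card[OF i] mult.commute)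
      then have "filterlim (\<lambda>n. card (V n i)) at_top sequentially"
        by (rule real_asymp_real_nat_transfer)
      from tendsto_mult[OF mean_nuc_limit[OF fin this v, of None] pow_lim[OF i]]
      \<comment> \<open>The part has \<open>real n * \<beta> i n\<close> vertices, so the powers of
        \<beta> cancel and \<open>N n\<close> remains as denominator.\<close>
      have "(\<lambda>n. mean_nuc (V n i) None / real (card (V n i)) powr (3/2) * \<beta> i n powr (3/2)) \<longlonglongrightarrow> C * b i powr (3/2)"
        by (simp add: C_def)
      moreover have "eventually (\<lambda>n. mean_nuc (V n i) None / real (card (V n i)) powr (3/2) * \<beta> i n powr (3/2) = mean_nuc (V n i) None / N n) sequentially"
        using order_tendstoD(1)[OF b(2)[OF i] b(1)[OF i]] eventually_gt_at_top[of 0]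
      proof eventually_elim
        case (elim n)
        then show ?case
          by (simp add: parts_card[OF i] powr_mult N_def)
      qed
      ultimately show ?thesis by (rule Lim_transform_eventually)
    qed
    have "r \<longlonglongrightarrow> (\<Sum>i\<in>{1..k}. C * b i powr (3/2))"
      unfolding r_def sum_divide_distrib by (intro tendsto_sum part_lim)
    then have r_lim: "r \<longlonglongrightarrow> C * s" by (simp add: s_def sum_distrib_left)

    define e where "e = (\<lambda>n. measure_pmf.expectation (P n) (energy n) / N n)"
    \<comment> \<open>The tolerated fluctuation is n^(-1/4) in units of \<open>N n\<close>, that is
      n^(5/4): far above the bound 4 n on the standard deviation, far below n^(3/2). Chebyshev then
      leaves a failure probability of 16 / sqrt n.\<close>
    define \<rho> where "\<rho> = (\<lambda>n. real n powr (-1/4))"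
    \<comment> \<open>One tolerance for two purposes: it bounds the error of the mean
      \<open>e\<close>, and through \<open>\<rho>\<close> also the distance from a typical
      normalised energy to \<open>e\<close>.\<close>
    define \<delta> where "\<delta> = (\<lambda>n. \<bar>m n - C\<bar> + \<bar>r n - C * S n\<bar> + 2 * real n / N n + \<rho> n)"
    have "(\<lambda>n. 2 * real n / N n) \<longlonglongrightarrow> 0" unfolding N_def by real_asymp
    moreover have "\<rho> \<longlonglongrightarrow> 0" unfolding \<rho>_def by real_asymp
    ultimately have "\<delta> \<longlonglongrightarrow> \<bar>C - C\<bar> + \<bar>C * s - C * s\<bar> + 0 + 0"
      unfolding \<delta>_def by (intro tendsto_intros m_lim r_lim S_lim)
    then have \<delta>: "\<delta> \<longlonglongrightarrow> 0" by simp
    have \<delta>_nonneg: "\<delta> n \<ge> 0" for n by (simp add: \<delta>_def N_def \<rho>_def)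
    have "eventually (\<lambda>n. (1 - S n) * C - \<delta> n \<le> e n \<and> e n \<le> (1 + S n) * C + \<delta> n) sequentially"
      using N_pos
    proof eventually_elim
      case (elim n)
      have "\<bar>measure_pmf.expectation (P n) (energy n) - mean_nuc {..<n} None\<bar> \<le> 2 * real n + (\<Sum>i\<in>{1..k}. mean_nuc (V n i) None)"
        using mean_energy[OF pq partition[of n]] by (simp add: P_def)
      then have "\<bar>measure_pmf.expectation (P n) (energy n) - mean_nuc {..<n} None\<bar> / N n \<le> (2 * real n + (\<Sum>i\<in>{1..k}. mean_nuc (V n i) None)) / N n"
        using elim by (intro divide_right_mono) auto
      moreover have "\<bar>measure_pmf.expectation (P n) (energy n) - mean_nuc {..<n} None\<bar> / N n = \<bar>e n - m n\<bar>"
        using elim by (simp add: e_def m_def flip: diff_divide_distrib)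
      ultimately have "\<bar>e n - m n\<bar> \<le> 2 * real n / N n + r n"
        by (simp add: add_divide_distrib r_def)
      then have em: "e n - m n \<le> 2 * real n / N n + r n" "m n - e n \<le> 2 * real n / N n + r n"
        unfolding abs_le_iff by simp_all
      define x where "x = \<bar>m n - C\<bar>"
      define z where "z = \<bar>r n - C * S n\<bar>"
      have x: "m n - C \<le> x" "C - m n \<le> x" and z: "r n - C * S n \<le> z"
        by (simp_all add: x_def z_def)
      have "0 \<le> \<rho> n" by (simp add: \<rho>_def)
      then have \<delta>n: "x + z + 2 * real n / N n \<le> \<delta> n"
        unfolding \<delta>_def x_def z_def by simp
      have CS: "(1 - S n) * C = C - C * S n" "(1 + S n) * C = C + C * S n"
        by (simp_all add: algebra_simps)
      show ?case
        unfolding CS using em x z \<delta>n by (intro conjI; linarith)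
    qed
    from common_error_sequence[OF C S_lim s \<delta> \<delta>_nonneg this]
    obtain \<epsilon> where \<epsilon>: "\<epsilon> \<longlonglongrightarrow> 0" and ev: "eventually (\<lambda>n. C + \<epsilon> n > 0 \<and>
      (\<forall>x. \<bar>x - e n\<bar> \<le> \<delta> n \<longrightarrow> (1 - S n) * (C + \<epsilon> n) \<le> x \<and> x \<le> (1 + S n) * (C + \<epsilon> n))) sequentially"
      by blast
    have "(\<lambda>n. measure_pmf.prob (P n) (good \<epsilon> n)) \<longlonglongrightarrow> 1"
    proof (rule tendsto_sandwich)
      show "(\<lambda>n. 1 - 16 / sqrt (real n)) \<longlonglongrightarrow> 1" by real_asymp
      show "(\<lambda>n. 1 :: real) \<longlonglongrightarrow> 1" by simp
      show "eventually (\<lambda>n. measure_pmf.prob (P n) (good \<epsilon> n) \<le> 1) sequentially"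
        by simp
      show "eventually (\<lambda>n. 1 - 16 / sqrt (real n) \<le> measure_pmf.prob (P n) (good \<epsilon> n)) sequentially"
        using ev N_pos eventually_gt_at_top[of 0]
      proof eventually_elim
        case (elim n)
        define a where "a = N n * \<rho> n"
        have a: "a > 0" using elim by (simp add: a_def \<rho>_def)
        have "a = real n powr (5/4)"
          by (simp add: a_def N_def \<rho>_def flip: powr_add)
        then have "a\<^sup>2 = real n powr (5/4 + 5/4)"
          unfolding powr_add by (simp only: power2_eq_square)
        also have "\<dots> = real n powr (2 + 1/2)" by simp
        also have "\<dots> = (real n)\<^sup>2 * sqrt (real n)"
          unfolding powr_add using elim by (simp add: powr_half_sqrt powr_numeral)
        finally have "a\<^sup>2 = (real n)\<^sup>2 * sqrt (real n)" .
        then have "16 * (real n)\<^sup>2 / a\<^sup>2 = 16 / sqrt (real n)"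
          using elim by simp
        then have "1 - 16 / sqrt (real n) \<le> measure_pmf.prob (P n) {G. \<bar>energy n G - measure_pmf.expectation (P n) (energy n)\<bar> < a}"
          using energy_concentration[OF pq partition[of n] a] by (simp add: P_def)
        also have "\<dots> \<le> measure_pmf.prob (P n) (good \<epsilon> n)"
        proof (rule measure_pmf.finite_measure_mono)
          show "{G. \<bar>energy n G - measure_pmf.expectation (P n) (energy n)\<bar> < a} \<subseteq> good \<epsilon> n"
          proof
            fix G assume "G \<in> {G. \<bar>energy n G - measure_pmf.expectation (P n) (energy n)\<bar> < a}"
            then have "\<bar>energy n G - measure_pmf.expectation (P n) (energy n)\<bar> / N n < a / N n"
              using elim by (intro divide_strict_right_mono) auto
            moreover have "\<bar>energy n G - measure_pmf.expectation (P n) (energy n)\<bar> / N n = \<bar>energy n G / N n - e n\<bar>"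
              using elim by (simp add: e_def flip: diff_divide_distrib)
            moreover have "a / N n = \<rho> n" using elim by (simp add: a_def)
            moreover have "\<rho> n \<le> \<delta> n" by (simp add: \<delta>_def N_def)
            ultimately have "\<bar>energy n G / N n - e n\<bar> \<le> \<delta> n" by linarith
            then have "(1 - S n) * (C + \<epsilon> n) \<le> energy n G / N n \<and> energy n G / N n \<le> (1 + S n) * (C + \<epsilon> n)"
              using elim(1) by blast
            then show "G \<in> good \<epsilon> n"
              using elim(1,2) by (simp add: good_def divide_inverse[symmetric] pos_le_divide_eq pos_divide_le_eq mult_ac)
          qed
        qed simp
        finally show ?case .
      qed
    qed
    with \<epsilon> show ?thesis by blast
  qed
  then show ?thesis
    unfolding good_def P_def N_def S_def C_def v_def Let_def .
qed

end
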